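(* Let $\{\epsilon_n\}_{n\in\mathbb{N}}$ and $\{t_n\}_{n\in\mathbb{N}}$ be sequences with $t_n>0$ and $\epsilon_n=1-e^{-t_n}$ for every $n$, and let $f_n:\{0,1\}^{V_n}\to\{-1,1\}$ be a sequence of functions satisfying $\lim_{n\to\infty}I\!I(f_n)=0$. Then $\{f_n\}_{n\in\mathbb{N}}$ is NS with respect to $\{\epsilon_n\}_{n\in\mathbb{N}}$ if and only if it is CGXS with respect to $\{t_n\}_{n\in\mathbb{N}}$.
   Context: $\{V_n\}$ is an increasing sequence of finite sets. For $f:\{0,1\}^{V}\to\{-1,1\}$ and $\omega$ uniform on $\{0,1\}^{V}$, the influence of $i\in V$ is $I_i(f)=\mathbb{P}(f(\omega)\ne f(\omega_i))$, where $\omega_i$ is $\omega$ with the $i$th bit flipped, and $I\!I(f):=\sum_{i\in V}I_i(f)^2$. Let $\omega$ be uniform on $\{0,1\}^{V_n}$; for $\epsilon\in(0,1)$, $\omega^\epsilon$ is obtained from $\omega$ by resampling each coordinate (as a fair bit) independently with probability $\epsilon$. $\{f_n\}$ is NS with respect to $\{\epsilon_n\}$ if $\lim_{n\to\infty}\mathbb{E}[f_n(\omega)f_n(\omega^{\epsilon_n})]-\mathbb{E}[f_n(\omega)]^2=0$. Complete graph exclusion process on $V_n$: to every unordered pair of distinct elements of $V_n$ associate an independent Poisson clock of rate $1/|V_n|$; when it rings, the two elements are interchanged. $\pi^n_t$ is the random permutation of $V_n$ obtained by composing, in order, all transpositions up to time $t$. With $\eta^n_0$ uniform on $\{0,1\}^{V_n}$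 and independent of the clocks, $\eta^n_t(x)=\eta^n_0((\pi^n_t)^{-1}(x))$. $\{f_n\}$ is CGXS with respect to $\{t_n\}$ if $\lim_{n\to\infty}\mathbb{E}[f_n(\eta^n_0)f_n(\eta^n_{t_n})]-\mathbb{E}[f_n(\eta^n_0)]^2=0$. *)

theory Defs
  imports "HOL-Probability.Probability" "HOL-Combinatorics.Transposition"
begin

text \<open>The cube \<open>{0,1}\<^sup>V\<close>, as extensional functions on \<open>V\<close>.\<close>

definition cube :: "'a set \<Rightarrow> ('a \<Rightarrow> bool) set" where
  "cube V = V \<rightarrow>\<^sub>E UNIV"

abbreviation unif_cube :: "'a set \<Rightarrow> ('a \<Rightarrow> bool) pmf" where
  "unif_cube V \<equiv> pmf_of_set (cube V)"

definition influence :: "'a set \<Rightarrow> (('a \<Rightarrow> bool) \<Rightarrow> real) \<Rightarrow> 'a \<Rightarrow> real" where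
  "influence V f i = measure_pmf.prob (unif_cube V) {\<xi>. f \<xi> \<noteq> f (\<xi>(i := \<not> \<xi> i))}"

definition II :: "'a set \<Rightarrow> (('a \<Rightarrow> bool) \<Rightarrow> real) \<Rightarrow> real" where
  "II V f = (\<Sum>i\<in>V. (influence V f i)\<^sup>2)"

text \<open>Joint law of \<open>(\<omega>, \<omega>\<^sup>\<epsilon>)\<close>: \<open>B\<close> marks the resampled coordinates and \<open>\<omega>'\<close> supplies
  the fresh bits.  Off \<open>V\<close> the marking is \<open>False\<close>, so the second component stays in the cube.\<close>

definition noise_pair :: "'a set \<Rightarrow> real \<Rightarrow> (('a \<Rightarrow> bool) \<times> ('a \<Rightarrow> bool)) pmf" where
  "noise_pair V \<epsilon> =
     bind_pmf (unif_cube V) (\<lambda>\<omega>.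
     bind_pmf (unif_cube V) (\<lambda>\<omega>'.
     bind_pmf (Pi_pmf V False (\<lambda>_. bernoulli_pmf \<epsilon>)) (\<lambda>B.
     return_pmf (\<omega>, \<lambda>x. if B x then \<omega>' x else \<omega> x))))"

definition NS :: "(nat \<Rightarrow> 'a set) \<Rightarrow> (nat \<Rightarrow> ('a \<Rightarrow> bool) \<Rightarrow> real) \<Rightarrow> (nat \<Rightarrow> real) \<Rightarrow> bool" where
  "NS V f \<epsilon> \<longleftrightarrow>
     (\<lambda>n. measure_pmf.expectation (noise_pair (V n) (\<epsilon> n)) (\<lambda>(\<omega>, \<omega>\<epsilon>). f n \<omega> * f n \<omega>\<epsilon>)
        - (measure_pmf.expectation (unif_cube (V n)) (f n))\<^sup>2) \<longlonglongrightarrow> 0"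

definition unordered_pairs :: "'a set \<Rightarrow> 'a set set" where
  "unordered_pairs V = {{x, y} | x y. x \<in> V \<and> y \<in> V \<and> x \<noteq> y}"

text \<open>The transposition that interchanges the two elements of an unordered pair.\<close>

definition pair_swap :: "'a set \<Rightarrow> 'a \<Rightarrow> 'a" where
  "pair_swap e = (THE \<tau>. \<exists>x y. e = {x, y} \<and> \<tau> = Transposition.transpose x y)"

text \<open>A Poisson clock is given by its random set \<open>T\<close> of ring times.  It is a Poisson process:
  the ring times are positive and locally finite, the number of rings in \<open>(a, b]\<close> is Poisson
  with parameter \<open>r (b - a)\<close>, and the numbers of rings in successive intervals are independent.\<close>

definition (in prob_space) poisson_clock :: "real \<Rightarrow> ('a \<Rightarrow> real set) \<Rightarrow> bool" where
  "poisson_clock r T \<longleftrightarrow>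
     (\<forall>\<omega>\<in>space M. T \<omega> \<subseteq> {0<..} \<and> (\<forall>t. finite (T \<omega> \<inter> {..t}))) \<and>
     (\<forall>a b. 0 \<le> a \<longrightarrow> a < b \<longrightarrow>
        distr M (count_space UNIV) (\<lambda>\<omega>. card (T \<omega> \<inter> {a<..b})) =
        measure_pmf (poisson_pmf (r * (b - a)))) \<and>
     (\<forall>\<tau> :: nat \<Rightarrow> real. 0 \<le> \<tau> 0 \<longrightarrow> incseq \<tau> \<longrightarrow>
        indep_vars (\<lambda>_. count_space UNIV) (\<lambda>i \<omega>. card (T \<omega> \<inter> {\<tau> i<..\<tau> (Suc i)})) UNIV)"

text \<open>The sample path \<open>t \<mapsto> N\<^sub>t\<close> (number of rings up to time \<open>t\<close>) of a clock; it determines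
  the ring times.\<close>

definition ring_count :: "real set \<Rightarrow> real \<Rightarrow> nat" where
  "ring_count S = (\<lambda>t\<in>{0..}. card (S \<inter> {0<..t}))"

abbreviation path_space :: "(real \<Rightarrow> nat) measure" where
  "path_space \<equiv> (\<Pi>\<^sub>M t\<in>{0..}. count_space UNIV)"

text \<open>The data driving a complete graph exclusion process: \<open>R e\<close> is the clock of the
  pair \<open>e\<close> and \<open>\<eta>0\<close> is the initial configuration.  The latter and the family of all
  clocks have different types, so their independence is stated for the generated \<open>\<sigma>\<close>-algebras.\<close>

locale complete_graph_exclusion = prob_space M
  for M :: "'w measure" +
  fixes V :: "'a set"
    and R :: "'a set \<Rightarrow> 'w \<Rightarrow> real set"
    and \<eta>0 :: "'w \<Rightarrow> 'a \<Rightarrow> bool"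
  assumes clocks: "\<And>e. e \<in> unordered_pairs V \<Longrightarrow> poisson_clock (1 / real (card V)) (R e)"
    and indep_clocks:
      "indep_vars (\<lambda>_. path_space) (\<lambda>e \<omega>. ring_count (R e \<omega>)) (unordered_pairs V)"
    and initial_uniform: "distr M (count_space UNIV) \<eta>0 = measure_pmf (unif_cube V)"
    and initial_measurable: "\<eta>0 \<in> M \<rightarrow>\<^sub>M count_space UNIV"
    and initial_indep:
      "indep_set
         (sets (vimage_algebra (space M) \<eta>0 (count_space UNIV)))
         (sets (vimage_algebra (space M)
           (\<lambda>\<omega>. \<lambda>e\<in>unordered_pairs V. ring_count (R e \<omega>))
           (\<Pi>\<^sub>M e\<in>unordered_pairs V. path_space)))"

text \<open>Below, \<open>C e\<close> is a realised set of ring times of the pair \<open>e\<close>.  Almost surely no two clocks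
  ring simultaneously; \<open>SOME\<close> only matters on the null event where they do.\<close>

definition ringing_pair :: "'a set \<Rightarrow> ('a set \<Rightarrow> real set) \<Rightarrow> real \<Rightarrow> 'a set" where
  "ringing_pair V C s = (SOME e. e \<in> unordered_pairs V \<and> s \<in> C e)"

text \<open>\<open>\<pi>\<^sub>t = \<tau>\<^sub>k \<circ> \<dots> \<circ> \<tau>\<^sub>1\<close>, where \<open>\<tau>\<^sub>1, \<dots>, \<tau>\<^sub>k\<close> are the transpositions up to time \<open>t\<close> in
  chronological order.\<close>

definition interchange_perm :: "'a set \<Rightarrow> ('a set \<Rightarrow> real set) \<Rightarrow> real \<Rightarrow> 'a \<Rightarrow> 'a" where
  "interchange_perm V C t =
     fold (\<lambda>s \<pi>. pair_swap (ringing_pair V C s) \<circ> \<pi>)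
       (sorted_list_of_set ((\<Union>e\<in>unordered_pairs V. C e) \<inter> {0<..t})) id"

definition exclusion ::
    "'a set \<Rightarrow> ('a set \<Rightarrow> 'w \<Rightarrow> real set) \<Rightarrow> ('w \<Rightarrow> 'a \<Rightarrow> bool) \<Rightarrow> real \<Rightarrow> 'w \<Rightarrow> 'a \<Rightarrow> bool" where
  "exclusion V R \<eta>0 t \<omega> = (\<lambda>x. \<eta>0 \<omega> (inv (interchange_perm V (\<lambda>e. R e \<omega>) t) x))"

definition CGXS ::
    "(nat \<Rightarrow> 'w measure) \<Rightarrow> (nat \<Rightarrow> 'a set) \<Rightarrow> (nat \<Rightarrow> 'a set \<Rightarrow> 'w \<Rightarrow> real set) \<Rightarrow>
     (nat \<Rightarrow> 'w \<Rightarrow> 'a \<Rightarrow> bool) \<Rightarrow> (nat \<Rightarrow> ('a \<Rightarrow> bool) \<Rightarrow> real) \<Rightarrow> (nat \<Rightarrow> real) \<Rightarrow> bool" where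
  "CGXS M V R \<eta>0 f t \<longleftrightarrow>
     (\<lambda>n. (\<integral>\<omega>. f n (exclusion (V n) (R n) (\<eta>0 n) 0 \<omega>)
               * f n (exclusion (V n) (R n) (\<eta>0 n) (t n) \<omega>) \<partial>M n)
        - (\<integral>\<omega>. f n (exclusion (V n) (R n) (\<eta>0 n) 0 \<omega>) \<partial>M n)\<^sup>2) \<longlonglongrightarrow> 0"

end

theory Submission
  imports Defs
begin

text \<open>
  Identify configurations with subsets of \<open>V\<close>, \<open>|V| = n\<close>.  By Cauchy-Schwarz the total influence of \<open>f\<close>
  is at most \<open>sqrt n * sqrt II\<close>, so altering \<open>O(sqrt n)\<close> suitably random bits of a uniform configuration
  changes \<open>f\<close> with probability \<open>O(sqrt II)\<close>.  Both \<open>(\<omega>, \<omega>\<^sup>\<epsilon>)\<close> and \<open>(\<eta>\<^sub>0, \<eta>\<^sub>t)\<close> have a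
  permutation invariant law with uniform first component, hence the correlation of \<open>f\<close> depends only on the law
  of \<open>(|A|, |A - B|, |B - A|)\<close>.  For \<open>\<epsilon> = 1 - exp (- t)\<close>, in both cases \<open>|A - B|\<close> and \<open>|B - A|\<close> are
  within \<open>O(sqrt n)\<close> of \<open>\<epsilon> m (n - m) / n\<close>, where \<open>m = |A|\<close> is within \<open>O(sqrt n)\<close> of \<open>n / 2\<close>:
  for the exclusion process the overlap \<open>|A \<inter> \<pi> A|\<close> has linear drift with rate \<open>1\<close> and its variance stays
  below \<open>n / 4\<close>.  Therefore the two correlations differ by \<open>o(1)\<close>, uniformly in \<open>t\<close>.
\<close>

section \<open>Correlations averaged over permutations\<close>

text \<open>Given its size, a permutation invariant configuration is uniform on a slice, not on the
  cube, and the influences say nothing about a single slice. They control the sum over the O(sqrt n)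
  central slices: each carries normalised edge mass at least \<open>c * sqrt n\<close> (binomial
  weight of order 1 / sqrt n, times n - u of order n), whereas the pivotal edges have total mass at
  most \<open>sqrt n * sqrt II\<close>. So a pair is moved to the reference type by shifting one
  endpoint of an interval at a time; the sizes are then monotone during a move and no slice is
  charged twice. The link between noise level and time comes from the overlap q of A and its image:
  summed over all pairs, a swap changes q by m^2 - n q, which at rate 1 / n is relaxation at rate 1
  towards m^2 / n. From q = m this gives |A - B| the mean (1 - exp (- t)) (m - m^2 / n). Squared
  jumps accumulate at rate at most n / 2 against contraction at rate 2, whence n / 4. The law of the
  permutation is not derived from a generator: Poisson counts on a time grid give words of
  transpositions, whose total mass tends to 1 as the grid is refined.\<close>

lemma ex_permutes_colour:
  fixes c c' :: "'a \<Rightarrow> 'c"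
  assumes fin: "finite V"
    and eq: "\<And>k. card {x \<in> V. c x = k} = card {x \<in> V. c' x = k}"
  obtains h where "h permutes V" and "\<And>x. x \<in> V \<Longrightarrow> c' (h x) = c x"
proof -
  have "\<exists>g. bij_betw g {x \<in> V. c x = k} {x \<in> V. c' x = k}" for k
    using fin eq by (intro finite_same_card_bij) auto
  then obtain g where g: "\<And>k. bij_betw (g k) {x \<in> V. c x = k} {x \<in> V. c' x = k}"
    by metis
  define h where "h = (\<lambda>x. if x \<in> V then g (c x) x else x)"
  have h: "h x \<in> V" "c' (h x) = c x" if "x \<in> V" for x
    using bij_betwE[OF g[of "c x"]] that by (auto simp: h_def)
  have "inj_on h V"
  proof (rule inj_onI)
    fix x y assume xy: "x \<in> V" "y \<in> V" "h x = h y"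
    then have "c x = c y" by (metis h(2))
    then show "x = y"
      using xy bij_betw_imp_inj_on[OF g[of "c x"]] by (auto simp: h_def inj_on_def)
  qed
  then have "bij_betw h V V"
    using h(1) fin by (simp add: bij_betw_def endo_inj_surj image_subsetI)
  then have "h permutes V"
    by (rule bij_imp_permutes) (simp add: h_def)
  then show ?thesis using h(2) that by blast
qed

text \<open>The correlation averaged over the simultaneous orbit of \<open>(A, B)\<close> under the
  symmetric group of \<open>V\<close>; only this average survives summation against a permutation
  invariant kernel.\<close>

definition pair_corr :: "'a set \<Rightarrow> ('a set \<Rightarrow> real) \<Rightarrow> 'a set \<Rightarrow> 'a set \<Rightarrow> real" where
  "pair_corr V G A B = (\<Sum>g | g permutes V. G (g ` A) * G (g ` B)) / fact (card V)"

text \<open>Meant for \<open>x\<close> outside \<open>A\<close>: every edge of the cube is recorded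
  once, at its lower endpoint.\<close>

definition pivotal :: "('a set \<Rightarrow> real) \<Rightarrow> 'a set \<Rightarrow> 'a \<Rightarrow> real" where
  "pivotal G A x = of_bool (G A \<noteq> G (insert x A))"

text \<open>The edges of the cube between layers \<open>s\<close> and \<open>s + 1\<close>, each
  given by its lower endpoint and its direction. \<open>slice_disc\<close> is then the proportion of
  these edges across which \<open>G\<close> changes.\<close>

definition flags :: "'a set \<Rightarrow> nat \<Rightarrow> ('a set \<times> 'a) set" where
  "flags V s = (SIGMA A:{A. A \<subseteq> V \<and> card A = s}. V - A)"

definition slice_disc :: "'a set \<Rightarrow> ('a set \<Rightarrow> real) \<Rightarrow> nat \<Rightarrow> real" where
  "slice_disc V G s = (\<Sum>(A, x)\<in>flags V s. pivotal G A x) / card (flags V s)"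

lemma pivotal_nonneg [simp]: "0 \<le> pivotal G A x"
  by (simp add: pivotal_def)

lemma slice_disc_nonneg: "0 \<le> slice_disc V G s"
  unfolding slice_disc_def by (intro divide_nonneg_nonneg sum_nonneg) auto

lemma sum_permutes_right:
  assumes "h permutes V"
  shows "(\<Sum>g | g permutes V. \<phi> (g \<circ> h)) = (\<Sum>g | g permutes V. \<phi> g)"
  by (rule sum.reindex_bij_witness[where i = "\<lambda>g. g \<circ> inv h" and j = "\<lambda>g. g \<circ> h"])
     (use assms in \<open>auto intro: permutes_compose permutes_inv simp: o_assoc permutes_inv_o
        simp flip: comp_assoc\<close>, auto simp: comp_assoc permutes_inv_o)

lemma finite_flags: "finite V \<Longrightarrow> finite (flags V s)"
  by (auto simp: flags_def intro!: finite_SigmaI)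

lemma card_flags:
  assumes "finite V"
  shows "card (flags V s) = (card V choose s) * (card V - s)"
proof -
  have "card (flags V s) = (\<Sum>A | A \<subseteq> V \<and> card A = s. card (V - A))"
    unfolding flags_def using assms by (subst card_SigmaI) auto
  also have "\<dots> = (\<Sum>A | A \<subseteq> V \<and> card A = s. card V - s)"
    using assms by (intro sum.cong) (auto simp: card_Diff_subset finite_subset)
  finally show ?thesis
    using assms by (simp add: n_subsets)
qed

lemma permutes_image_subset: "g permutes V \<Longrightarrow> A \<subseteq> V \<Longrightarrow> g ` A \<subseteq> V"
  by (auto simp: permutes_in_image)

lemma card_permutes_image: "g permutes V \<Longrightarrow> card (g ` A) = card A"
  by (intro card_image) (meson permutes_inj_on)

lemma permutes_image_inv: "g permutes V \<Longrightarrow> inv g ` g ` A = A"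
  "g permutes V \<Longrightarrow> g ` inv g ` A = A"
  by (auto simp: image_comp permutes_inv_o)

lemma sum_flags_permute:
  assumes "g permutes V"
  shows "(\<Sum>(A, x)\<in>flags V s. \<phi> (g ` A) (g x)) = (\<Sum>(A, x)\<in>flags V s. \<phi> A x)"
proof -
  note inv = permutes_inv[OF assms]
  have fl: "(h ` A, h x) \<in> flags V s" if "h permutes V" "(A, x) \<in> flags V s" for h A x
    using that permutes_image_subset[OF that(1), of A]
    by (auto simp: flags_def card_permutes_image permutes_in_image
        inj_image_mem_iff[OF permutes_inj])
  show ?thesis
    by (rule sum.reindex_bij_witness[where i = "\<lambda>p. (inv g ` fst p, inv g (snd p))"
          and j = "\<lambda>p. (g ` fst p, g (snd p))"])
       (use fl[OF assms] fl[OF inv] in \<open>auto simp: permutes_image_inv[OF assms]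
          permutes_inverses[OF assms] split: prod.splits\<close>)
qed

text \<open>The symmetric group acts transitively on flags of one size, so the left side is the same
  for all of them. Summing it over all flags and exchanging the sums evaluates it, because each
  permutation merely rearranges the flags.\<close>

lemma sum_pivotal_permutes:
  assumes fin: "finite V" and A: "A \<subseteq> V" "x \<in> V - A"
  shows "(\<Sum>g | g permutes V. pivotal G (g ` A) (g x)) = fact (card V) * slice_disc V G (card A)"
proof -
  define t where "t = (\<lambda>A x. \<Sum>g | g permutes V. pivotal G (g ` A) (g x))"
  let ?F = "flags V (card A)"
  have "t A' x' = t A x" if "(A', x') \<in> ?F" for A' x'
  proof -
    have A': "A' \<subseteq> V" "card A' = card A" "x' \<in> V - A'"
      using that by (auto simp: flags_def)
    \<comment> \<open>The colour of a point is its role in the flag, so a colour preserving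
      permutation carries \<open>(A, x)\<close> to \<open>(A', x')\<close>.\<close>
    define c where "c = (\<lambda>y. (y \<in> A, y = x))"
    define c' where "c' = (\<lambda>y. (y \<in> A', y = x'))"
    have "card {y \<in> V. c y = k} = card {y \<in> V. c' y = k}" for k
    proof -
      consider "k = (True, True)" | "k = (True, False)" | "k = (False, True)" | "k = (False, False)"
        by (metis surj_pair)
      then show ?thesis
      proof cases
        case 1
        then have "{y \<in> V. c y = k} = {}" "{y \<in> V. c' y = k} = {}"
          using A A' by (auto simp: c_def c'_def)
        then show ?thesis by (simp only:)
      next
        case 2
        then have "{y \<in> V. c y = k} = A" "{y \<in> V. c' y = k} = A'"
          using A A' by (auto simp: c_def c'_def)
        then show ?thesis using A' by simp
      next
        case 3
        then have "{y \<in> V. c y = k} = {x}" "{y \<in> V. c' y = k} = {x'}"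
          using A A' by (auto simp: c_def c'_def)
        then show ?thesis by simp
      next
        case 4
        then have "{y \<in> V. c y = k} = V - insert x A" "{y \<in> V. c' y = k} = V - insert x' A'"
          using A A' by (auto simp: c_def c'_def)
        then show ?thesis
          using A A' fin by (simp add: card_Diff_subset finite_subset)
      qed
    qed
    then obtain h where h: "h permutes V" "\<And>y. y \<in> V \<Longrightarrow> c' (h y) = c y"
      using ex_permutes_colour[OF fin, of c c'] by metis
    have hx: "h x = x'"
      using h(2)[of x] A by (auto simp: c_def c'_def)
    have "h ` A \<subseteq> A'"
      using h(2) A by (auto simp: c_def c'_def)
    then have hA: "h ` A = A'"
      using A' fin card_permutes_image[OF h(1), of A] by (metis card_subset_eq finite_subset)
    show ?thesis
      using sum_permutes_right[OF h(1), of "\<lambda>g. pivotal G (g ` A) (g x)"]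
      unfolding t_def image_comp[symmetric] comp_apply hx hA .
  qed
  then have "(\<Sum>(A', x')\<in>?F. t A' x') = card ?F * t A x"
    by (subst sum.cong[OF refl, of _ _ "\<lambda>_. t A x"]) auto
  moreover have "(\<Sum>(A', x')\<in>?F. t A' x') = fact (card V) * (\<Sum>(A', x')\<in>?F. pivotal G A' x')"
  proof -
    have "(\<Sum>(A', x')\<in>?F. t A' x')
        = (\<Sum>g | g permutes V. \<Sum>(A', x')\<in>?F. pivotal G (g ` A') (g x'))"
      unfolding t_def by (simp add: case_prod_unfold) (rule sum.swap)
    also have "\<dots> = (\<Sum>g | g permutes V. \<Sum>(A', x')\<in>?F. pivotal G A' x')"
      by (intro sum.cong[OF refl] sum_flags_permute) simp
    also have "\<dots> = fact (card V) * (\<Sum>(A', x')\<in>?F. pivotal G A' x')"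
      using fin by (simp add: card_permutations)
    finally show ?thesis .
  qed
  moreover have "card ?F \<noteq> 0"
    using A fin by (auto simp: flags_def card_eq_0_iff finite_flags[unfolded flags_def])
  ultimately show ?thesis
    by (simp add: slice_disc_def t_def field_simps)
qed

text \<open>The three cardinalities fix the sizes of all four cells cut out by the two sets, so the
  pairs lie in one orbit; right translation by the connecting permutation leaves the average
  unchanged.\<close>

lemma pair_corr_cong_type:
  assumes fin: "finite V" and sub: "A \<subseteq> V" "B \<subseteq> V" "A' \<subseteq> V" "B' \<subseteq> V"
    and card: "card A = card A'" "card (A - B) = card (A' - B')" "card (B - A) = card (B' - A')"
  shows "pair_corr V G A B = pair_corr V G A' B'"
proof -
  note finite_subset[OF _ fin, simp]
  define c where "c = (\<lambda>y. (y \<in> A, y \<in> B))"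
  define c' where "c' = (\<lambda>y. (y \<in> A', y \<in> B'))"
  have sum: "card A = card (A \<inter> B) + card (A - B)" "card A' = card (A' \<inter> B') + card (A' - B')"
    using sub by (auto simp: card_Diff_subset_Int card_mono)
  have "card {y \<in> V. c y = k} = card {y \<in> V. c' y = k}" for k
  proof -
    consider "k = (True, True)" | "k = (True, False)" | "k = (False, True)" | "k = (False, False)"
      by (metis surj_pair)
    then show ?thesis
    proof cases
      case 1
      then have "{y \<in> V. c y = k} = A \<inter> B" "{y \<in> V. c' y = k} = A' \<inter> B'"
        using sub by (auto simp: c_def c'_def)
      then show ?thesis using sum card by simp
    next
      case 2
      then have "{y \<in> V. c y = k} = A - B" "{y \<in> V. c' y = k} = A' - B'"
        using sub by (auto simp: c_def c'_def)
      then show ?thesis using card by simp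
    next
      case 3
      then have "{y \<in> V. c y = k} = B - A" "{y \<in> V. c' y = k} = B' - A'"
        using sub by (auto simp: c_def c'_def)
      then show ?thesis using card by simp
    next
      case 4
      then have eq: "{y \<in> V. c y = k} = V - (A \<union> (B - A))" "{y \<in> V. c' y = k} = V - (A' \<union> (B' - A'))"
        using sub by (auto simp: c_def c'_def)
      have "card (A \<union> (B - A)) = card (A' \<union> (B' - A'))"
        using sub card by (subst (1 2) card_Un_disjoint) auto
      then show ?thesis
        unfolding eq using sub fin by (subst (1 2) card_Diff_subset) auto
    qed
  qed
  then obtain h where h: "h permutes V" "\<And>y. y \<in> V \<Longrightarrow> c' (h y) = c y"
    using ex_permutes_colour[OF fin, of c c'] by metis
  have img: "h ` A = A'" "h ` B = B'"
  proof -
    have "h ` V = V" using h(1) by (rule permutes_image)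
    then show "h ` A = A'" "h ` B = B'"
      using h(2) sub by (auto simp: c_def c'_def image_iff) (metis (no_types, lifting) imageE subsetD)+
  qed
  show ?thesis
    using sum_permutes_right[OF h(1), of "\<lambda>g. G (g ` A) * G (g ` B)"]
    unfolding pair_corr_def image_comp[symmetric] img by simp
qed

lemma pair_corr_insert:
  assumes fin: "finite V" and G: "G \<in> Pow V \<rightarrow> {-1, 1}"
    and "A \<subseteq> V" "B \<subseteq> V" "x \<in> V - B"
  shows "\<bar>pair_corr V G A B - pair_corr V G A (insert x B)\<bar> \<le> 2 * slice_disc V G (card B)"
proof -
  have "\<bar>G (g ` A) * G (g ` B) - G (g ` A) * G (g ` insert x B)\<bar> \<le> 2 * pivotal G (g ` B) (g x)"
    if "g permutes V" for g
  proof -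
    have "G (g ` A) \<in> {-1, 1}" "G (g ` B) \<in> {-1, 1}" "G (insert (g x) (g ` B)) \<in> {-1, 1}"
      using G assms that permutes_image_subset[OF that]
      by (auto simp: Pi_iff permutes_in_image)
    then show ?thesis by (auto simp: pivotal_def)
  qed
  then have "\<bar>\<Sum>g | g permutes V. G (g ` A) * G (g ` B) - G (g ` A) * G (g ` insert x B)\<bar>
      \<le> (\<Sum>g | g permutes V. 2 * pivotal G (g ` B) (g x))"
    by (intro order.trans[OF sum_abs] sum_mono) auto
  also have "\<dots> = 2 * (fact (card V) * slice_disc V G (card B))"
    using assms by (simp add: sum_pivotal_permutes flip: sum_distrib_left)
  finally show ?thesis
    by (simp add: pair_corr_def sum_subtractf field_simps flip: diff_divide_distrib)
qed

section \<open>Interval representatives and paths between types\<close>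

definition ivl :: "(nat \<Rightarrow> 'a) \<Rightarrow> nat \<Rightarrow> nat \<Rightarrow> 'a set" where
  "ivl e a c = e ` {a..<c}"

text \<open>Up to a permutation of \<open>V\<close>, a pair \<open>(A, B)\<close> with \<open>|A| = m\<close>, \<open>|A - B| = a\<close>, \<open>|B - A| = b\<close>
  is the pair of intervals \<open>([0, m), [a, m + b))\<close> of a fixed enumeration \<open>e\<close>.\<close>

definition corr_ivl :: "'a set \<Rightarrow> ('a set \<Rightarrow> real) \<Rightarrow> (nat \<Rightarrow> 'a) \<Rightarrow> nat \<Rightarrow> nat \<Rightarrow> nat \<Rightarrow> real" where
  "corr_ivl V G e m a c = pair_corr V G (ivl e 0 m) (ivl e a c)"

lemma pair_corr_eq_corr_ivl:
  assumes fin: "finite V" and e: "bij_betw e {..<card V} V" and sub: "A \<subseteq> V" "B \<subseteq> V"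
  shows "pair_corr V G A B
    = corr_ivl V G e (card A) (card (A - B)) (card A + card (B - A))"
proof -
  note finite_subset[OF _ fin, simp]
  have inj: "inj_on e {..<card V}" and img: "e ` {..<card V} = V"
    using e by (auto simp: bij_betw_def)
  have a: "card (A - B) \<le> card A"
    by (intro card_mono) (use sub in auto)
  have "card A + card (B - A) = card (A \<union> (B - A))"
    using sub by (subst card_Un_disjoint) auto
  also have "\<dots> \<le> card V"
    using sub fin by (intro card_mono) auto
  finally have n: "card A + card (B - A) \<le> card V" .
  have ivl_sub: "ivl e i j \<subseteq> V" if "j \<le> card V" for i j
    using that img by (auto simp: ivl_def)
  have ivl_card: "card (ivl e i j) = j - i" if "j \<le> card V" for i j
    unfolding ivl_def using inj that by (subst card_image) (auto intro: inj_on_subset)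
  have ivl_diff: "ivl e i j - ivl e k l = e ` ({i..<j} - {k..<l})" if "j \<le> card V" "l \<le> card V" for i j k l
    unfolding ivl_def using inj that by (subst inj_on_image_set_diff[of e "{..<card V}"]) auto
  have "ivl e 0 (card A) - ivl e (card (A - B)) (card A + card (B - A)) = ivl e 0 (card (A - B))"
    "ivl e (card (A - B)) (card A + card (B - A)) - ivl e 0 (card A)
      = ivl e (card A) (card A + card (B - A))"
    using a n by (subst ivl_diff; force simp: ivl_def)+
  then show ?thesis
    unfolding corr_ivl_def using a n
    by (intro pair_corr_cong_type fin sub ivl_sub) (simp_all add: ivl_card)
qed

text \<open>Moving one endpoint by one inserts or deletes a single point of the second interval. The
  cost is charged to the layer of the smaller of the two sets, hence \<open>Suc a\<close> for the
  left endpoint.\<close>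

lemma corr_ivl_step:
  assumes fin: "finite V" and e: "bij_betw e {..<card V} V" and G: "G \<in> Pow V \<rightarrow> {-1, 1}"
    and m: "m \<le> card V"
  shows corr_ivl_Suc_right: "a \<le> c \<Longrightarrow> c < card V \<Longrightarrow>
      \<bar>corr_ivl V G e m a c - corr_ivl V G e m a (Suc c)\<bar> \<le> 2 * slice_disc V G (c - a)"
    and corr_ivl_Suc_left: "a < c \<Longrightarrow> c \<le> card V \<Longrightarrow>
      \<bar>corr_ivl V G e m a c - corr_ivl V G e m (Suc a) c\<bar> \<le> 2 * slice_disc V G (c - Suc a)"
proof -
  have inj: "inj_on e {..<card V}" and img: "e ` {..<card V} = V"
    using e by (auto simp: bij_betw_def)
  have ivl_sub: "ivl e i j \<subseteq> V" if "j \<le> card V" for i j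
    using that img by (auto simp: ivl_def)
  have ivl_card: "card (ivl e i j) = j - i" if "j \<le> card V" for i j
    unfolding ivl_def using inj that by (subst card_image) (auto intro: inj_on_subset)
  have notin: "e i \<notin> ivl e a c" if "i < card V" "c \<le> card V" "i \<notin> {a..<c}" for i a c
  proof
    assume "e i \<in> ivl e a c"
    then obtain j where j: "j \<in> {a..<c}" "e i = e j" by (auto simp: ivl_def)
    then have "i = j" using that by (intro inj_onD[OF inj]) auto
    then show False using j that by simp
  qed
  show "\<bar>corr_ivl V G e m a c - corr_ivl V G e m a (Suc c)\<bar> \<le> 2 * slice_disc V G (c - a)"
    if "a \<le> c" "c < card V"
  proof -
    have "ivl e a (Suc c) = insert (e c) (ivl e a c)"
      using that by (auto simp: ivl_def atLeastLessThanSuc)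
    moreover have "e c \<in> V - ivl e a c" using that img notin[of c c a] by auto
    ultimately show ?thesis
      using pair_corr_insert[OF fin G ivl_sub[OF m, of 0] ivl_sub[of c a], of "e c"] that
      by (simp add: corr_ivl_def ivl_card)
  qed
  show "\<bar>corr_ivl V G e m a c - corr_ivl V G e m (Suc a) c\<bar> \<le> 2 * slice_disc V G (c - Suc a)"
    if "a < c" "c \<le> card V"
  proof -
    have "{a..<c} = insert a {Suc a..<c}" using that by auto
    then have "ivl e a c = insert (e a) (ivl e (Suc a) c)" by (simp add: ivl_def)
    moreover have "e a \<in> V - ivl e (Suc a) c" using that img notin[of a c "Suc a"] by auto
    ultimately show ?thesis
      using pair_corr_insert[OF fin G ivl_sub[OF m, of 0] ivl_sub[of c "Suc a"], of "e a"] that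
      by (simp add: corr_ivl_def ivl_card abs_minus_commute)
  qed
qed

lemma abs_diff_telescope:
  fixes \<phi> d :: "nat \<Rightarrow> real"
  assumes "i \<le> j" and "\<And>k. i \<le> k \<Longrightarrow> k < j \<Longrightarrow> \<bar>\<phi> k - \<phi> (Suc k)\<bar> \<le> d k"
  shows "\<bar>\<phi> i - \<phi> j\<bar> \<le> (\<Sum>k=i..<j. d k)"
  using assms
proof (induction j rule: dec_induct)
  case (step j)
  have "\<bar>\<phi> i - \<phi> (Suc j)\<bar> \<le> \<bar>\<phi> i - \<phi> j\<bar> + \<bar>\<phi> j - \<phi> (Suc j)\<bar>" by simp
  also have "\<dots> \<le> (\<Sum>k=i..<j. d k) + d j"
    using step by (intro add_mono) auto
  finally show ?case using step by simp
qed auto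

text \<open>While the right endpoint moves, the sizes \<open>k - a\<close> are distinct, so each
  layer is charged at most once. This is why the bound is a sum over layers and not a number of
  steps times a maximum.\<close>

lemma corr_ivl_right:
  assumes fin: "finite V" and e: "bij_betw e {..<card V} V" and G: "G \<in> Pow V \<rightarrow> {-1, 1}"
    and m: "m \<le> card V" and c: "a \<le> c" "c \<le> card V" "a \<le> c'" "c' \<le> card V"
    and U: "finite U" "\<And>k. min c c' \<le> k \<Longrightarrow> k < max c c' \<Longrightarrow> k - a \<in> U"
  shows "\<bar>corr_ivl V G e m a c - corr_ivl V G e m a c'\<bar> \<le> 2 * (\<Sum>u\<in>U. slice_disc V G u)"
proof -
  have *: "\<bar>corr_ivl V G e m a c - corr_ivl V G e m a c'\<bar> \<le> 2 * (\<Sum>u\<in>U. slice_disc V G u)"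
    if "c \<le> c'" "a \<le> c" "c' \<le> card V" "\<And>k. c \<le> k \<Longrightarrow> k < c' \<Longrightarrow> k - a \<in> U" for c c'
  proof -
    have "\<bar>corr_ivl V G e m a c - corr_ivl V G e m a c'\<bar>
        \<le> (\<Sum>k=c..<c'. 2 * slice_disc V G (k - a))"
      using that by (intro abs_diff_telescope corr_ivl_Suc_right fin e G m) auto
    also have "\<dots> = 2 * (\<Sum>u\<in>(\<lambda>k. k - a) ` {c..<c'}. slice_disc V G u)"
      using that by (subst sum.reindex) (auto simp: inj_on_def sum_distrib_left)
    also have "\<dots> \<le> 2 * (\<Sum>u\<in>U. slice_disc V G u)"
      using that U(1) by (intro mult_left_mono sum_mono2) (auto simp: slice_disc_nonneg)
    finally show ?thesis .
  qed
  show ?thesis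
    using *[of c c'] *[of c' c] c U(2) by (cases "c \<le> c'") (auto simp: abs_minus_commute min_def max_def)
qed

lemma corr_ivl_left:
  assumes fin: "finite V" and e: "bij_betw e {..<card V} V" and G: "G \<in> Pow V \<rightarrow> {-1, 1}"
    and m: "m \<le> card V" and c: "a \<le> c" "a' \<le> c" "c \<le> card V"
    and U: "finite U" "\<And>k. min a a' \<le> k \<Longrightarrow> k < max a a' \<Longrightarrow> c - Suc k \<in> U"
  shows "\<bar>corr_ivl V G e m a c - corr_ivl V G e m a' c\<bar> \<le> 2 * (\<Sum>u\<in>U. slice_disc V G u)"
proof -
  have *: "\<bar>corr_ivl V G e m a c - corr_ivl V G e m a' c\<bar> \<le> 2 * (\<Sum>u\<in>U. slice_disc V G u)"
    if "a \<le> a'" "a' \<le> c" "\<And>k. a \<le> k \<Longrightarrow> k < a' \<Longrightarrow> c - Suc k \<in> U" for a a'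
  proof -
    have "\<bar>corr_ivl V G e m a c - corr_ivl V G e m a' c\<bar>
        \<le> (\<Sum>k=a..<a'. 2 * slice_disc V G (c - Suc k))"
      using that c by (intro abs_diff_telescope corr_ivl_Suc_left fin e G m) auto
    also have "\<dots> = 2 * (\<Sum>u\<in>(\<lambda>k. c - Suc k) ` {a..<a'}. slice_disc V G u)"
      using that by (subst sum.reindex) (auto simp: inj_on_def sum_distrib_left)
    also have "\<dots> \<le> 2 * (\<Sum>u\<in>U. slice_disc V G u)"
      using that U(1) by (intro mult_left_mono sum_mono2) (auto simp: slice_disc_nonneg)
    finally show ?thesis .
  qed
  show ?thesis
    using *[of a a'] *[of a' a] c U(2) by (cases "a \<le> a'") (auto simp: abs_minus_commute min_def max_def)
qed

text \<open>Strict \<open>u < n\<close>, since \<open>u\<close> is the lower layer of an edge and no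
  edge starts at the full set.\<close>

definition window :: "nat \<Rightarrow> real \<Rightarrow> nat set" where
  "window n r = {u. u < n \<and> \<bar>real u - real n / 2\<bar> \<le> r}"

lemma finite_window [simp]: "finite (window n r)"
  by (rule finite_subset[of _ "{..<n}"]) (auto simp: window_def)

text \<open>The left endpoint moves from \<open>a\<close> to \<open>d\<close>, then the right one
  from \<open>m + b\<close> to \<open>m + d\<close>; each move costs 2 per layer. In the first move
  the size is \<open>m + b - k - 1\<close> with \<open>k\<close> within \<open>3 * L\<close> of
  \<open>d\<close>, so its distance from n / 2 is at most L + 3 L + 3 L + 1, which
  \<open>1 \<le> L\<close> turns into \<open>8 * L\<close>. The second move stays within
  \<open>4 * L\<close>.\<close>

lemma corr_ivl_compare:
  assumes fin: "finite V" and e: "bij_betw e {..<card V} V" and G: "G \<in> Pow V \<rightarrow> {-1, 1}"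
    and m: "\<bar>real m - card V / 2\<bar> \<le> L" and a: "a \<le> m" "\<bar>real a - real d\<bar> \<le> 3 * L"
    and b: "m + b \<le> card V" "\<bar>real b - real d\<bar> \<le> 3 * L"
    and d: "d \<le> m" "m + d \<le> card V" and L: "1 \<le> L"
  shows "\<bar>corr_ivl V G e m a (m + b) - corr_ivl V G e m d (m + d)\<bar>
    \<le> 4 * (\<Sum>u\<in>window (card V) (8 * L). slice_disc V G u)"
proof -
  have "\<bar>corr_ivl V G e m a (m + b) - corr_ivl V G e m d (m + b)\<bar>
    \<le> 2 * (\<Sum>u\<in>window (card V) (8 * L). slice_disc V G u)"
  proof (rule corr_ivl_left[OF fin e G])
    fix k assume k: "min a d \<le> k" "k < max a d"
    then have "real (m + b - Suc k) = real m + real b - real k - 1"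
      using a d by (auto simp: of_nat_diff max_def split: if_splits)
    moreover have "\<bar>real k - real d\<bar> \<le> 3 * L"
      using k a(2) by (auto simp: min_def max_def split: if_splits)
    moreover have "m + b - Suc k < card V" using k a d b by (auto simp: max_def split: if_splits)
    ultimately show "m + b - Suc k \<in> window (card V) (8 * L)"
      using m b L by (simp add: window_def; linarith)
  qed (use a b d in auto)
  moreover have "\<bar>corr_ivl V G e m d (m + b) - corr_ivl V G e m d (m + d)\<bar>
    \<le> 2 * (\<Sum>u\<in>window (card V) (8 * L). slice_disc V G u)"
  proof (rule corr_ivl_right[OF fin e G])
    fix k assume k: "min (m + b) (m + d) \<le> k" "k < max (m + b) (m + d)"
    then have "real (k - d) = real k - real d"
      using a d by (auto simp: of_nat_diff min_def split: if_splits)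
    moreover have "\<bar>real k - real (m + d)\<bar> \<le> 3 * L"
      using k b(2) by (auto simp: min_def max_def split: if_splits)
    moreover have "k - d < card V" using k a d b by (auto simp: max_def split: if_splits)
    ultimately show "k - d \<in> window (card V) (8 * L)"
      using m b L by (simp add: window_def; linarith)
  qed (use a b d in auto)
  ultimately show ?thesis by linarith
qed

section \<open>Influences and slices of the cube\<close>

lemma sum_slice_disc:
  assumes "finite V"
  shows "(\<Sum>u<card V. real (card V choose u) * real (card V - u) * slice_disc V G u)
    = (\<Sum>A\<in>Pow V. \<Sum>x\<in>V - A. pivotal G A x)"
proof -
  have "(\<Sum>u<card V. real (card V choose u) * real (card V - u) * slice_disc V G u)
      = (\<Sum>u<card V. card (flags V u) * slice_disc V G u)"
    using assms by (intro sum.cong refl) (simp add: card_flags of_nat_diff less_imp_le)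
  also have "\<dots> = (\<Sum>u<card V. \<Sum>(A, x)\<in>flags V u. pivotal G A x)"
    by (intro sum.cong refl) (auto simp: slice_disc_def finite_flags[OF assms])
  also have "\<dots> = (\<Sum>u<card V. \<Sum>A | A \<subseteq> V \<and> card A = u. \<Sum>x\<in>V - A. pivotal G A x)"
    unfolding flags_def using assms by (intro sum.cong refl sum.Sigma[symmetric]) auto
  \<comment> \<open>The top layer consists of \<open>V\<close> alone, which has no upward edge; it
    is added so that the layers exhaust \<open>Pow V\<close>.\<close>
  also have "\<dots> = (\<Sum>u\<le>card V. \<Sum>A | A \<subseteq> V \<and> card A = u. \<Sum>x\<in>V - A. pivotal G A x)"
  proof -
    have "{A. A \<subseteq> V \<and> card A = card V} = {V}"
      using assms by (auto intro: card_subset_eq[THEN equalityD2, THEN subsetD])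
    then show ?thesis by (simp flip: lessThan_Suc_atMost)
  qed
  also have "\<dots> = (\<Sum>u\<le>card V. \<Sum>A\<in>{A \<in> Pow V. card A = u}. \<Sum>x\<in>V - A. pivotal G A x)"
    by simp
  also have "\<dots> = (\<Sum>A\<in>Pow V. \<Sum>x\<in>V - A. pivotal G A x)"
    using assms by (intro sum.group) (auto intro: card_mono)
  finally show ?thesis .
qed

text \<open>Each layer in \<open>U\<close> has weight at least \<open>c\<close> in the total count
  of pivotal edges, so the unweighted sum over \<open>U\<close> costs a factor
  \<open>1 / c\<close>.\<close>

lemma sum_slice_disc_le:
  assumes fin: "finite V" and U: "U \<subseteq> {..<card V}" and c: "0 < c"
    and le: "\<And>u. u \<in> U \<Longrightarrow> c \<le> (card V choose u) * (real (card V) - u) / 2 ^ card V"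
  shows "(\<Sum>u\<in>U. slice_disc V G u)
    \<le> (\<Sum>A\<in>Pow V. \<Sum>x\<in>V - A. pivotal G A x) / 2 ^ card V / c"
proof -
  have "c * (\<Sum>u\<in>U. slice_disc V G u)
      \<le> (\<Sum>u\<in>U. (card V choose u) * (real (card V) - u) / 2 ^ card V * slice_disc V G u)"
    unfolding sum_distrib_left using le by (intro sum_mono mult_right_mono slice_disc_nonneg)
  also have "\<dots> \<le> (\<Sum>u<card V. (card V choose u) * (real (card V) - u) / 2 ^ card V * slice_disc V G u)"
    using U by (intro sum_mono2) (auto simp: slice_disc_nonneg)
  also have "\<dots> = (\<Sum>u<card V. real (card V choose u) * real (card V - u) * slice_disc V G u) / 2 ^ card V"
    unfolding sum_divide_distrib by (intro sum.cong refl) (simp add: of_nat_diff less_imp_le)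
  also note sum_slice_disc[OF fin]
  finally show ?thesis
    using c by (simp add: field_simps)
qed

section \<open>Lower bounds for binomial coefficients near the middle layer\<close>

lemma central_binomial_even:
  assumes "1 \<le> k"
  shows "(4 ^ k)\<^sup>2 \<le> 4 * real k * (real ((2 * k) choose k))\<^sup>2"
  using assms
proof (induction k rule: dec_induct)
  case base
  then show ?case by (simp add: numeral_2_eq_2)
next
  case (step k)
  let ?C = "real ((2 * k) choose k)" and ?C' = "real ((2 * Suc k) choose Suc k)"
  have "Suc k * ((2 * Suc k) choose Suc k) = Suc (2 * k + 1) * ((2 * k + 1) choose k)"
    using Suc_times_binomial[of k "2 * k + 1"] by simp
  moreover have "(2 * k + 1) choose k = (2 * k + 1) choose (Suc k)"
    using binomial_symmetric[of k "2 * k + 1"] by simp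
  moreover have "Suc k * ((2 * k + 1) choose Suc k) = Suc (2 * k) * ((2 * k) choose k)"
    using Suc_times_binomial[of k "2 * k"] by simp
  ultimately have "(k + 1) * ((2 * Suc k) choose Suc k) = 2 * (2 * k + 1) * ((2 * k) choose k)"
    by (metis Suc_eq_plus1 mult.assoc mult.left_commute mult_2 add_Suc add_Suc_right)
  then have C': "(real k + 1) * ?C' = 2 * (2 * real k + 1) * ?C"
    by (metis (mono_tags, opaque_lifting) of_nat_1 of_nat_add of_nat_mult of_nat_numeral)
  \<comment> \<open>Consecutive central coefficients have ratio 2 (2 k + 1) / (k + 1); after
    squaring, the induction step rests on 4 k (k + 1) \<le> (2 k + 1)^2.\<close>
  have "16 * real k * (real k + 1) * (4 * real k * ?C\<^sup>2) \<le> 4 * (2 * real k + 1)\<^sup>2 * (4 * real k * ?C\<^sup>2)"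
    by (intro mult_right_mono) (auto simp: power2_eq_square algebra_simps)
  also have "\<dots> = (2 * (2 * real k + 1) * ?C)\<^sup>2 * (4 * real k)"
    by (simp add: power2_eq_square algebra_simps)
  also have "\<dots> = (real k + 1)\<^sup>2 * ?C'\<^sup>2 * (4 * real k)"
    unfolding C'[symmetric] by (simp add: power_mult_distrib)
  finally have "real k * (real k + 1) * (16 * (4 * real k * ?C\<^sup>2))
      \<le> real k * (real k + 1) * (4 * (real k + 1) * ?C'\<^sup>2)"
    by (simp add: power2_eq_square algebra_simps)
  then have "16 * (4 * real k * ?C\<^sup>2) \<le> 4 * (real k + 1) * ?C'\<^sup>2"
    using step by (subst (asm) mult_le_cancel_left_pos) auto
  then have "16 * (4 ^ k)\<^sup>2 \<le> 4 * (real k + 1) * ?C'\<^sup>2"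
    using step.IH by linarith
  then show ?case by (simp add: power_mult_distrib algebra_simps del: binomial_Suc_Suc)
qed

lemma central_binomial_lower:
  assumes "1 \<le> n"
  shows "2 ^ n \<le> 2 * sqrt n * (n choose (n div 2))"
proof -
  have even: "2 ^ (2 * k) \<le> 2 * sqrt k * ((2 * k) choose k)" if "1 \<le> k" for k
    using real_sqrt_le_mono[OF central_binomial_even[OF that]]
    by (simp add: real_sqrt_mult power_mult)
  show ?thesis
  proof (cases "even n")
    case True
    then obtain k where k: "n = 2 * k" by blast
    have "2 ^ n \<le> 2 * sqrt k * (n choose (n div 2))"
      using even[of k] k assms by simp
    also have "\<dots> \<le> 2 * sqrt n * (n choose (n div 2))"
      using k by (intro mult_right_mono) auto
    finally show ?thesis .
  next
    case False
    then obtain k where k: "n = 2 * k + 1" using oddE by blast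
    \<comment> \<open>For odd \<open>n\<close> the central coefficient of \<open>n + 1\<close> is
      twice that of \<open>n\<close>, which reduces to the even case.\<close>
    have "(2 * Suc k) choose Suc k = 2 * (n choose k)"
      using binomial_symmetric[of k "2 * k + 1"] by (simp add: k)
    then have "2 * 2 ^ n \<le> 2 * sqrt (Suc k) * (2 * (n choose k))"
      using even[of "Suc k"] k by simp
    also have "\<dots> \<le> 2 * sqrt n * (2 * (n choose k))"
      using k assms by (intro mult_right_mono mult_left_mono) auto
    finally show ?thesis using k by simp
  qed
qed

text \<open>Above the middle, consecutive coefficients have ratio (n - v) / (v + 1). Up to distance
  \<open>r\<close> from n / 2 this is at least 1 - x: the deficit is about 2 r, and
  \<open>4 * r \<le> x * n\<close> makes x (v + 1) at least that large.\<close>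

lemma binomial_geometric_lower:
  fixes x r :: real
  assumes x: "0 \<le> x" "x \<le> 1" and r: "4 * r \<le> x * n"
    and v: "n div 2 \<le> v" "real v \<le> n / 2 + r" "v \<le> n"
  shows "(n choose (n div 2)) * (1 - x) ^ (v - n div 2) \<le> n choose v"
  using v
proof (induction v rule: dec_induct)
  case (step v)
  have "n \<le> 2 * (v + 1)" using step.hyps(1) by presburger
  then have "real n \<le> real (2 * (v + 1))" by (simp only: of_nat_le_iff)
  then have half: "real n \<le> 2 * (real v + 1)" by simp
  have "(1 - x) * Suc v \<le> real n - v"
  proof -
    have "x * n \<le> x * (2 * (real v + 1))"
      using half x by (intro mult_left_mono) auto
    then show ?thesis using step.prems r by (simp add: algebra_simps)
  qed
  then have ratio: "(1 - x) * Suc v \<le> real (n - v)"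
    using step.prems by (simp add: of_nat_diff)
  have absorb: "Suc v * (n choose Suc v) = (n - v) * (n choose v)"
    using binomial_absorb_comp[of n v] Suc_times_binomial_eq[of "n - 1" v] step.prems
    by (cases n) auto
  have "(n choose (n div 2)) * (1 - x) ^ (Suc v - n div 2) * Suc v
      = ((n choose (n div 2)) * (1 - x) ^ (v - n div 2)) * ((1 - x) * Suc v)"
    using step.hyps by (simp add: Suc_diff_le)
  also have "\<dots> \<le> (n choose v) * real (n - v)"
    using step ratio x by (intro mult_mono) auto
  also have "\<dots> = (n choose Suc v) * real (Suc v)"
    using absorb by (metis mult.commute of_nat_mult)
  finally show ?case
    by (metis mult_le_cancel_right_pos of_nat_0_less_iff zero_less_Suc)
qed auto

lemma binomial_window_lower:
  fixes \<kappa> :: real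
  assumes \<kappa>: "0 < \<kappa>"
  obtains c where "0 < c"
    and "\<And>n u. u \<in> window n (\<kappa> * sqrt n) \<Longrightarrow>
      c * sqrt n \<le> (n choose u) * (real n - u) / 2 ^ n"
proof -
  \<comment> \<open>From \<open>N\<close> on, \<open>sqrt n\<close> is at least
    \<open>8 * \<kappa>\<close>, so that \<open>x\<close> below is at most 1 / 2.\<close>
  define N where "N = nat \<lceil>64 * \<kappa>\<^sup>2\<rceil>"
  \<comment> \<open>The exponent is 2 x times the largest distance from the middle, with x = 4
    \<kappa> / sqrt n and distance at most (\<kappa> + 1) sqrt n. The 8 collects the 2 of the
    central coefficient and the 4 of n - u \<ge> n / 4.\<close>
  define c1 where "c1 = exp (- (8 * \<kappa> * (\<kappa> + 1))) / 8"
  define c2 where "c2 = 1 / (2 ^ N * (sqrt N + 1))"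
  have large: "c1 * sqrt n \<le> (n choose u) * (real n - u) / 2 ^ n"
    if n: "N \<le> n" and u: "u \<in> window n (\<kappa> * sqrt n)" for n u
  proof -
    have n0: "0 < n" using u by (auto simp: window_def)
    have "64 * \<kappa>\<^sup>2 \<le> n" using n by (simp add: N_def nat_ceiling_le_eq)
    then have s: "8 * \<kappa> \<le> sqrt n"
      by (intro real_le_rsqrt) (simp add: power_mult_distrib)
    have ss: "sqrt n * sqrt n = n" by simp
    have s1: "1 \<le> sqrt n" using n0 by simp
    define x where "x = 4 * \<kappa> / sqrt n"
    have x: "0 \<le> x" "x \<le> 1 / 2" using s s1 \<kappa> by (auto simp: x_def field_simps)
    have xn: "4 * (\<kappa> * sqrt n) \<le> x * n"
      using s1 ss by (simp add: x_def field_simps)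
    \<comment> \<open>Reflection into the upper half, where the geometric bound applies.\<close>
    define v where "v = (if n div 2 \<le> u then u else n - u)"
    have v: "n div 2 \<le> v" "real v \<le> n / 2 + \<kappa> * sqrt n" "v \<le> n"
      using u by (auto simp: v_def window_def of_nat_diff abs_le_iff)
    have nv: "n choose v = n choose u"
      using u binomial_symmetric[of u n] by (auto simp: v_def window_def)
    have "real (v - n div 2) \<le> \<kappa> * sqrt n + 1"
      using v(1,2) by (simp add: of_nat_diff; linarith)
    also have "\<dots> \<le> (\<kappa> + 1) * sqrt n" using s1 by (simp add: algebra_simps)
    finally have j: "real (v - n div 2) \<le> (\<kappa> + 1) * sqrt n" .
    \<comment> \<open>This gives exp (- 2 x) \<le> 1 - x on [0, 1 / 2], so the geometric factor
      becomes an exponential independent of n.\<close>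
    have "- 2 * x \<le> - x - 2 * x\<^sup>2"
      using mult_right_mono[OF x(2) x(1)] by (simp add: power2_eq_square)
    also have "\<dots> \<le> ln (1 - x)"
      using x by (intro ln_one_minus_pos_lower_bound)
    finally have "exp (- 2 * x) \<le> 1 - x"
      using x by (simp add: ln_ge_iff)
    then have "exp (- 2 * x) ^ (v - n div 2) \<le> (1 - x) ^ (v - n div 2)"
      by (intro power_mono) auto
    moreover have "exp (- (8 * \<kappa> * (\<kappa> + 1))) \<le> exp (- 2 * x) ^ (v - n div 2)"
    proof -
      have "real (v - n div 2) * (2 * x) \<le> (\<kappa> + 1) * sqrt n * (2 * x)"
        using j x by (intro mult_right_mono) auto
      also have "\<dots> = 8 * \<kappa> * (\<kappa> + 1)"
        using s1 by (simp add: x_def field_simps)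
      finally show ?thesis by (simp flip: exp_of_nat_mult)
    qed
    ultimately have "8 * c1 \<le> (1 - x) ^ (v - n div 2)" by (simp add: c1_def)
    then have "(n choose (n div 2)) * (8 * c1) \<le> (n choose (n div 2)) * (1 - x) ^ (v - n div 2)"
      by (intro mult_left_mono) auto
    also have "\<dots> \<le> n choose v"
      using x xn v by (intro binomial_geometric_lower[where r = "\<kappa> * sqrt n"]) auto
    finally have "(n choose (n div 2)) * (8 * c1) \<le> n choose u" by (simp add: nv)
    moreover have "2 ^ n / (2 * sqrt n) \<le> n choose (n div 2)"
      using central_binomial_lower[of n] n0 by (simp add: field_simps)
    moreover have c1: "0 < c1" by (simp add: c1_def)
    ultimately have "2 ^ n / (2 * sqrt n) * (8 * c1) \<le> n choose u"
      by (meson c1 mult_right_mono order.trans less_imp_le mult_pos_pos zero_less_numeral)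
    moreover have "real n / 4 \<le> real n - u"
    proof -
      have "\<kappa> * sqrt n \<le> sqrt n / 8 * sqrt n"
        using s s1 by (intro mult_right_mono) auto
      then show ?thesis using u ss by (auto simp: window_def abs_le_iff)
    qed
    ultimately have "2 ^ n / (2 * sqrt n) * (8 * c1) * (real n / 4) \<le> (n choose u) * (real n - u)"
      using c1 by (intro mult_mono) auto
    moreover have "2 ^ n / (2 * sqrt n) * (8 * c1) * (real n / 4) = c1 * sqrt n * 2 ^ n"
    proof -
      have "real n / sqrt n = sqrt n" using s1 by (simp add: real_div_sqrt)
      then have "c1 * sqrt n * 2 ^ n = c1 * (real n / sqrt n) * 2 ^ n" by simp
      then show ?thesis by simp
    qed
    ultimately show ?thesis by (simp add: field_simps)
  qed
  \<comment> \<open>Below \<open>N\<close> it is enough that the coefficient and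
    \<open>n - u\<close> are at least 1; the latter uses \<open>u < n\<close> from the
    window.\<close>
  have small: "c2 * sqrt n \<le> (n choose u) * (real n - u) / 2 ^ n"
    if n: "n \<le> N" and u: "u \<in> window n (\<kappa> * sqrt n)" for n u
  proof -
    have "sqrt n / (sqrt N + 1) \<le> 1"
      using n by (simp add: divide_le_eq_1 add_increasing2 add_nonneg_pos)
    then have "sqrt n / (sqrt N + 1) / 2 ^ N \<le> 1 / 2 ^ N"
      by (rule divide_right_mono) simp
    then have "c2 * sqrt n \<le> 1 / 2 ^ N"
      by (simp add: c2_def mult.commute)
    also have "\<dots> \<le> 1 * 1 / 2 ^ n" using n by (simp add: field_simps power_increasing)
    also have "\<dots> \<le> (n choose u) * (real n - u) / 2 ^ n"
    proof (intro divide_right_mono mult_mono)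
      show "1 \<le> real (n choose u)" using u by (simp add: window_def Suc_le_eq zero_less_binomial_iff)
      show "1 \<le> real n - real u" using u by (simp add: window_def)
    qed auto
    finally show ?thesis .
  qed
  show ?thesis
  proof (rule that[of "min c1 c2"])
    show "0 < min c1 c2" by (simp add: c1_def c2_def add_nonneg_pos)
    show "min c1 c2 * sqrt n \<le> (n choose u) * (real n - u) / 2 ^ n"
      if "u \<in> window n (\<kappa> * sqrt n)" for n u
    proof -
      have "min c1 c2 * sqrt n \<le> c1 * sqrt n" "min c1 c2 * sqrt n \<le> c2 * sqrt n"
        by (intro mult_right_mono; simp)+
      then show ?thesis
        using large[OF _ that] small[OF _ that] by (meson nle_le order.trans)
    qed
  qed
qed

section \<open>Permutation invariant kernels\<close>

lemma sum_Pow_insert: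
  assumes "finite V" "v \<notin> V"
  shows "(\<Sum>C\<in>Pow (insert v V). \<phi> C) = (\<Sum>C\<in>Pow V. \<phi> C + \<phi> (insert v C))"
proof -
  have "inj_on (insert v) (Pow V)"
    using assms by (intro inj_onI) (metis PowD insert_ident subsetD)
  moreover have "Pow V \<inter> insert v ` Pow V = {}" using assms by auto
  ultimately show ?thesis
    unfolding Pow_insert using assms
    by (subst sum.union_disjoint) (auto simp: sum.reindex sum.distrib)
qed

text \<open>The shift \<open>z\<close> is what makes the induction on \<open>V\<close> go through; \<open>A = {}\<close>, \<open>z = 1\<close> gives the
  total mass.\<close>

lemma sum_Pow_variance:
  fixes q z :: real
  assumes "finite V" "A \<subseteq> V"
  shows "(\<Sum>C\<in>Pow V. q ^ card C * (1 - q) ^ card (V - C) * (z + card (A \<inter> C) - q * card A)\<^sup>2)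
    = z\<^sup>2 + q * (1 - q) * card A"
  using assms
proof (induction V arbitrary: A z rule: finite_induct)
  case empty
  then show ?case by simp
next
  case (insert v V)
  define w where "w = (\<lambda>C. q ^ card C * (1 - q) ^ card (V - C))"
  define A' where "A' = A - {v}"
  define s where "s = (of_bool (v \<in> A) :: real)"
  have A': "A' \<subseteq> V" "finite A'" and v: "v \<notin> A'"
    using insert.prems insert.hyps(1) by (auto simp: A'_def intro: finite_subset)
  have IH: "(\<Sum>C\<in>Pow V. w C * (z + card (A' \<inter> C) - q * card A')\<^sup>2) = z\<^sup>2 + q * (1 - q) * card A'" for z :: real
    unfolding w_def by (rule insert.IH[OF A'(1)])
  have cardA: "real (card A) = card A' + s"
    using A' v by (cases "v \<in> A") (auto simp: A'_def s_def card.remove[of A v] simp del: card_Diff_insert)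
  \<comment> \<open>Splitting on whether \<open>v\<close> is in \<open>C\<close> replaces
    \<open>z\<close> by \<open>z - q * s\<close> with weight \<open>1 - q\<close> and by
    \<open>z + s - q * s\<close> with weight \<open>q\<close>. The squares of these shifts average
    to z^2 + q (1 - q) s^2.\<close>
  have "(\<Sum>C\<in>Pow (insert v V). q ^ card C * (1 - q) ^ card (insert v V - C)
        * (z + card (A \<inter> C) - q * card A)\<^sup>2)
      = (\<Sum>C\<in>Pow V. (1 - q) * (w C * ((z - q * s) + card (A' \<inter> C) - q * card A')\<^sup>2)
          + q * (w C * ((z + s - q * s) + card (A' \<inter> C) - q * card A')\<^sup>2))"
    unfolding sum_Pow_insert[OF insert.hyps]
  proof (intro sum.cong refl arg_cong2[where f = "(+)"])
    fix C assume "C \<in> Pow V"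
    then have C: "C \<subseteq> V" "finite C" "v \<notin> C"
      using insert.hyps by (auto intro: finite_subset)
    have "A \<inter> C = A' \<inter> C" using C by (auto simp: A'_def)
    moreover have "insert v V - C = insert v (V - C)" using C by auto
    ultimately show "q ^ card C * (1 - q) ^ card (insert v V - C) * (z + card (A \<inter> C) - q * card A)\<^sup>2
        = (1 - q) * (w C * ((z - q * s) + card (A' \<inter> C) - q * card A')\<^sup>2)"
      using insert.hyps by (simp add: w_def cardA algebra_simps)
    have "real (card (A \<inter> insert v C)) = card (A' \<inter> C) + s"
    proof (cases "v \<in> A")
      case True
      then have "A \<inter> insert v C = insert v (A' \<inter> C)" by (auto simp: A'_def)
      then show ?thesis using True A' v by (simp add: s_def)
    next
      case False
      then have "A \<inter> insert v C = A' \<inter> C" by (auto simp: A'_def)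
      then show ?thesis using False by (simp add: s_def)
    qed
    moreover have "insert v V - insert v C = V - C" using insert.hyps by auto
    ultimately show "q ^ card (insert v C) * (1 - q) ^ card (insert v V - insert v C)
          * (z + card (A \<inter> insert v C) - q * card A)\<^sup>2
        = q * (w C * ((z + s - q * s) + card (A' \<inter> C) - q * card A')\<^sup>2)"
      using C by (simp add: w_def cardA algebra_simps)
  qed
  also have "\<dots> = (1 - q) * ((z - q * s)\<^sup>2 + q * (1 - q) * card A')
      + q * ((z + s - q * s)\<^sup>2 + q * (1 - q) * card A')"
    unfolding sum.distrib sum_distrib_left[symmetric] IH ..
  also have "\<dots> = z\<^sup>2 + q * (1 - q) * (card A' + s\<^sup>2)"
    by (simp add: power2_eq_square algebra_simps)
  also have "s\<^sup>2 = s" by (simp add: s_def)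
  finally show ?case by (simp add: cardA)
qed

lemma abs_pair_corr_le_1:
  assumes fin: "finite V" and G: "G \<in> Pow V \<rightarrow> {-1, 1}" and sub: "A \<subseteq> V" "B \<subseteq> V"
  shows "\<bar>pair_corr V G A B\<bar> \<le> 1"
proof -
  have "\<bar>G (g ` A) * G (g ` B)\<bar> \<le> 1" if "g permutes V" for g
  proof -
    have "g ` A \<in> Pow V" "g ` B \<in> Pow V"
      using permutes_image_subset[OF that] sub by auto
    then have "G (g ` A) \<in> {-1, 1}" "G (g ` B) \<in> {-1, 1}"
      using G by blast+
    then show ?thesis by (auto simp: abs_mult)
  qed
  then have "\<bar>\<Sum>g | g permutes V. G (g ` A) * G (g ` B)\<bar> \<le> (\<Sum>g | g permutes V. 1)"
    by (intro order.trans[OF sum_abs] sum_mono) auto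
  then show ?thesis
    using fin by (simp add: pair_corr_def card_permutations)
qed

text \<open>Substituting \<open>(g\<close> A, g \<open>B)\<close> for \<open>(A, B)\<close> does not
  change the sum, since the kernel is invariant; averaging over all \<open>g\<close> then produces
  \<open>pair_corr\<close>.\<close>

lemma sum_kernel_eq_pair_corr:
  fixes k :: "'a set \<Rightarrow> 'a set \<Rightarrow> real"
  assumes fin: "finite V"
    and inv: "\<And>g A B. g permutes V \<Longrightarrow> A \<subseteq> V \<Longrightarrow> B \<subseteq> V \<Longrightarrow> k (g ` A) (g ` B) = k A B"
  shows "(\<Sum>A\<in>Pow V. \<Sum>B\<in>Pow V. k A B * (G A * G B))
    = (\<Sum>A\<in>Pow V. \<Sum>B\<in>Pow V. k A B * pair_corr V G A B)"
proof -
  have "(\<Sum>A\<in>Pow V. \<Sum>B\<in>Pow V. k A B * (G (g ` A) * G (g ` B)))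
      = (\<Sum>A\<in>Pow V. \<Sum>B\<in>Pow V. k A B * (G A * G B))" if g: "g permutes V" for g
  proof -
    have bij: "bij_betw ((`) g) (Pow V) (Pow V)"
      using permutes_imp_bij[OF g] by (rule bij_betw_Pow)
    have "(\<Sum>A\<in>Pow V. \<Sum>B\<in>Pow V. k A B * (G A * G B))
        = (\<Sum>A\<in>Pow V. \<Sum>B\<in>Pow V. k (g ` A) (g ` B) * (G (g ` A) * G (g ` B)))"
      by (subst (1 2) sum.reindex_bij_betw[OF bij, symmetric]) simp
    then show ?thesis by (simp add: inv[OF g])
  qed
  then have "(\<Sum>g | g permutes V. \<Sum>A\<in>Pow V. \<Sum>B\<in>Pow V. k A B * (G (g ` A) * G (g ` B)))
      = fact (card V) * (\<Sum>A\<in>Pow V. \<Sum>B\<in>Pow V. k A B * (G A * G B))"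
    using fin by (simp add: card_permutations)
  moreover have "(\<Sum>g | g permutes V. \<Sum>A\<in>Pow V. \<Sum>B\<in>Pow V. k A B * (G (g ` A) * G (g ` B)))
      = (\<Sum>A\<in>Pow V. \<Sum>B\<in>Pow V. k A B * (\<Sum>g | g permutes V. G (g ` A) * G (g ` B)))"
    unfolding sum_distrib_left
    by (subst sum.swap, rule sum.cong[OF refl], rule sum.swap)
  ultimately show ?thesis
    by (simp add: pair_corr_def flip: sum_divide_distrib)
qed

text \<open>The reference value depends only on \<open>\<epsilon>\<close>, so it is shared by the noise kernel and the
  exclusion kernel.  Outside an event of probability \<open>O(n / L\<^sup>2)\<close> the pair \<open>(A, B)\<close> is moved to the
  reference type through sets whose sizes lie in a window of width \<open>O(L)\<close>, each size being used
  at most twice.\<close>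

lemma kernel_corr_bound:
  fixes k :: "'a set \<Rightarrow> 'a set \<Rightarrow> real" and \<mu> \<nu> :: "'a set \<Rightarrow> real" and \<epsilon> L :: real
  assumes fin: "finite V" and V: "V \<noteq> {}" and e: "bij_betw e {..<card V} V"
    and G: "G \<in> Pow V \<rightarrow> {-1, 1}" and \<epsilon>: "0 \<le> \<epsilon>" "\<epsilon> \<le> 1" and L: "1 \<le> L"
    and k_nonneg: "\<And>A B. A \<subseteq> V \<Longrightarrow> B \<subseteq> V \<Longrightarrow> 0 \<le> k A B"
    and k_sum: "\<And>A. A \<subseteq> V \<Longrightarrow> (\<Sum>B\<in>Pow V. k A B) = 1"
    and k_inv: "\<And>g A B. g permutes V \<Longrightarrow> A \<subseteq> V \<Longrightarrow> B \<subseteq> V \<Longrightarrow> k (g ` A) (g ` B) = k A B"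
    and removed: "\<And>A. A \<subseteq> V \<Longrightarrow>
      \<bar>\<mu> A - \<epsilon> * card A * (real (card V) - card A) / card V\<bar> \<le> \<bar>card A - card V / 2\<bar>"
      "\<And>A. A \<subseteq> V \<Longrightarrow> (\<Sum>B\<in>Pow V. k A B * (card (A - B) - \<mu> A)\<^sup>2) \<le> card V"
    and added: "\<And>A. A \<subseteq> V \<Longrightarrow>
      \<bar>\<nu> A - \<epsilon> * card A * (real (card V) - card A) / card V\<bar> \<le> \<bar>card A - card V / 2\<bar>"
      "\<And>A. A \<subseteq> V \<Longrightarrow> (\<Sum>B\<in>Pow V. k A B * (card (B - A) - \<nu> A)\<^sup>2) \<le> card V"
  defines "d \<equiv> \<lambda>m. nat \<lfloor>\<epsilon> * real m * (real (card V) - m) / card V\<rfloor>"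
  shows "\<bar>(\<Sum>A\<in>Pow V. \<Sum>B\<in>Pow V. k A B * (G A * G B)) / 2 ^ card V
      - (\<Sum>A\<in>Pow V. corr_ivl V G e (card A) (d (card A)) (card A + d (card A))) / 2 ^ card V\<bar>
    \<le> 5 * card V / L\<^sup>2 + 4 * (\<Sum>u\<in>window (card V) (8 * L). slice_disc V G u)"
proof -
  note finite_subset[OF _ fin, simp]
  define n where "n = card V"
  define W where "W = (\<Sum>u\<in>window n (8 * L). slice_disc V G u)"
  define c where "c = (\<lambda>m. corr_ivl V G e m (d m) (m + d m))"
  define X where "X = (\<lambda>A B. (card A - n / 2)\<^sup>2 + (card (A - B) - \<mu> A)\<^sup>2 + (card (B - A) - \<nu> A)\<^sup>2)"
  have n: "0 < n" using V fin by (simp add: n_def card_gt_0_iff)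
  have W: "0 \<le> W" unfolding W_def by (intro sum_nonneg slice_disc_nonneg)
  \<comment> \<open>Chebyshev in pointwise form: if a deviation exceeds \<open>L\<close>, then
    \<open>X A B\<close> is at least L^2, and 2 X / L^2 dominates the trivial bound 2. Otherwise the
    path bound gives \<open>4 * W\<close>.\<close>
  have pointwise: "\<bar>pair_corr V G A B - c (card A)\<bar> \<le> 4 * W + 2 * X A B / L\<^sup>2"
    if sub: "A \<subseteq> V" "B \<subseteq> V" for A B
  proof -
    define m where "m = card A"
    define x where "x = \<epsilon> * real m * (real n - m) / n"
    have m: "m \<le> n" unfolding m_def n_def using sub fin by (intro card_mono) auto
    have x0: "0 \<le> x" using \<epsilon> m by (simp add: x_def)
    have "x = \<epsilon> * (real m * (real n - m) / n)" by (simp add: x_def)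
    also have "\<dots> \<le> 1 * (real m * (real n - m) / n)"
      using \<epsilon> m by (intro mult_right_mono) auto
    finally have xle: "x \<le> real m * (real n - m) / n" by simp
    have "real m * (real n - m) / n \<le> m" "real m * (real n - m) / n \<le> real n - m"
      using m n by (auto simp: divide_le_eq mult_left_mono mult_right_mono mult.commute)
    \<comment> \<open>These bounds make the reference type realisable: \<open>d m\<close> points can
      be removed from a set of size \<open>m\<close> and as many added within
      \<open>V\<close>.\<close>
    with xle have xm: "x \<le> m" "x \<le> real n - m" by auto
    have d: "real (d m) \<le> x" "\<bar>real (d m) - x\<bar> \<le> 1"
      using x0 by (auto simp: d_def x_def n_def of_nat_nat abs_le_iff; linarith)+
    have dm: "d m \<le> m" "m + d m \<le> n" using d(1) xm by linarith+
    have pc: "pair_corr V G A B = corr_ivl V G e m (card (A - B)) (m + card (B - A))"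
      unfolding m_def by (rule pair_corr_eq_corr_ivl[OF fin e sub])
    have a: "card (A - B) \<le> m" unfolding m_def using sub by (intro card_mono) auto
    have "m + card (B - A) = card (A \<union> (B - A))"
      unfolding m_def using sub by (subst card_Un_disjoint) auto
    then have b: "m + card (B - A) \<le> n"
      unfolding n_def using sub fin by (auto intro!: card_mono)
    show ?thesis
    proof (cases "\<bar>real m - n / 2\<bar> \<le> L \<and> \<bar>card (A - B) - \<mu> A\<bar> \<le> L \<and> \<bar>card (B - A) - \<nu> A\<bar> \<le> L")
      case True
      have "\<bar>\<mu> A - x\<bar> \<le> L" "\<bar>\<nu> A - x\<bar> \<le> L"
        using removed(1)[OF sub(1)] added(1)[OF sub(1)] True by (auto simp: x_def m_def n_def)
      then have "\<bar>real (card (A - B)) - d m\<bar> \<le> 3 * L" "\<bar>real (card (B - A)) - d m\<bar> \<le> 3 * L"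
        using True d(2) L by linarith+
      then have "\<bar>pair_corr V G A B - c m\<bar> \<le> 4 * W"
        unfolding pc c_def W_def n_def using True a b dm L
        by (intro corr_ivl_compare fin e G) (auto simp: n_def)
      then show ?thesis by (simp add: m_def X_def add_increasing2)
    next
      case False
      have sq: "L\<^sup>2 \<le> y\<^sup>2" if "\<not> \<bar>y\<bar> \<le> L" for y :: real
        using that L by (simp add: abs_le_square_iff[symmetric])
      have "L\<^sup>2 \<le> X A B"
        using False sq[of "real m - n / 2"] sq[of "card (A - B) - \<mu> A"] sq[of "card (B - A) - \<nu> A"]
          zero_le_power2[of "real m - n / 2"] zero_le_power2[of "card (A - B) - \<mu> A"]
          zero_le_power2[of "card (B - A) - \<nu> A"]
        unfolding X_def m_def by linarith
      then have "2 \<le> 2 * X A B / L\<^sup>2" using L by (simp add: le_divide_eq)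
      moreover have "\<bar>c m\<bar> \<le> 1"
        unfolding c_def corr_ivl_def using e dm m
        by (intro abs_pair_corr_le_1 fin G) (auto simp: ivl_def n_def bij_betw_def)
      moreover have "\<bar>pair_corr V G A B\<bar> \<le> 1"
        by (intro abs_pair_corr_le_1 fin G sub)
      ultimately show ?thesis using W by (simp add: m_def)
    qed
  qed
  have row: "\<bar>(\<Sum>B\<in>Pow V. k A B * pair_corr V G A B) - c (card A)\<bar>
      \<le> 4 * W + 2 * ((card A - n / 2)\<^sup>2 + 2 * n) / L\<^sup>2" if A: "A \<subseteq> V" for A
  proof -
    have "(\<Sum>B\<in>Pow V. k A B * pair_corr V G A B) - c (card A)
        = (\<Sum>B\<in>Pow V. k A B * (pair_corr V G A B - c (card A)))"
      using k_sum[OF A] by (simp add: right_diff_distrib sum_subtractf flip: sum_distrib_right)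
    also have "\<bar>\<dots>\<bar> \<le> (\<Sum>B\<in>Pow V. k A B * (4 * W + 2 * X A B / L\<^sup>2))"
      using pointwise[OF A] k_nonneg[OF A]
      by (intro order.trans[OF sum_abs] sum_mono) (auto simp: abs_mult intro!: mult_left_mono)
    also have "\<dots> = (\<Sum>B\<in>Pow V. k A B) * (4 * W + 2 * (card A - n / 2)\<^sup>2 / L\<^sup>2)
        + (2 / L\<^sup>2) * ((\<Sum>B\<in>Pow V. k A B * (card (A - B) - \<mu> A)\<^sup>2)
          + (\<Sum>B\<in>Pow V. k A B * (card (B - A) - \<nu> A)\<^sup>2))"
      unfolding X_def sum_distrib_left sum_distrib_right sum.distrib[symmetric]
      by (intro sum.cong refl) (simp add: algebra_simps add_divide_distrib)
    also have "\<dots> \<le> 1 * (4 * W + 2 * (card A - n / 2)\<^sup>2 / L\<^sup>2) + (2 / L\<^sup>2) * (n + n)"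
      using removed(2)[OF A] added(2)[OF A] k_sum[OF A]
      by (intro add_mono mult_left_mono) (auto simp: n_def)
    finally show ?thesis by (simp add: add_divide_distrib algebra_simps)
  qed
  \<comment> \<open>The variance of the size of a uniform subset, from
    \<open>sum_Pow_variance\<close> with \<open>q = 1 / 2\<close> and \<open>A = V\<close>.\<close>
  have var: "(\<Sum>A\<in>Pow V. (card A - n / 2)\<^sup>2) = 2 ^ n * (n / 4)"
  proof -
    have "(\<Sum>C\<in>Pow V. (1 / 2) ^ n * (real (card C) - n / 2)\<^sup>2)
      = (\<Sum>C\<in>Pow V. (1 / 2) ^ card C * (1 - 1 / 2) ^ card (V - C) * (0 + card (V \<inter> C) - 1 / 2 * card V)\<^sup>2)"
    proof (intro sum.cong refl)
      fix C assume C: "C \<in> Pow V"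
      then have "card C \<le> card V" using fin by (auto intro: card_mono)
      then have "n = card C + card (V - C)" using C fin by (simp add: card_Diff_subset n_def)
      then have "(1 / 2 :: real) ^ n = (1 / 2) ^ card C * (1 - 1 / 2) ^ card (V - C)"
        by (simp add: power_add)
      moreover have "V \<inter> C = C" using C by auto
      ultimately show "(1 / 2) ^ n * (real (card C) - n / 2)\<^sup>2
        = (1 / 2) ^ card C * (1 - 1 / 2) ^ card (V - C) * (0 + card (V \<inter> C) - 1 / 2 * card V)\<^sup>2"
        by (simp add: n_def)
    qed
    also have "\<dots> = n / 4"
      using sum_Pow_variance[OF fin order.refl, of "1 / 2" 0] by (simp add: n_def)
    finally show ?thesis
      by (simp add: power_divide field_simps flip: sum_distrib_left sum_divide_distrib)
  qed
  have sym: "(\<Sum>A\<in>Pow V. \<Sum>B\<in>Pow V. k A B * (G A * G B))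
      = (\<Sum>A\<in>Pow V. \<Sum>B\<in>Pow V. k A B * pair_corr V G A B)"
    by (rule sum_kernel_eq_pair_corr[OF fin]) (rule k_inv)
  have "\<bar>(\<Sum>A\<in>Pow V. \<Sum>B\<in>Pow V. k A B * (G A * G B)) - (\<Sum>A\<in>Pow V. c (card A))\<bar>
      \<le> (\<Sum>A\<in>Pow V. \<bar>(\<Sum>B\<in>Pow V. k A B * pair_corr V G A B) - c (card A)\<bar>)"
    unfolding sym sum_subtractf[symmetric]
    by (rule sum_abs)
  also have "\<dots> \<le> (\<Sum>A\<in>Pow V. 4 * W + 2 * ((card A - n / 2)\<^sup>2 + 2 * n) / L\<^sup>2)"
    using row by (intro sum_mono) auto
  also have "\<dots> = 2 ^ n * (4 * W) + 2 / L\<^sup>2 * ((\<Sum>A\<in>Pow V. (card A - n / 2)\<^sup>2) + 2 ^ n * (2 * n))"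
    using fin by (simp add: sum.distrib card_Pow n_def add_divide_distrib
        sum_distrib_left sum_divide_distrib algebra_simps)
  \<comment> \<open>The size deviation contributes n / 4 and the two differences n each, all times 2
    / L^2; the sum 9 / 2 is then rounded up to 5.\<close>
  also have "\<dots> = 2 ^ n * (4 * W + 9 / 2 * n / L\<^sup>2)"
    unfolding var by (simp add: field_simps)
  also have "\<dots> \<le> 2 ^ n * (4 * W + 5 * n / L\<^sup>2)"
    by (intro mult_left_mono add_left_mono divide_right_mono) auto
  finally show ?thesis
    by (simp add: W_def c_def n_def abs_divide divide_le_eq mult.commute add.commute
        flip: diff_divide_distrib)
qed

section \<open>The noise kernel\<close>

definition config :: "'a set \<Rightarrow> 'a set \<Rightarrow> 'a \<Rightarrow> bool" where
  "config V A = (\<lambda>x\<in>V. x \<in> A)"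

lemma bij_betw_config: "bij_betw (config V) (Pow V) (cube V)"
  by (rule bij_betw_byWitness[where f' = "\<lambda>\<omega>. {x \<in> V. \<omega> x}"])
     (auto simp: config_def cube_def fun_eq_iff PiE_def extensional_def restrict_def)

lemma config_in_cube: "config V A \<in> cube V"
  by (simp add: config_def cube_def)

text \<open>A permutation of \<open>V\<close> fixes all points outside, so the undefined values stay
  there and moving the configuration is the same as moving its set of ones.\<close>

lemma config_permute:
  assumes "\<sigma> permutes V" "A \<subseteq> V"
  shows "(\<lambda>x. config V A (inv \<sigma> x)) = config V (\<sigma> ` A)"
proof
  fix x
  have "inv \<sigma> x \<in> V \<longleftrightarrow> x \<in> V"
    using permutes_in_image[OF permutes_inv[OF assms(1)]] .
  moreover have "inv \<sigma> x \<in> A \<longleftrightarrow> x \<in> \<sigma> ` A"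
    using permutes_inverses[OF assms(1)] by (auto simp: image_iff) metis
  ultimately show "config V A (inv \<sigma> x) = config V (\<sigma> ` A) x"
    by (simp add: config_def)
qed

lemma sum_cube_eq_sum_Pow: "(\<Sum>\<omega>\<in>cube V. \<phi> \<omega>) = (\<Sum>A\<in>Pow V. \<phi> (config V A))"
  by (rule sum.reindex_bij_betw[OF bij_betw_config, symmetric])

lemma finite_cube [simp]: "finite V \<Longrightarrow> finite (cube V)"
  using bij_betw_finite[OF bij_betw_config[of V]] by simp

lemma card_cube: "finite V \<Longrightarrow> card (cube V) = 2 ^ card V"
  using bij_betw_same_card[OF bij_betw_config[of V]] by (simp add: card_Pow)

lemma cube_nonempty [simp]: "cube V \<noteq> {}"
  by (simp add: cube_def PiE_eq_empty_iff)

lemma expectation_unif_cube: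
  fixes \<phi> :: "('a \<Rightarrow> bool) \<Rightarrow> real"
  shows "finite V \<Longrightarrow> measure_pmf.expectation (unif_cube V) \<phi> = (\<Sum>A\<in>Pow V. \<phi> (config V A)) / 2 ^ card V"
  by (simp add: integral_pmf_of_set card_cube sum_cube_eq_sum_Pow)

text \<open>The left side sees only configurations without \<open>x\<close>, that is the lower
  endpoints of the pivotal edges in direction \<open>x\<close>; embedding them in the event that
  defines the influence gives the inequality.\<close>

lemma sum_pivotal_le_influence:
  assumes fin: "finite V" and x: "x \<in> V"
  shows "(\<Sum>A\<in>Pow (V - {x}). pivotal (\<lambda>A. f (config V A)) A x) / 2 ^ card V \<le> influence V f x"
proof -
  let ?S = "{A \<in> Pow (V - {x}). f (config V A) \<noteq> f (config V (insert x A))}"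
  let ?P = "{\<xi>. f \<xi> \<noteq> f (\<xi>(x := \<not> \<xi> x))}"
  have "(\<Sum>A\<in>Pow (V - {x}). pivotal (\<lambda>A. f (config V A)) A x) = card ?S"
    using fin by (simp add: pivotal_def of_bool_def sum.If_cases Int_def)
  moreover have "card ?S \<le> card (cube V \<inter> ?P)"
  proof (rule card_inj_on_le[where f = "config V"])
    show "inj_on (config V) ?S"
      using bij_betw_imp_inj_on[OF bij_betw_config[of V]] by (auto intro: inj_on_subset)
    have "(config V A)(x := \<not> config V A x) = config V (insert x A)" if "A \<subseteq> V - {x}" for A
      using that x by (auto simp: config_def fun_eq_iff)
    then show "config V ` ?S \<subseteq> cube V \<inter> ?P"
      using bij_betwE[OF bij_betw_config[of V]] by auto
  qed (use fin in auto)
  ultimately show ?thesis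
    using fin by (simp add: influence_def measure_pmf_of_set card_cube divide_right_mono)
qed

lemma sum_pivotal_le_II:
  assumes fin: "finite V"
  shows "(\<Sum>A\<in>Pow V. \<Sum>x\<in>V - A. pivotal (\<lambda>A. f (config V A)) A x) / 2 ^ card V
    \<le> sqrt (card V) * sqrt (II V f)"
proof -
  let ?G = "\<lambda>A. f (config V A)"
  have "(\<Sum>A\<in>Pow V. \<Sum>x\<in>V - A. pivotal ?G A x) = (\<Sum>x\<in>V. \<Sum>A\<in>Pow (V - {x}). pivotal ?G A x)"
    using fin by (subst (1 2) sum.Sigma)
      (auto intro!: sum.reindex_bij_witness[where i = prod.swap and j = prod.swap])
  then have "(\<Sum>A\<in>Pow V. \<Sum>x\<in>V - A. pivotal ?G A x) / 2 ^ card V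
      = (\<Sum>x\<in>V. (\<Sum>A\<in>Pow (V - {x}). pivotal ?G A x) / 2 ^ card V)"
    by (simp add: sum_divide_distrib)
  also have "\<dots> \<le> (\<Sum>x\<in>V. influence V f x * 1)"
    using sum_pivotal_le_influence[OF fin] by (intro sum_mono) auto
  also have "\<dots> \<le> sqrt (\<Sum>x\<in>V. (influence V f x)\<^sup>2) * sqrt (\<Sum>x\<in>V. 1\<^sup>2)"
    unfolding real_sqrt_mult[symmetric] by (intro real_le_rsqrt Cauchy_Schwarz_ineq_sum)
  finally show ?thesis by (simp add: II_def mult.commute)
qed

text \<open>A resampled fair bit differs from the old one with probability 1 / 2, so every
  coordinate flips independently with probability \<open>\<epsilon> / 2\<close>.\<close>

definition noise_kernel :: "'a set \<Rightarrow> real \<Rightarrow> 'a set \<Rightarrow> 'a set \<Rightarrow> real" where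
  "noise_kernel V \<epsilon> A B
    = (\<epsilon> / 2) ^ card (sym_diff A B) * (1 - \<epsilon> / 2) ^ card (V - sym_diff A B)"

lemma noise_kernel_nonneg: "0 \<le> \<epsilon> \<Longrightarrow> \<epsilon> \<le> 1 \<Longrightarrow> 0 \<le> noise_kernel V \<epsilon> A B"
  by (simp add: noise_kernel_def)

lemma noise_kernel_permute:
  assumes g: "g permutes V" and "A \<subseteq> V" "B \<subseteq> V"
  shows "noise_kernel V \<epsilon> (g ` A) (g ` B) = noise_kernel V \<epsilon> A B"
proof -
  have inj: "inj g" using g by (rule permutes_inj)
  have "sym_diff (g ` A) (g ` B) = g ` sym_diff A B"
    by (simp add: image_Un image_set_diff[OF inj])
  moreover have "V - g ` sym_diff A B = g ` (V - sym_diff A B)"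
    using permutes_image[OF g] by (simp add: image_set_diff[OF inj])
  ultimately show ?thesis
    by (simp add: noise_kernel_def card_permutes_image[OF g])
qed

lemma sum_noise_kernel:
  assumes "A \<subseteq> V"
  shows "(\<Sum>B\<in>Pow V. noise_kernel V \<epsilon> A B * \<phi> B)
    = (\<Sum>C\<in>Pow V. (\<epsilon> / 2) ^ card C * (1 - \<epsilon> / 2) ^ card (V - C) * \<phi> (sym_diff A C))"
proof -
  have "sym_diff A (sym_diff A C) = C" for C by auto
  then show ?thesis
    using assms
    by (intro sum.reindex_bij_witness[where i = "sym_diff A" and j = "sym_diff A"])
       (auto simp: noise_kernel_def)
qed

lemma sum_noise_kernel_eq_1:
  assumes "finite V" "A \<subseteq> V"
  shows "(\<Sum>B\<in>Pow V. noise_kernel V \<epsilon> A B) = 1"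
  using sum_noise_kernel[OF assms(2), of \<epsilon> "\<lambda>_. 1"] sum_Pow_variance[OF assms(1), of "{}" "\<epsilon> / 2" 1]
  by simp

text \<open>With \<open>C\<close> the set of flipped coordinates, \<open>A - B\<close> is
  \<open>A \<inter> C\<close> and \<open>B - A\<close> is \<open>(V - A) \<inter> C\<close>. Both
  sizes are therefore binomial with parameter \<open>\<epsilon> / 2\<close>.\<close>

lemma noise_kernel_variance:
  assumes fin: "finite V" and A: "A \<subseteq> V"
  shows "(\<Sum>B\<in>Pow V. noise_kernel V \<epsilon> A B * (card (A - B) - \<epsilon> / 2 * card A)\<^sup>2)
      = \<epsilon> / 2 * (1 - \<epsilon> / 2) * card A" (is ?removed)
    and "(\<Sum>B\<in>Pow V. noise_kernel V \<epsilon> A B * (card (B - A) - \<epsilon> / 2 * card (V - A))\<^sup>2)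
      = \<epsilon> / 2 * (1 - \<epsilon> / 2) * card (V - A)" (is ?added)
proof -
  have "A - sym_diff A C = A \<inter> C" for C by auto
  then show ?removed
    using sum_Pow_variance[OF fin A, of "\<epsilon> / 2" 0] by (subst sum_noise_kernel[OF A]) simp
  have "(\<Sum>B\<in>Pow V. noise_kernel V \<epsilon> A B * (card (B - A) - \<epsilon> / 2 * card (V - A))\<^sup>2)
    = (\<Sum>C\<in>Pow V. (\<epsilon> / 2) ^ card C * (1 - \<epsilon> / 2) ^ card (V - C)
        * (0 + card ((V - A) \<inter> C) - \<epsilon> / 2 * card (V - A))\<^sup>2)"
    unfolding sum_noise_kernel[OF A]
  proof (intro sum.cong refl)
    fix C assume "C \<in> Pow V"
    then have "sym_diff A C - A = (V - A) \<inter> C" by auto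
    then show "(\<epsilon> / 2) ^ card C * (1 - \<epsilon> / 2) ^ card (V - C)
        * (card (sym_diff A C - A) - \<epsilon> / 2 * card (V - A))\<^sup>2
      = (\<epsilon> / 2) ^ card C * (1 - \<epsilon> / 2) ^ card (V - C)
        * (0 + card ((V - A) \<inter> C) - \<epsilon> / 2 * card (V - A))\<^sup>2" by simp
  qed
  also have "\<dots> = \<epsilon> / 2 * (1 - \<epsilon> / 2) * card (V - A)"
    using sum_Pow_variance[OF fin, of "V - A" "\<epsilon> / 2" 0] by simp
  finally show ?added .
qed

definition resample :: "'a set \<Rightarrow> real \<Rightarrow> ('a \<Rightarrow> bool) \<Rightarrow> ('a \<Rightarrow> bool) pmf" where
  "resample V \<epsilon> \<omega> = Pi_pmf V undefined (\<lambda>x. bind_pmf (pmf_of_set UNIV) (\<lambda>a.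
     bind_pmf (bernoulli_pmf \<epsilon>) (\<lambda>b. return_pmf (if b then a else \<omega> x))))"

lemma noise_pair_eq_resample:
  assumes fin: "finite V"
  shows "noise_pair V \<epsilon> = bind_pmf (unif_cube V) (\<lambda>\<omega>. map_pmf (Pair \<omega>) (resample V \<epsilon> \<omega>))"
proof -
  have cube: "unif_cube V = Pi_pmf V undefined (\<lambda>_. pmf_of_set UNIV)"
    using fin by (subst Pi_pmf_of_set)
      (auto simp: cube_def PiE_dflt_def PiE_def extensional_def intro!: arg_cong[of _ _ pmf_of_set])
  \<comment> \<open>The defaults have to agree off \<open>V\<close>: the mark there is
    \<open>False\<close>, so the value is that of \<open>\<omega>\<close>, which is
    \<open>undefined\<close> because \<open>\<omega>\<close> lies in the cube.\<close>
  have *: "bind_pmf (unif_cube V) (\<lambda>\<omega>'.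
        bind_pmf (Pi_pmf V False (\<lambda>_. bernoulli_pmf \<epsilon>)) (\<lambda>B.
          return_pmf (\<lambda>x. if B x then \<omega>' x else \<omega> x)))
      = resample V \<epsilon> \<omega>" if \<omega>: "\<omega> \<in> cube V" for \<omega>
    unfolding resample_def cube
    apply (subst Pi_pmf_bind[OF fin, where d' = undefined])
    apply (subst Pi_pmf_bind[OF fin, where d' = False])
    apply (intro bind_pmf_cong refl)
    subgoal for f B
      using set_Pi_pmf_subset[OF fin, of False "\<lambda>_. bernoulli_pmf \<epsilon>"] \<omega> fin
      by (auto simp: cube_def PiE_def extensional_def intro!: arg_cong[of _ _ return_pmf])
    done
  have "bind_pmf (unif_cube V) (\<lambda>\<omega>'.
        bind_pmf (Pi_pmf V False (\<lambda>_. bernoulli_pmf \<epsilon>)) (\<lambda>B.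
          return_pmf (\<omega>, \<lambda>x. if B x then \<omega>' x else \<omega> x)))
      = map_pmf (Pair \<omega>) (resample V \<epsilon> \<omega>)" if "\<omega> \<in> set_pmf (unif_cube V)" for \<omega>
    using that fin by (subst *[symmetric]) (simp_all add: map_bind_pmf)
  then show ?thesis
    unfolding noise_pair_def by (intro bind_pmf_cong refl)
qed

lemma pmf_resample:
  assumes fin: "finite V" and \<epsilon>: "0 \<le> \<epsilon>" "\<epsilon> \<le> 1" and sub: "A \<subseteq> V" "B \<subseteq> V"
  shows "pmf (resample V \<epsilon> (config V A)) (config V B) = noise_kernel V \<epsilon> A B"
proof -
  have bit: "pmf (bind_pmf (pmf_of_set UNIV) (\<lambda>a. bind_pmf (bernoulli_pmf \<epsilon>)
      (\<lambda>b. return_pmf (if b then a else w)))) c = (if c = w then 1 - \<epsilon> / 2 else \<epsilon> / 2)" for c w :: bool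
    using \<epsilon> unfolding bernoulli_pmf_half_conv_pmf_of_set[symmetric]
    by (cases c; cases w) (simp_all add: pmf_bind measure_pmf_single field_simps)
  have "pmf (resample V \<epsilon> (config V A)) (config V B)
      = (\<Prod>x\<in>V. if config V B x = config V A x then 1 - \<epsilon> / 2 else \<epsilon> / 2)"
    unfolding resample_def by (subst pmf_Pi'[OF fin]) (auto simp: bit config_def)
  also have "\<dots> = (\<Prod>x\<in>V. if x \<in> sym_diff A B then \<epsilon> / 2 else 1 - \<epsilon> / 2)"
    by (intro prod.cong) (auto simp: config_def)
  also have "\<dots> = noise_kernel V \<epsilon> A B"
  proof -
    have "V \<inter> {x. x \<in> sym_diff A B} = sym_diff A B" "V \<inter> - {x. x \<in> sym_diff A B} = V - sym_diff A B"
      using sub by auto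
    then show ?thesis
      using fin by (simp add: prod.If_cases noise_kernel_def)
  qed
  finally show ?thesis .
qed

lemma expectation_noise_pair:
  assumes fin: "finite V" and \<epsilon>: "0 \<le> \<epsilon>" "\<epsilon> \<le> 1"
  shows "measure_pmf.expectation (noise_pair V \<epsilon>) (\<lambda>(\<omega>, \<omega>'). f \<omega> * f \<omega>')
    = (\<Sum>A\<in>Pow V. \<Sum>B\<in>Pow V. noise_kernel V \<epsilon> A B * (f (config V A) * f (config V B))) / 2 ^ card V"
proof -
  have supp: "set_pmf (noise_pair V \<epsilon>) \<subseteq> cube V \<times> cube V"
  proof -
    have "set_pmf (resample V \<epsilon> \<omega>) \<subseteq> cube V" for \<omega>
      unfolding resample_def
      by (rule order.trans[OF set_Pi_pmf_subset[OF fin]]) (auto simp: cube_def PiE_def extensional_def)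
    then show ?thesis
      using fin by (auto simp: noise_pair_eq_resample)
  qed
  have pmf: "pmf (noise_pair V \<epsilon>) (config V A, config V B) = noise_kernel V \<epsilon> A B / 2 ^ card V"
    if "A \<subseteq> V" "B \<subseteq> V" for A B
  proof -
    have "pmf (noise_pair V \<epsilon>) (config V A, config V B)
        = (\<Sum>A'\<in>Pow V. pmf (map_pmf (Pair (config V A')) (resample V \<epsilon> (config V A'))) (config V A, config V B))
          / 2 ^ card V"
      using fin by (simp add: noise_pair_eq_resample pmf_bind expectation_unif_cube)
    also have "(\<Sum>A'\<in>Pow V. pmf (map_pmf (Pair (config V A')) (resample V \<epsilon> (config V A'))) (config V A, config V B))
        = (\<Sum>A'\<in>Pow V. if A' = A then noise_kernel V \<epsilon> A B else 0)"
    proof (intro sum.cong refl)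
      fix A' assume A': "A' \<in> Pow V"
      show "pmf (map_pmf (Pair (config V A')) (resample V \<epsilon> (config V A'))) (config V A, config V B)
          = (if A' = A then noise_kernel V \<epsilon> A B else 0)"
      proof (cases "A' = A")
        case True
        then show ?thesis
          using pmf_resample[OF fin \<epsilon> that]
          by (simp add: pmf_map_inj'[of "Pair (config V A)"] inj_on_def)
      next
        case False
        then have "config V A' \<noteq> config V A"
          using A' that bij_betw_imp_inj_on[OF bij_betw_config[of V]] by (auto dest: inj_onD)
        then have "(config V A, config V B) \<notin> Pair (config V A') ` set_pmf (resample V \<epsilon> (config V A'))"
          by auto
        then show ?thesis
          using False by (simp add: pmf_eq_0_set_pmf)
      qed
    qed
    also have "\<dots> = noise_kernel V \<epsilon> A B" using that fin by simp
    finally show ?thesis .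
  qed
  have "measure_pmf.expectation (noise_pair V \<epsilon>) (\<lambda>(\<omega>, \<omega>'). f \<omega> * f \<omega>')
      = (\<Sum>p\<in>cube V \<times> cube V. (case p of (\<omega>, \<omega>') \<Rightarrow> f \<omega> * f \<omega>') * pmf (noise_pair V \<epsilon>) p)"
    using fin supp by (intro integral_measure_pmf_real) auto
  also have "\<dots> = (\<Sum>A\<in>Pow V. \<Sum>B\<in>Pow V. f (config V A) * f (config V B)
      * pmf (noise_pair V \<epsilon>) (config V A, config V B))"
    by (simp add: sum.cartesian_product' sum_cube_eq_sum_Pow)
  also have "\<dots> = (\<Sum>A\<in>Pow V. \<Sum>B\<in>Pow V.
      noise_kernel V \<epsilon> A B * (f (config V A) * f (config V B)) / 2 ^ card V)"
    by (intro sum.cong refl) (simp add: pmf)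
  finally show ?thesis by (simp add: sum_divide_distrib)
qed

section \<open>The interchange process on a time grid\<close>

text \<open>The choice is literally that of \<open>ringing_pair\<close> when \<open>S\<close> is the
  set of pairs ringing at the only ring time of a cell; this makes the two permutations equal even
  if clocks coincide.\<close>

definition grid_swap :: "'a set set \<Rightarrow> 'a \<Rightarrow> 'a" where
  "grid_swap S = (if S = {} then id else pair_swap (SOME e. e \<in> S))"

definition ringers :: "'a set \<Rightarrow> ('a set \<Rightarrow> real set) \<Rightarrow> real \<Rightarrow> real \<Rightarrow> 'a set set" where
  "ringers V C a b = {e \<in> unordered_pairs V. C e \<inter> {a<..b} \<noteq> {}}"

primrec grid_perm :: "'a set \<Rightarrow> ('a set \<Rightarrow> real set) \<Rightarrow> real \<Rightarrow> nat \<Rightarrow> 'a \<Rightarrow> 'a" where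
  "grid_perm V C h 0 = id"
| "grid_perm V C h (Suc k) = grid_swap (ringers V C (real k * h) (real (Suc k) * h)) \<circ> grid_perm V C h k"

abbreviation all_rings :: "'a set \<Rightarrow> ('a set \<Rightarrow> real set) \<Rightarrow> real set" where
  "all_rings V C \<equiv> \<Union>e\<in>unordered_pairs V. C e"

lemma finite_unordered_pairs [simp]: "finite V \<Longrightarrow> finite (unordered_pairs V)"
  by (rule finite_subset[of _ "Pow V"]) (auto simp: unordered_pairs_def)

lemma pair_swap_pair: "pair_swap {x, y} = Transposition.transpose x y"
  unfolding pair_swap_def
  by (rule the_equality) (auto simp: doubleton_eq_iff transpose_commute)

lemma pair_swap_permutes: "e \<in> unordered_pairs V \<Longrightarrow> pair_swap e permutes V"
  by (auto simp: unordered_pairs_def pair_swap_pair permutes_swap_id)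

lemma interchange_perm_0: "interchange_perm V C 0 = id"
  by (simp add: interchange_perm_def)

text \<open>The hypothesis bounds ring times, not ringing pairs. A single new time is the largest so
  far, so it extends the sorted list at its end and composes one swap on the left.\<close>

lemma interchange_perm_step:
  assumes fin: "finite (all_rings V C \<inter> {0<..b})" and ab: "0 \<le> a" "a \<le> b"
    and one: "card (all_rings V C \<inter> {a<..b}) \<le> 1"
  shows "interchange_perm V C b = grid_swap (ringers V C a b) \<circ> interchange_perm V C a"
proof -
  let ?U = "all_rings V C"
  have split: "?U \<inter> {0<..b} = (?U \<inter> {a<..b}) \<union> (?U \<inter> {0<..a})" using ab by auto
  have fin': "finite (?U \<inter> {a<..b})" "finite (?U \<inter> {0<..a})"
    using fin unfolding split by auto
  show ?thesis
  proof (cases "?U \<inter> {a<..b} = {}")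
    case True
    then have "ringers V C a b = {}" by (auto simp: ringers_def)
    moreover have "?U \<inter> {0<..b} = ?U \<inter> {0<..a}" using split True by simp
    ultimately show ?thesis
      by (simp add: interchange_perm_def grid_swap_def)
  next
    case False
    then have "card (?U \<inter> {a<..b}) = 1"
      using one fin' by (metis One_nat_def card_0_eq le_Suc_eq le_zero_eq)
    then obtain s where s: "?U \<inter> {a<..b} = {s}" by (auto simp: card_1_singleton_iff)
    then have mem: "s \<in> ?U" "a < s" "s \<le> b" by auto
    have "ringers V C a b = {e \<in> unordered_pairs V. s \<in> C e}"
      using s by (auto simp: ringers_def)
    then have ring: "pair_swap (ringing_pair V C s) = grid_swap (ringers V C a b)"
      using mem by (auto simp: ringing_pair_def grid_swap_def)
    have "sorted_list_of_set (?U \<inter> {0<..b}) = sorted_list_of_set (?U \<inter> {0<..a}) @ [s]"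
      unfolding split s using fin' mem
      by (auto intro!: sorted_insort_is_snoc)
    then show ?thesis by (simp add: interchange_perm_def ring)
  qed
qed

lemma interchange_perm_eq_grid_perm:
  assumes fin: "\<And>b. finite (all_rings V C \<inter> {0<..b})" and h: "0 \<le> h"
    and one: "\<And>i. i < k \<Longrightarrow> card (all_rings V C \<inter> {real i * h<..real (Suc i) * h}) \<le> 1"
  shows "interchange_perm V C (real k * h) = grid_perm V C h k"
  using one
proof (induction k)
  case 0
  then show ?case by (simp add: interchange_perm_0)
next
  case (Suc k)
  have "interchange_perm V C (real (Suc k) * h)
      = grid_swap (ringers V C (real k * h) (real (Suc k) * h)) \<circ> interchange_perm V C (real k * h)"
    using h Suc.prems[of k] by (intro interchange_perm_step fin) (auto intro!: mult_right_mono)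
  then show ?case using Suc by simp
qed

lemma finite_set_separated:
  fixes F :: "real set"
  assumes "finite F"
  obtains \<delta> where "0 < \<delta>" "\<And>x y. x \<in> F \<Longrightarrow> y \<in> F \<Longrightarrow> \<bar>x - y\<bar> < \<delta> \<Longrightarrow> x = y"
proof -
  \<comment> \<open>The set of positive gaps; the extra 1 keeps it nonempty when \<open>F\<close>
    has at most one point.\<close>
  define S where "S = insert 1 ((\<lambda>(x, y). \<bar>x - y\<bar>) ` (F \<times> F - Id))"
  have "finite S" unfolding S_def using assms by simp
  moreover have "\<forall>s\<in>S. 0 < s" by (auto simp: S_def)
  ultimately have "0 < Min S" by (subst Min_gr_iff) (auto simp: S_def)
  moreover have "x = y" if "x \<in> F" "y \<in> F" "\<bar>x - y\<bar> < Min S" for x y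
  proof (rule ccontr)
    assume "x \<noteq> y"
    then have "\<bar>x - y\<bar> \<in> S" using that by (auto simp: S_def)
    then show False using that \<open>finite S\<close> by (meson Min_le not_le)
  qed
  ultimately show ?thesis using that by blast
qed

text \<open>This holds on every path, also when clocks ring simultaneously, because \<open>SOME\<close> then makes the
  same choice on both sides.  Hence \<open>interchange_perm\<close> is measurable, not merely up to a null set.\<close>

lemma eventually_interchange_perm_eq_grid_perm:
  assumes fin: "\<And>b. finite (all_rings V C \<inter> {0<..b})" and t: "0 < t"
  shows "\<forall>\<^sub>F K in sequentially. interchange_perm V C t = grid_perm V C (t / K) K"
proof -
  obtain \<delta> where \<delta>: "0 < \<delta>"
    and sep: "\<And>x y. x \<in> all_rings V C \<inter> {0<..t} \<Longrightarrow> y \<in> all_rings V C \<inter> {0<..t} \<Longrightarrow> \<bar>x - y\<bar> < \<delta> \<Longrightarrow> x = y"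
    using finite_set_separated[OF fin] by metis
  have "(\<lambda>K. t / real K) \<longlonglongrightarrow> 0" by (rule lim_const_over_n)
  then have "\<forall>\<^sub>F K in sequentially. t / real K < \<delta>"
    using \<delta> by (rule order_tendstoD)
  moreover have "\<forall>\<^sub>F K in sequentially. 0 < K" by (rule eventually_gt_at_top)
  ultimately show ?thesis
  proof eventually_elim
    case (elim K)
    have "card (all_rings V C \<inter> {real i * (t / K)<..real (Suc i) * (t / K)}) \<le> 1" if "i < K" for i
    proof -
      let ?A = "all_rings V C \<inter> {real i * (t / K)<..real (Suc i) * (t / K)}"
      have "0 \<le> real i * (t / K)" using t by simp
      moreover have "real (Suc i) * (t / K) \<le> real K * (t / K)"
        using that t by (intro mult_right_mono) auto
      then have "real (Suc i) * (t / K) \<le> t" using elim by simp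
      ultimately have sub: "?A \<subseteq> all_rings V C \<inter> {0<..t}" by auto
      moreover have "\<bar>x - y\<bar> < \<delta>" if "x \<in> ?A" "y \<in> ?A" for x y
      proof -
        have "real (Suc i) * (t / K) = real i * (t / K) + t / K"
          by (simp add: add_divide_distrib algebra_simps)
        then show ?thesis using that elim
          unfolding Int_iff greaterThanAtMost_iff by linarith
      qed
      ultimately have "\<forall>x\<in>?A. \<forall>y\<in>?A. x = y" using sep by blast
      then show ?thesis
        using finite_subset[OF sub fin] by (simp add: card_le_Suc0_iff_eq)
    qed
    then have "interchange_perm V C (real K * (t / K)) = grid_perm V C (t / K) K"
      using t by (intro interchange_perm_eq_grid_perm fin) auto
    then show ?case using elim by simp
  qed
qed

lemma grid_perm_permutes: "grid_perm V C h k permutes V"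
proof (induction k)
  case (Suc k)
  have swap: "grid_swap (ringers V C a b) permutes V" for a b
  proof (cases "ringers V C a b = {}")
    case False
    then have "(SOME e. e \<in> ringers V C a b) \<in> ringers V C a b" by (simp add: some_in_eq)
    then show ?thesis
      using False by (auto simp: grid_swap_def ringers_def intro: pair_swap_permutes)
  qed (simp add: grid_swap_def permutes_id)
  show ?case
    unfolding grid_perm.simps by (intro permutes_compose Suc swap)
qed (simp only: grid_perm.simps permutes_id)

lemma interchange_perm_permutes:
  assumes "\<And>b. finite (all_rings V C \<inter> {0<..b})" "0 < t"
  shows "interchange_perm V C t permutes V"
proof -
  have "\<exists>K. interchange_perm V C t = grid_perm V C (t / real K) K"
    using eventually_happens[OF eventually_interchange_perm_eq_grid_perm[OF assms]] by auto
  then show ?thesis using grid_perm_permutes by metis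
qed

lemma ring_count_diff:
  assumes "0 \<le> a" "a \<le> b" "finite (S \<inter> {..b})"
  shows "ring_count S b = ring_count S a + card (S \<inter> {a<..b})"
proof -
  have fin: "finite (S \<inter> {0<..b})" by (rule finite_subset[OF _ assms(3)]) auto
  have "S \<inter> {0<..b} = (S \<inter> {0<..a}) \<union> (S \<inter> {a<..b})" using assms by auto
  moreover from this fin have "finite (S \<inter> {0<..a})" "finite (S \<inter> {a<..b})" by auto
  ultimately have "card (S \<inter> {0<..b}) = card (S \<inter> {0<..a}) + card (S \<inter> {a<..b})"
    by (simp add: card_Un_disjoint[symmetric] disjoint_iff)
  then show ?thesis using assms by (simp add: ring_count_def)
qed

section \<open>Measurability of the interchange permutation\<close>

context complete_graph_exclusion
begin

abbreviation rings_in :: "'a set \<Rightarrow> real \<Rightarrow> real \<Rightarrow> 'w \<Rightarrow> nat" where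
  "rings_in e a b \<omega> \<equiv> card (R e \<omega> \<inter> {a<..b})"

lemma finite_rings: "e \<in> unordered_pairs V \<Longrightarrow> \<omega> \<in> space M \<Longrightarrow> finite (R e \<omega> \<inter> {..b})"
  using clocks unfolding poisson_clock_def by blast

lemma finite_rings_in: "e \<in> unordered_pairs V \<Longrightarrow> \<omega> \<in> space M \<Longrightarrow> finite (R e \<omega> \<inter> {a<..b})"
  by (rule finite_subset[OF _ finite_rings[of e \<omega> b]]) auto

lemma finite_all_rings:
  assumes "finite V" "\<omega> \<in> space M"
  shows "finite (all_rings V (\<lambda>e. R e \<omega>) \<inter> {0<..b})"
proof -
  have "all_rings V (\<lambda>e. R e \<omega>) \<inter> {0<..b} = (\<Union>e\<in>unordered_pairs V. R e \<omega> \<inter> {0<..b})" by auto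
  moreover have "finite (\<Union>e\<in>unordered_pairs V. R e \<omega> \<inter> {0<..b})"
    using assms by (intro finite_UN_I finite_unordered_pairs finite_rings_in)
  ultimately show ?thesis by (simp only:)
qed

text \<open>The independence clause of \<open>poisson_clock\<close> includes measurability of the
  increments. The grid a, b, b, ... makes the interval in question its first increment.\<close>

lemma measurable_rings_in:
  assumes e: "e \<in> unordered_pairs V" and ab: "0 \<le> a" "a \<le> b"
  shows "rings_in e a b \<in> M \<rightarrow>\<^sub>M count_space UNIV"
proof -
  define \<tau> :: "nat \<Rightarrow> real" where "\<tau> i = (if i = 0 then a else b)" for i
  have "0 \<le> \<tau> 0" "incseq \<tau>" using ab by (auto simp: \<tau>_def incseq_def)
  then have "indep_vars (\<lambda>_. count_space UNIV) (\<lambda>i \<omega>. rings_in e (\<tau> i) (\<tau> (Suc i)) \<omega>) UNIV"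
    using clocks[OF e] unfolding poisson_clock_def by blast
  then have "random_variable (count_space UNIV) (rings_in e (\<tau> 0) (\<tau> (Suc 0)))"
    unfolding indep_vars_def2 by blast
  then show ?thesis by (simp add: \<tau>_def)
qed

lemma measurable_ringers:
  assumes fin: "finite V" and ab: "0 \<le> a" "a \<le> b"
  shows "(\<lambda>\<omega>. ringers V (\<lambda>e. R e \<omega>) a b) \<in> M \<rightarrow>\<^sub>M count_space (Pow (unordered_pairs V))"
proof -
  have fin': "finite (Pow (unordered_pairs V))" using fin by simp
  have ringers: "ringers V (\<lambda>e. R e \<omega>) a b = {e \<in> unordered_pairs V. rings_in e a b \<omega> \<noteq> 0}"
    if "\<omega> \<in> space M" for \<omega>
    unfolding ringers_def using that by (intro Collect_cong conj_cong refl) (simp add: finite_rings_in)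
  have "(\<lambda>\<omega>. ringers V (\<lambda>e. R e \<omega>) a b) -` {S} \<inter> space M \<in> events"
    if S: "S \<in> Pow (unordered_pairs V)" for S
  proof -
    have "(\<lambda>\<omega>. ringers V (\<lambda>e. R e \<omega>) a b) -` {S} \<inter> space M
        = {\<omega> \<in> space M. {e \<in> unordered_pairs V. rings_in e a b \<omega> \<noteq> 0} = S}"
      using ringers by (intro set_eqI) (simp add: vimage_def conj_commute cong: conj_cong)
    also have "\<dots> = {\<omega> \<in> space M. \<forall>e\<in>unordered_pairs V. (rings_in e a b \<omega> \<noteq> 0) = (e \<in> S)}"
    proof -
      have "({e \<in> unordered_pairs V. Q e} = S) = (\<forall>e\<in>unordered_pairs V. Q e = (e \<in> S))" for Q
        using S by auto
      then show ?thesis by simp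
    qed
    also have "\<dots> \<in> events"
    proof (intro sets.sets_Collect_finite_All fin finite_unordered_pairs)
      fix e assume e: "e \<in> unordered_pairs V"
      have "(\<lambda>\<omega>. (rings_in e a b \<omega> \<noteq> 0) = (e \<in> S)) \<in> M \<rightarrow>\<^sub>M count_space UNIV"
        by (rule measurable_compose[OF measurable_rings_in[OF e ab]]) simp
      then show "{\<omega> \<in> space M. (rings_in e a b \<omega> \<noteq> 0) = (e \<in> S)} \<in> events"
        by (simp add: pred_def)
    qed
    finally show ?thesis .
  qed
  then show ?thesis
    unfolding measurable_count_space_eq2[OF fin'] by (auto simp: ringers_def)
qed

lemma measurable_grid_perm:
  assumes fin: "finite V" and h: "0 \<le> h"
  shows "(\<lambda>\<omega>. grid_perm V (\<lambda>e. R e \<omega>) h k) \<in> M \<rightarrow>\<^sub>M count_space UNIV"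
proof (induction k)
  case (Suc k)
  have "(\<lambda>\<omega>. (\<lambda>S \<omega>. grid_swap S \<circ> grid_perm V (\<lambda>e. R e \<omega>) h k)
      (ringers V (\<lambda>e. R e \<omega>) (real k * h) (real (Suc k) * h)) \<omega>) \<in> M \<rightarrow>\<^sub>M count_space UNIV"
  proof (rule measurable_compose_countable'[where I = "Pow (unordered_pairs V)"])
    show "(\<lambda>\<omega>. grid_swap S \<circ> grid_perm V (\<lambda>e. R e \<omega>) h k) \<in> M \<rightarrow>\<^sub>M count_space UNIV" for S
      using Suc by (rule measurable_compose) simp
    show "(\<lambda>\<omega>. ringers V (\<lambda>e. R e \<omega>) (real k * h) (real (Suc k) * h))
        \<in> M \<rightarrow>\<^sub>M count_space (Pow (unordered_pairs V))"
      using h by (intro measurable_ringers fin) (auto intro: mult_right_mono)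
    show "countable (Pow (unordered_pairs V))" using fin by (simp add: countable_finite)
  qed
  then show ?case by (simp only: grid_perm.simps)
qed simp

text \<open>Since the grid permutations are eventually equal to the true one, the preimage of
  \<open>B\<close> is the limit inferior of the corresponding grid events.\<close>

lemma measurable_interchange_perm:
  assumes fin: "finite V" and t: "0 < t"
  shows "(\<lambda>\<omega>. interchange_perm V (\<lambda>e. R e \<omega>) t) \<in> M \<rightarrow>\<^sub>M count_space UNIV"
proof (rule measurableI)
  fix B :: "('a \<Rightarrow> 'a) set"
  have eq: "(\<lambda>\<omega>. interchange_perm V (\<lambda>e. R e \<omega>) t) -` B \<inter> space M
      = {\<omega> \<in> space M. \<exists>K0. \<forall>K. K0 \<le> K \<longrightarrow> grid_perm V (\<lambda>e. R e \<omega>) (t / real K) K \<in> B}"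
  proof (intro set_eqI iffI; clarsimp)
    fix \<omega> assume \<omega>: "\<omega> \<in> space M"
    have ev: "\<forall>\<^sub>F K in sequentially.
        interchange_perm V (\<lambda>e. R e \<omega>) t = grid_perm V (\<lambda>e. R e \<omega>) (t / real K) K"
      by (intro eventually_interchange_perm_eq_grid_perm finite_all_rings fin \<omega> t)
    show "\<exists>K0. \<forall>K\<ge>K0. grid_perm V (\<lambda>e. R e \<omega>) (t / real K) K \<in> B"
      if "interchange_perm V (\<lambda>e. R e \<omega>) t \<in> B"
      using ev that unfolding eventually_sequentially by metis
    show "interchange_perm V (\<lambda>e. R e \<omega>) t \<in> B"
      if "\<forall>K\<ge>K0. grid_perm V (\<lambda>e. R e \<omega>) (t / real K) K \<in> B" for K0
    proof -
      have "\<forall>\<^sub>F K in sequentially. grid_perm V (\<lambda>e. R e \<omega>) (t / real K) K \<in> B"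
        using that unfolding eventually_sequentially by blast
      with ev have "\<forall>\<^sub>F K :: nat in sequentially. interchange_perm V (\<lambda>e. R e \<omega>) t \<in> B"
        by eventually_elim simp
      then show ?thesis by simp
    qed
  qed
  have "(\<lambda>\<omega>. grid_perm V (\<lambda>e. R e \<omega>) (t / real K) K \<in> B) \<in> M \<rightarrow>\<^sub>M count_space UNIV" for K
    using t by (intro measurable_compose[OF measurable_grid_perm[OF fin]]) auto
  then have *: "{\<omega> \<in> space M. grid_perm V (\<lambda>e. R e \<omega>) (t / real K) K \<in> B} \<in> events" for K
    by (simp add: pred_def)
  show "(\<lambda>\<omega>. interchange_perm V (\<lambda>e. R e \<omega>) t) -` B \<inter> space M \<in> events"
  proof -
    have "{\<omega> \<in> space M. \<exists>K0. \<forall>K. K0 \<le> K \<longrightarrow> grid_perm V (\<lambda>e. R e \<omega>) (t / real K) K \<in> B}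
        = (\<Union>K0. \<Inter>K\<in>{K0..}. {\<omega> \<in> space M. grid_perm V (\<lambda>e. R e \<omega>) (t / real K) K \<in> B})"
      by (intro set_eqI) auto
    also have "\<dots> \<in> events"
    proof (rule sets.countable_UN, rule image_subsetI)
      show "(\<Inter>K\<in>{K0..}. {\<omega> \<in> space M. grid_perm V (\<lambda>e. R e \<omega>) (t / real K) K \<in> B}) \<in> events" for K0
        by (rule sets.countable_INT') (auto simp: * )
    qed
    finally show ?thesis unfolding eq .
  qed
qed simp

end

section \<open>Words of transpositions\<close>

text \<open>A letter describes one time cell: \<open>None\<close> for no ring at all,
  \<open>Some e\<close> for exactly one ring, on the clock of \<open>e\<close>.\<close>

definition letter_perm :: "'a set option \<Rightarrow> 'a \<Rightarrow> 'a" where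
  "letter_perm x = (case x of None \<Rightarrow> id | Some e \<Rightarrow> pair_swap e)"

text \<open>The probability of the letter divided by the probability that no clock rings: a Poisson
  count of parameter \<open>r\<close> is 0 or 1 with probability exp (- r) or r exp (- r).\<close>

definition letter_weight :: "real \<Rightarrow> 'a set option \<Rightarrow> real" where
  "letter_weight r x = (case x of None \<Rightarrow> 1 | Some e \<Rightarrow> r)"

definition word_perm :: "'a set option list \<Rightarrow> ('a \<Rightarrow> 'a) \<Rightarrow> 'a \<Rightarrow> 'a" where
  "word_perm w \<pi> = fold (\<lambda>x \<pi>. letter_perm x \<circ> \<pi>) w \<pi>"

lemma word_perm_Cons: "word_perm (x # w) \<pi> = word_perm w (letter_perm x \<circ> \<pi>)"
  by (simp add: word_perm_def)

definition words :: "'a set \<Rightarrow> nat \<Rightarrow> 'a set option list set" where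
  "words V K = {w. set w \<subseteq> insert None (Some ` unordered_pairs V) \<and> length w = K}"

text \<open>With \<open>r = t / (n K)\<close>, the operator \<open>exp (- r |pairs|) swap_op V r\<close> is an approximate transition
  operator for a time step \<open>t / K\<close>, in which several rings in one step are discarded.\<close>

definition swap_op :: "'a set \<Rightarrow> real \<Rightarrow> (('a \<Rightarrow> 'a) \<Rightarrow> real) \<Rightarrow> ('a \<Rightarrow> 'a) \<Rightarrow> real" where
  "swap_op V r \<phi> \<pi> = \<phi> \<pi> + r * (\<Sum>e\<in>unordered_pairs V. \<phi> (pair_swap e \<circ> \<pi>))"

lemma finite_words [simp]: "finite V \<Longrightarrow> finite (words V K)"
  unfolding words_def by (intro finite_lists_length_eq) simp

lemma nth_words: "w \<in> words V K \<Longrightarrow> i < K \<Longrightarrow> w ! i \<in> insert None (Some ` unordered_pairs V)"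
  unfolding words_def using nth_mem by blast

lemma words_0: "words V 0 = {[]}"
  by (auto simp: words_def)

lemma words_Suc: "words V (Suc K) = (\<lambda>(x, w). x # w) ` (insert None (Some ` unordered_pairs V) \<times> words V K)"
  unfolding words_def lists_length_Suc_eq
    product_swap[of "insert None (Some ` unordered_pairs V)", symmetric] image_image
  by (simp add: case_prod_unfold)

lemma sum_letters:
  "finite V \<Longrightarrow> (\<Sum>x\<in>insert None (Some ` unordered_pairs V). \<psi> x)
    = \<psi> None + (\<Sum>e\<in>unordered_pairs V. \<psi> (Some e))"
  by (subst sum.insert) (auto simp: sum.reindex)

text \<open>Expansion of the power into words. The outermost application of \<open>swap_op\<close>
  acts on the starting permutation and so chooses the first letter, which is why the induction
  varies \<open>\<pi>\<close>.\<close>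

lemma sum_words:
  assumes fin: "finite V"
  shows "(\<Sum>w\<in>words V K. (\<Prod>x\<leftarrow>w. letter_weight r x) * \<phi> (word_perm w \<pi>)) = (swap_op V r ^^ K) \<phi> \<pi>"
proof (induction K arbitrary: \<pi>)
  case 0
  then show ?case by (simp add: words_0 word_perm_def)
next
  case (Suc K)
  have "(\<Sum>w\<in>words V (Suc K). (\<Prod>x\<leftarrow>w. letter_weight r x) * \<phi> (word_perm w \<pi>))
      = (\<Sum>x\<in>insert None (Some ` unordered_pairs V). letter_weight r x *
          (\<Sum>w\<in>words V K. (\<Prod>x\<leftarrow>w. letter_weight r x) * \<phi> (word_perm w (letter_perm x \<circ> \<pi>))))"
    unfolding words_Suc
    by (subst sum.reindex)
      (auto simp: inj_on_def sum.cartesian_product' word_perm_def sum_distrib_left mult.assoc)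
  also have "\<dots> = swap_op V r ((swap_op V r ^^ K) \<phi>) \<pi>"
    unfolding Suc.IH sum_letters[OF fin]
    by (simp add: swap_op_def letter_weight_def letter_perm_def sum_distrib_left)
  finally show ?case by simp
qed

text \<open>Words started at the identity reach only permutations of \<open>V\<close>, so the power
  is integration against its own point masses.\<close>

lemma swap_op_power_eq_sum:
  assumes fin: "finite V"
  shows "(swap_op V r ^^ K) \<phi> id
    = (\<Sum>\<sigma> | \<sigma> permutes V. (swap_op V r ^^ K) (\<lambda>\<pi>. of_bool (\<pi> = \<sigma>)) id * \<phi> \<sigma>)"
proof -
  have perm: "word_perm w id permutes V" if "w \<in> words V K" for w
  proof -
    have "word_perm w \<pi> permutes V"
      if "set w \<subseteq> insert None (Some ` unordered_pairs V)" "\<pi> permutes V" for w \<pi>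
      using that
    proof (induction w arbitrary: \<pi>)
      case (Cons x w)
      then have "letter_perm x permutes V"
        by (auto simp: letter_perm_def permutes_id intro: pair_swap_permutes)
      then have "letter_perm x \<circ> \<pi> permutes V"
        using Cons.prems(2) by (intro permutes_compose)
      then show ?case using Cons by (simp add: word_perm_Cons)
    qed (simp add: word_perm_def)
    then show ?thesis using that permutes_id[of V] by (auto simp: words_def)
  qed
  let ?W = "\<lambda>w. \<Prod>x\<leftarrow>w. letter_weight r x"
  have "(\<Sum>\<sigma> | \<sigma> permutes V. (swap_op V r ^^ K) (\<lambda>\<pi>. of_bool (\<pi> = \<sigma>)) id * \<phi> \<sigma>)
      = (\<Sum>\<sigma> | \<sigma> permutes V. \<Sum>w\<in>words V K. ?W w * of_bool (word_perm w id = \<sigma>) * \<phi> \<sigma>)"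
    by (simp add: sum_words[OF fin, symmetric] sum_distrib_right)
  also have "\<dots> = (\<Sum>w\<in>words V K. \<Sum>\<sigma> | \<sigma> permutes V. ?W w * of_bool (word_perm w id = \<sigma>) * \<phi> \<sigma>)"
    by (rule sum.swap)
  also have "\<dots> = (\<Sum>w\<in>words V K. ?W w * \<phi> (word_perm w id))"
  proof (intro sum.cong refl)
    fix w assume "w \<in> words V K"
    then have "word_perm w id \<in> {\<sigma>. \<sigma> permutes V}" using perm by simp
    moreover have "(\<Sum>\<sigma> | \<sigma> permutes V. ?W w * of_bool (word_perm w id = \<sigma>) * \<phi> \<sigma>)
        = (\<Sum>\<sigma> | \<sigma> permutes V. if word_perm w id = \<sigma> then ?W w * \<phi> \<sigma> else 0)"
      by (intro sum.cong) auto
    ultimately show "(\<Sum>\<sigma> | \<sigma> permutes V. ?W w * of_bool (word_perm w id = \<sigma>) * \<phi> \<sigma>)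
        = ?W w * \<phi> (word_perm w id)"
      using fin by (simp add: finite_permutations)
  qed
  finally show ?thesis by (simp add: sum_words[OF fin])
qed

lemma swap_op_const: "(swap_op V r ^^ K) (\<lambda>_. c) \<pi> = (1 + r * card (unordered_pairs V)) ^ K * c"
proof (induction K arbitrary: \<pi>)
  case (Suc K)
  have "(swap_op V r ^^ Suc K) (\<lambda>_. c) \<pi> = swap_op V r ((swap_op V r ^^ K) (\<lambda>_. c)) \<pi>" by simp
  also have "\<dots> = (1 + r * card (unordered_pairs V)) ^ Suc K * c"
    unfolding swap_op_def Suc by (simp add: algebra_simps)
  finally show ?case .
qed simp

text \<open>Matching counts leave in each cell at most one ringing pair, the one named by the
  letter, so the choice in \<open>grid_swap\<close> is forced.\<close>

lemma grid_perm_eq_word_perm: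
  assumes w: "w \<in> words V K" and k: "k \<le> K"
    and fin: "\<And>e i. e \<in> unordered_pairs V \<Longrightarrow> finite (C e \<inter> {real i * h<..real (Suc i) * h})"
    and match: "\<And>i e. i < K \<Longrightarrow> e \<in> unordered_pairs V \<Longrightarrow>
      card (C e \<inter> {real i * h<..real (Suc i) * h}) = of_bool (w ! i = Some e)"
  shows "grid_perm V C h k = word_perm (take k w) id"
  using k
proof (induction k)
  case 0
  then show ?case by (simp add: word_perm_def)
next
  case (Suc k)
  have letter: "w ! k \<in> insert None (Some ` unordered_pairs V)"
    using Suc.prems by (intro nth_words[OF w]) auto
  have "C e \<inter> {real k * h<..real (Suc k) * h} \<noteq> {} \<longleftrightarrow> w ! k = Some e"
    if "e \<in> unordered_pairs V" for e
  proof -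
    have "card (C e \<inter> {real k * h<..real (Suc k) * h}) = of_bool (w ! k = Some e)"
      using Suc.prems that by (intro match) auto
    then show ?thesis
      using card_0_eq[OF fin[OF that, of k]] by (cases "w ! k = Some e") auto
  qed
  then have "ringers V C (real k * h) (real (Suc k) * h) = {e \<in> unordered_pairs V. w ! k = Some e}"
    unfolding ringers_def by (intro Collect_cong conj_cong refl)
  also have "\<dots> = set_option (w ! k)"
    using letter by (cases "w ! k") auto
  finally have "ringers V C (real k * h) (real (Suc k) * h) = set_option (w ! k)" .
  then have "grid_swap (ringers V C (real k * h) (real (Suc k) * h)) = letter_perm (w ! k)"
    by (cases "w ! k") (auto simp: grid_swap_def letter_perm_def)
  moreover have "take (Suc k) w = take k w @ [w ! k]"
    using w Suc.prems by (intro take_Suc_conv_app_nth) (auto simp: words_def)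
  ultimately show ?case
    using Suc by (simp add: word_perm_def)
qed

lemma card_all_rings_le_1:
  assumes fin: "finite V" and x: "x \<in> insert None (Some ` unordered_pairs V)"
    and finC: "\<And>e. e \<in> unordered_pairs V \<Longrightarrow> finite (C e \<inter> I)"
    and match: "\<And>e. e \<in> unordered_pairs V \<Longrightarrow> card (C e \<inter> I) = of_bool (x = Some e)"
  shows "card (all_rings V C \<inter> I) \<le> 1"
proof (cases x)
  case None
  then have "C e \<inter> I = {}" if "e \<in> unordered_pairs V" for e
    using finC[OF that] match[OF that] by simp
  then have "all_rings V C \<inter> I = {}" by auto
  then show ?thesis by (simp only: card.empty)
next
  case (Some e)
  have "C e' \<inter> I = {}" if "e' \<in> unordered_pairs V" "e' \<noteq> e" for e'
    using finC[OF that(1)] match[OF that(1)] that Some by simp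
  then have "all_rings V C \<inter> I = C e \<inter> I" using x Some by auto
  then show ?thesis using match[of e] x Some by auto
qed

text \<open>At most one pair contributes \<open>r * exp (- r)\<close> and every other pair
  contributes \<open>exp (- r)\<close>. Positivity of \<open>r\<close> is conditional because
  \<open>h / card V\<close> is 0 for empty \<open>V\<close>.\<close>

lemma prod_letter_weight:
  assumes fin: "finite V" and r: "V \<noteq> {} \<Longrightarrow> 0 < r" and x: "x \<in> insert None (Some ` unordered_pairs V)"
  shows "(\<Prod>e\<in>unordered_pairs V. pmf (poisson_pmf r) (of_bool (x = Some e)))
    = exp (- r * card (unordered_pairs V)) * letter_weight r x"
proof -
  have "(\<Prod>e\<in>unordered_pairs V. pmf (poisson_pmf r) (of_bool (x = Some e)))
      = (\<Prod>e\<in>unordered_pairs V. exp (- r) * (if x = Some e then r else 1))"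
  proof (intro prod.cong refl)
    fix e assume "e \<in> unordered_pairs V"
    then have "0 < r" using r by (auto simp: unordered_pairs_def)
    then show "pmf (poisson_pmf r) (of_bool (x = Some e)) = exp (- r) * (if x = Some e then r else 1)"
      by (simp add: pmf_poisson)
  qed
  also have "\<dots> = exp (- r) ^ card (unordered_pairs V)
      * (\<Prod>e\<in>unordered_pairs V. if x = Some e then r else 1)"
    by (simp add: prod.distrib)
  also have "(\<Prod>e\<in>unordered_pairs V. if x = Some e then r else 1) = letter_weight r x"
    using x fin by (cases x) (auto simp: letter_weight_def)
  also have "exp (- r) ^ card (unordered_pairs V) = exp (- r * card (unordered_pairs V))"
    by (simp add: mult.commute flip: exp_of_nat_mult)
  finally show ?thesis .
qed

section \<open>Probabilities of word events\<close>

context complete_graph_exclusion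
begin

lemma prob_rings_in:
  assumes e: "e \<in> unordered_pairs V" and h: "0 < h" and K: "0 < K"
  shows "prob {\<omega> \<in> space M. \<forall>i<K. rings_in e (real i * h) (real (Suc i) * h) \<omega> = c i}
    = (\<Prod>i<K. pmf (poisson_pmf (h / card V)) (c i))"
proof -
  define N where "N = (\<lambda>(i :: nat) \<omega>. rings_in e (real i * h) (real (Suc i) * h) \<omega>)"
  have "incseq (\<lambda>i. real i * h)" using h by (auto simp: incseq_def intro: mult_right_mono)
  then have indep: "indep_vars (\<lambda>_. count_space UNIV) N UNIV"
    using clocks[OF e] unfolding poisson_clock_def N_def
    by (elim conjE allE[of _ "\<lambda>i. real i * h"]) auto
  have "{\<omega> \<in> space M. \<forall>i<K. N i \<omega> = c i} = (\<Inter>i\<in>{..<K}. N i -` {c i} \<inter> space M)"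
    using K by auto
  also have "prob \<dots> = (\<Prod>i<K. prob (N i -` {c i} \<inter> space M))"
    using K by (intro indep_varsD[OF indep]) auto
  also have "\<dots> = (\<Prod>i<K. pmf (poisson_pmf (h / card V)) (c i))"
  proof (intro prod.cong refl)
    fix i
    have ab: "0 \<le> real i * h" "real i * h < real (Suc i) * h" using h by auto
    then have "distr M (count_space UNIV) (N i)
        = measure_pmf (poisson_pmf (1 / real (card V) * (real (Suc i) * h - real i * h)))"
      using clocks[OF e] unfolding poisson_clock_def N_def by blast
    moreover have "real (Suc i) * h - real i * h = h" by (simp add: algebra_simps)
    ultimately have "measure (distr M (count_space UNIV) (N i)) {c i} = pmf (poisson_pmf (h / card V)) (c i)"
      by (simp add: measure_pmf_single)
    moreover have "N i \<in> M \<rightarrow>\<^sub>M count_space UNIV"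
      unfolding N_def using ab by (intro measurable_rings_in e) auto
    ultimately show "prob (N i -` {c i} \<inter> space M) = pmf (poisson_pmf (h / card V)) (c i)"
      by (simp add: measure_distr)
  qed
  finally show ?thesis by (simp add: N_def)
qed

text \<open>Three independences combine: increments of one clock, different clocks, and the clocks
  against the initial configuration.\<close>

lemma prob_match_word:
  assumes fin: "finite V" and h: "0 < h" and K: "0 < K" and w: "w \<in> words V K"
    and \<omega>0: "\<omega>0 \<in> cube V"
  defines "E \<equiv> {\<omega> \<in> space M. \<eta>0 \<omega> = \<omega>0 \<and> (\<forall>e\<in>unordered_pairs V. \<forall>i<K.
      rings_in e (real i * h) (real (Suc i) * h) \<omega> = of_bool (w ! i = Some e))}"
  shows "E \<in> events"
    and "prob E = exp (- (h * K / card V * card (unordered_pairs V)))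
      * (\<Prod>x\<leftarrow>w. letter_weight (h / card V) x) / 2 ^ card V"
proof -
  let ?P = "unordered_pairs V"
  \<comment> \<open>Clocks are independent as paths of \<open>ring_count\<close>, so the cell counts
    are rewritten as path increments between grid times; this makes the condition a cylinder
    event.\<close>
  define B where "B = (\<lambda>e. {p \<in> space path_space.
      \<forall>i<K. p (real (Suc i) * h) = p (real i * h) + (of_bool (w ! i = Some e) :: nat)})"
  define A where "A = (\<lambda>e. {\<omega> \<in> space M. \<forall>i<K.
      rings_in e (real i * h) (real (Suc i) * h) \<omega> = of_bool (w ! i = Some e)})"
  define Z where "Z = (\<lambda>\<omega>. \<lambda>e\<in>?P. ring_count (R e \<omega>)) -` (\<Pi>\<^sub>E e\<in>?P. B e) \<inter> space M"
  define H where "H = \<eta>0 -` {\<omega>0} \<inter> space M"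
  have B: "B e \<in> sets path_space" for e
  proof -
    have "real i * h \<in> {0..}" for i using h by simp
    then have [measurable]: "(\<lambda>p. p (real i * h)) \<in> path_space \<rightarrow>\<^sub>M count_space UNIV" for i
      by (rule measurable_component_singleton)
    show ?thesis unfolding B_def by measurable
  qed
  have ring: "(\<lambda>\<omega>. ring_count (R e \<omega>)) -` B e \<inter> space M = A e" if e: "e \<in> ?P" for e
  proof -
    have "ring_count (R e \<omega>) (real (Suc i) * h)
        = ring_count (R e \<omega>) (real i * h) + rings_in e (real i * h) (real (Suc i) * h) \<omega>"
      if "\<omega> \<in> space M" for \<omega> i
      using h finite_rings[OF e that] by (intro ring_count_diff) (auto intro: mult_right_mono)
    moreover have "ring_count (R e \<omega>) \<in> space path_space" for \<omega>
      by (simp add: ring_count_def space_PiM)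
    ultimately show ?thesis unfolding A_def B_def by auto
  qed
  have Z: "Z = {\<omega> \<in> space M. \<forall>e\<in>?P. \<omega> \<in> A e}"
  proof -
    have "Z = {\<omega> \<in> space M. \<forall>e\<in>?P. \<omega> \<in> (\<lambda>\<omega>. ring_count (R e \<omega>)) -` B e \<inter> space M}"
      unfolding Z_def by auto
    then show ?thesis using ring by simp
  qed
  have Zvim: "Z \<in> sets (vimage_algebra (space M) (\<lambda>\<omega>. \<lambda>e\<in>?P. ring_count (R e \<omega>)) (\<Pi>\<^sub>M e\<in>?P. path_space))"
    unfolding Z_def using fin B by (intro in_vimage_algebra sets_PiM_I_finite) auto
  have Hvim: "H \<in> sets (vimage_algebra (space M) \<eta>0 (count_space UNIV))"
    unfolding H_def by (intro in_vimage_algebra) auto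
  have EHZ: "E = H \<inter> Z" unfolding E_def Z H_def A_def by auto
  have "H \<in> events" "Z \<in> events"
    using indep_setD_ev1[OF initial_indep] indep_setD_ev2[OF initial_indep] Zvim Hvim by auto
  then show "E \<in> events" unfolding EHZ by auto
  have "prob Z = (\<Prod>e\<in>?P. prob (A e))"
  proof (cases "?P = {}")
    case True
    then show ?thesis by (simp add: Z prob_space)
  next
    case False
    then have "Z = (\<Inter>e\<in>?P. (\<lambda>\<omega>. ring_count (R e \<omega>)) -` B e \<inter> space M)"
      unfolding Z using ring by auto
    also have "prob \<dots> = (\<Prod>e\<in>?P. prob ((\<lambda>\<omega>. ring_count (R e \<omega>)) -` B e \<inter> space M))"
      using False fin B by (intro indep_varsD[OF indep_clocks]) auto
    finally show ?thesis by (simp add: ring)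
  qed
  also have "\<dots> = (\<Prod>e\<in>?P. \<Prod>i<K. pmf (poisson_pmf (h / card V)) (of_bool (w ! i = Some e)))"
    unfolding A_def by (intro prod.cong refl prob_rings_in h K)
  \<comment> \<open>Regrouping by cell instead of by pair turns each inner product into the weight
    of one letter.\<close>
  also have "\<dots> = (\<Prod>i<K. \<Prod>e\<in>?P. pmf (poisson_pmf (h / card V)) (of_bool (w ! i = Some e)))"
    by (rule prod.swap)
  also have "\<dots> = (\<Prod>i<K. exp (- (h / card V) * card ?P) * letter_weight (h / card V) (w ! i))"
    using h nth_words[OF w] fin
    by (intro prod.cong refl prod_letter_weight) (auto simp: card_gt_0_iff)
  also have "\<dots> = exp (- (h / card V) * card ?P) ^ K * (\<Prod>x\<leftarrow>w. letter_weight (h / card V) x)"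
    using w by (simp add: prod.distrib words_def prod.list_conv_set_nth lessThan_atLeast0)
  also have "exp (- (h / card V) * card ?P) ^ K = exp (- (h * K / card V * card ?P))"
    by (simp add: mult_ac flip: exp_of_nat_mult)
  finally have Zprob: "prob Z = exp (- (h * K / card V * card ?P)) * (\<Prod>x\<leftarrow>w. letter_weight (h / card V) x)" .
  have "prob H = measure (distr M (count_space UNIV) \<eta>0) {\<omega>0}"
    unfolding H_def using initial_measurable by (simp add: measure_distr)
  also have "\<dots> = 1 / 2 ^ card V"
    unfolding initial_uniform using fin \<omega>0 by (simp add: measure_pmf_single card_cube)
  finally have Hprob: "prob H = 1 / 2 ^ card V" .
  have "prob (H \<inter> Z) = prob H * prob Z"
    by (rule indep_setD[OF initial_indep Hvim Zvim])
  then show "prob E = exp (- (h * K / card V * card ?P))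
      * (\<Prod>x\<leftarrow>w. letter_weight (h / card V) x) / 2 ^ card V"
    by (simp add: EHZ Zprob Hprob)
qed

end

section \<open>Moments of the overlap\<close>

text \<open>The operator is not normalised: it multiplies constants by
  \<open>1 + r * card (unordered_pairs V)\<close>.\<close>

lemma swap_op_affine:
  "swap_op V r (\<lambda>\<pi>. c * \<phi> \<pi> + d) \<pi> = c * swap_op V r \<phi> \<pi> + d * (1 + r * card (unordered_pairs V))"
  by (simp add: swap_op_def sum.distrib sum_distrib_left algebra_simps)

lemma permutes_image_unordered_pairs:
  assumes g: "g permutes V"
  shows "bij_betw ((`) g) (unordered_pairs V) (unordered_pairs V)"
proof (rule bij_betw_byWitness[where f' = "(`) (inv g)"])
  have sub: "(`) h ` unordered_pairs V \<subseteq> unordered_pairs V" if h: "h permutes V" for h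
  proof (rule image_subsetI)
    fix e assume "e \<in> unordered_pairs V"
    then obtain x y where e: "e = {x, y}" "x \<in> V" "y \<in> V" "x \<noteq> y"
      by (auto simp: unordered_pairs_def)
    then have "h ` e = {h x, h y}" "h x \<in> V" "h y \<in> V" "h x \<noteq> h y"
      using h by (auto simp: permutes_in_image dest: injD[OF permutes_inj])
    then show "h ` e \<in> unordered_pairs V" unfolding unordered_pairs_def by blast
  qed
  show "(`) g ` unordered_pairs V \<subseteq> unordered_pairs V" "(`) (inv g) ` unordered_pairs V \<subseteq> unordered_pairs V"
    using sub[OF g] sub[OF permutes_inv[OF g]] .
qed (simp_all add: permutes_image_inv[OF g])

lemma conj_pair_swap:
  assumes g: "g permutes V" and e: "e \<in> unordered_pairs V"
  shows "g \<circ> pair_swap e = pair_swap (g ` e) \<circ> g"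
proof -
  obtain x y where e: "e = {x, y}" using e by (auto simp: unordered_pairs_def)
  then have "g ` e = {g x, g y}" by auto
  moreover have "g \<circ> Transposition.transpose x y = Transposition.transpose (g x) (g y) \<circ> g"
    using injD[OF permutes_inj[OF g]] by (auto simp: fun_eq_iff Transposition.transpose_def)
  ultimately show ?thesis by (simp add: e pair_swap_pair)
qed

lemma swap_op_power_conj:
  assumes g: "g permutes V"
  shows "(swap_op V r ^^ K) (\<lambda>\<pi>. \<phi> (g \<circ> \<pi> \<circ> inv g)) \<pi> = (swap_op V r ^^ K) \<phi> (g \<circ> \<pi> \<circ> inv g)"
proof (induction K arbitrary: \<pi>)
  case (Suc K)
  have "(swap_op V r ^^ Suc K) (\<lambda>\<pi>. \<phi> (g \<circ> \<pi> \<circ> inv g)) \<pi>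
      = swap_op V r (\<lambda>\<pi>. (swap_op V r ^^ K) \<phi> (g \<circ> \<pi> \<circ> inv g)) \<pi>"
    by (simp add: Suc.IH[abs_def])
  also have "\<dots> = (swap_op V r ^^ K) \<phi> (g \<circ> \<pi> \<circ> inv g)
      + r * (\<Sum>e\<in>unordered_pairs V. (swap_op V r ^^ K) \<phi> (pair_swap (g ` e) \<circ> (g \<circ> \<pi> \<circ> inv g)))"
    unfolding swap_op_def
    by (intro arg_cong2[where f = "(+)"] arg_cong2[where f = "(*)"] sum.cong refl arg_cong[where f = "(swap_op V r ^^ K) \<phi>" for K])
      (simp add: conj_pair_swap[OF g] flip: comp_assoc)
  also have "(\<Sum>e\<in>unordered_pairs V. (swap_op V r ^^ K) \<phi> (pair_swap (g ` e) \<circ> (g \<circ> \<pi> \<circ> inv g)))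
      = (\<Sum>e\<in>unordered_pairs V. (swap_op V r ^^ K) \<phi> (pair_swap e \<circ> (g \<circ> \<pi> \<circ> inv g)))"
    by (rule sum.reindex_bij_betw[OF permutes_image_unordered_pairs[OF g]])
  finally show ?case
    by (simp only: funpow.simps comp_apply[of "swap_op V r"] swap_op_def[of V r "(swap_op V r ^^ K) \<phi>"])
qed simp

lemma sum_unordered_pairs:
  fixes \<psi> :: "'a set \<Rightarrow> real"
  assumes fin: "finite V"
  shows "2 * (\<Sum>e\<in>unordered_pairs V. \<psi> e) = (\<Sum>x\<in>V. \<Sum>y\<in>V. if x = y then 0 else \<psi> {x, y})"
proof -
  let ?S = "{(x, y) \<in> V \<times> V. x \<noteq> y}"
  have S: "finite ?S" using fin by (auto intro: finite_subset[of _ "V \<times> V"])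
  have "(\<Sum>x\<in>V. \<Sum>y\<in>V. if x = y then 0 else \<psi> {x, y})
      = (\<Sum>p\<in>V \<times> V. if fst p = snd p then 0 else \<psi> {fst p, snd p})"
    by (simp add: sum.cartesian_product' cong: if_cong)
  also have "\<dots> = (\<Sum>p\<in>?S. \<psi> {fst p, snd p})"
    using fin by (intro sum.mono_neutral_cong_right) auto
  also have "\<dots> = (\<Sum>e\<in>unordered_pairs V. \<Sum>p | p \<in> ?S \<and> {fst p, snd p} = e. \<psi> {fst p, snd p})"
  proof (intro sum.group[symmetric] S finite_unordered_pairs fin)
    show "(\<lambda>p. {fst p, snd p}) ` ?S \<subseteq> unordered_pairs V"
    proof (rule image_subsetI)
      fix p assume "p \<in> ?S"
      then show "{fst p, snd p} \<in> unordered_pairs V"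
        unfolding unordered_pairs_def
        by (intro CollectI exI[of _ "fst p"] exI[of _ "snd p"]) auto
    qed
  qed
  also have "\<dots> = (\<Sum>e\<in>unordered_pairs V. 2 * \<psi> e)"
  proof (intro sum.cong refl)
    fix e assume "e \<in> unordered_pairs V"
    then obtain x y where e: "e = {x, y}" "x \<in> V" "y \<in> V" "x \<noteq> y"
      by (auto simp: unordered_pairs_def)
    then have "{p. p \<in> ?S \<and> {fst p, snd p} = e} = {(x, y), (y, x)}"
      by (auto simp: doubleton_eq_iff)
    then show "(\<Sum>p | p \<in> ?S \<and> {fst p, snd p} = e. \<psi> {fst p, snd p}) = 2 * \<psi> e"
      using e by (simp add: insert_commute)
  qed
  finally show ?thesis by (simp add: sum_distrib_left)
qed

lemma card_unordered_pairs:
  assumes "finite V"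
  shows "real (card (unordered_pairs V)) = real (card V) * (real (card V) - 1) / 2"
proof -
  have "2 * real (card (unordered_pairs V)) = (\<Sum>x\<in>V. \<Sum>y\<in>V. if x = y then 0 else 1)"
    using sum_unordered_pairs[OF assms, of "\<lambda>_. 1"] by simp
  also have "\<dots> = (\<Sum>x\<in>V. \<Sum>y\<in>V. 1 - of_bool (x = y))"
    by (intro sum.cong) auto
  also have "\<dots> = (\<Sum>x\<in>V. real (card V) - 1)"
    using assms by (intro sum.cong) (auto simp: sum_subtractf of_bool_def)
  finally show ?thesis by simp
qed

text \<open>Only \<open>x\<close> and \<open>y\<close> can change their membership in the image, and
  their contributions combine into a product.\<close>

lemma card_Int_transpose:
  assumes fin: "finite V" and sub: "A \<subseteq> V" "B \<subseteq> V" and xy: "x \<in> V" "y \<in> V"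
  shows "real (card (A \<inter> Transposition.transpose x y ` B)) = real (card (A \<inter> B))
    + (of_bool (x \<in> A) - of_bool (y \<in> A)) * (of_bool (y \<in> B) - of_bool (x \<in> B))"
proof (cases "x = y")
  case False
  let ?\<tau> = "Transposition.transpose x y"
  have mem: "z \<in> ?\<tau> ` B \<longleftrightarrow> ?\<tau> z \<in> B" for z
    by (metis (no_types, lifting) image_iff transpose_involutory)
  have card: "real (card (A \<inter> C)) = (\<Sum>z\<in>V - {x, y}. of_bool (z \<in> A \<and> z \<in> C))
      + of_bool (x \<in> A \<and> x \<in> C) + of_bool (y \<in> A \<and> y \<in> C)" for C
  proof -
    have "real (card (A \<inter> C)) = (\<Sum>z\<in>V. of_bool (z \<in> A \<and> z \<in> C))"
    proof -
      have "A \<inter> C = V \<inter> {z. z \<in> A \<and> z \<in> C}" using sub by auto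
      then show ?thesis using fin by (simp add: of_bool_def sum.If_cases)
    qed
    also have "\<dots> = (\<Sum>z\<in>V - {x, y}. of_bool (z \<in> A \<and> z \<in> C)) + (\<Sum>z\<in>{x, y}. of_bool (z \<in> A \<and> z \<in> C))"
      using fin xy by (intro sum.subset_diff) auto
    finally show ?thesis using False by simp
  qed
  have "(\<Sum>z\<in>V - {x, y}. of_bool (z \<in> A \<and> z \<in> ?\<tau> ` B)) = (\<Sum>z\<in>V - {x, y}. of_bool (z \<in> A \<and> z \<in> B) :: real)"
    by (intro sum.cong) (auto simp: mem)
  then show ?thesis
    using card[of "?\<tau> ` B"] card[of B] by (auto simp: mem)
qed simp

text \<open>Over ordered pairs the product of differences expands into 2 |A| |B| - 2 n |A \<inter>
  B|. For the squares, one swap changes the overlap by at most 1 and there are n (n - 1) / 2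
  pairs.\<close>

lemma sum_overlap_change:
  assumes fin: "finite V" and sub: "A \<subseteq> V" "B \<subseteq> V"
  shows "(\<Sum>e\<in>unordered_pairs V. real (card (A \<inter> pair_swap e ` B)) - card (A \<inter> B))
      = real (card A) * card B - card V * card (A \<inter> B)"
    and "(\<Sum>e\<in>unordered_pairs V. (real (card (A \<inter> pair_swap e ` B)) - card (A \<inter> B))\<^sup>2)
      \<le> (real (card V))\<^sup>2 / 2"
proof -
  let ?a = "\<lambda>x. of_bool (x \<in> A) :: real" and ?b = "\<lambda>x. of_bool (x \<in> B) :: real"
  have ind: "(\<Sum>x\<in>V. of_bool (x \<in> C)) = real (card C)" if "C \<subseteq> V" for C
  proof -
    have "V \<inter> {x. x \<in> C} = C" using that by auto
    then show ?thesis using fin by (simp add: of_bool_def sum.If_cases)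
  qed
  have "2 * (\<Sum>e\<in>unordered_pairs V. real (card (A \<inter> pair_swap e ` B)) - card (A \<inter> B))
      = (\<Sum>x\<in>V. \<Sum>y\<in>V. (?a x - ?a y) * (?b y - ?b x))"
    unfolding sum_unordered_pairs[OF fin]
  proof (intro sum.cong refl)
    fix x y assume "x \<in> V" "y \<in> V"
    from card_Int_transpose[OF fin sub this]
    have "real (card (A \<inter> Transposition.transpose x y ` B)) - card (A \<inter> B) = (?a x - ?a y) * (?b y - ?b x)"
      by linarith
    then show "(if x = y then 0 else real (card (A \<inter> pair_swap {x, y} ` B)) - card (A \<inter> B))
        = (?a x - ?a y) * (?b y - ?b x)"
      by (cases "x = y") (simp, simp only: pair_swap_pair if_False)
  qed
  also have "\<dots> = (\<Sum>x\<in>V. \<Sum>y\<in>V. ?a x * ?b y + ?b x * ?a y - ?a x * ?b x - ?a y * ?b y)"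
    by (intro sum.cong refl) (simp add: algebra_simps)
  also have "\<dots> = 2 * (\<Sum>x\<in>V. ?a x) * (\<Sum>y\<in>V. ?b y) - 2 * card V * (\<Sum>x\<in>V. ?a x * ?b x)"
  proof -
    have 1: "(\<Sum>x\<in>V. \<Sum>y\<in>V. ?a x * ?b y) = (\<Sum>x\<in>V. ?a x) * (\<Sum>y\<in>V. ?b y)"
      "(\<Sum>x\<in>V. \<Sum>y\<in>V. ?b x * ?a y) = (\<Sum>x\<in>V. ?b x) * (\<Sum>y\<in>V. ?a y)"
      by (simp_all only: sum_product)
    have 2: "(\<Sum>x\<in>V. \<Sum>y\<in>V. ?a x * ?b x) = card V * (\<Sum>x\<in>V. ?a x * ?b x)"
      "(\<Sum>x\<in>V. \<Sum>y\<in>V. ?a y * ?b y) = card V * (\<Sum>x\<in>V. ?a x * ?b x)"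
      by (simp_all only: sum_constant sum_distrib_left)
    show ?thesis
      unfolding sum_subtractf sum.distrib 1 2 by (simp add: algebra_simps)
  qed
  also have "(\<Sum>x\<in>V. ?a x * ?b x) = card (A \<inter> B)"
    using ind[of "A \<inter> B"] sub by (simp add: of_bool_conj[symmetric] le_infI1)
  finally show "(\<Sum>e\<in>unordered_pairs V. real (card (A \<inter> pair_swap e ` B)) - card (A \<inter> B))
      = real (card A) * card B - card V * card (A \<inter> B)"
    using ind sub by simp
  have "(\<Sum>e\<in>unordered_pairs V. (real (card (A \<inter> pair_swap e ` B)) - card (A \<inter> B))\<^sup>2)
      \<le> (\<Sum>e\<in>unordered_pairs V. 1)"
  proof (rule sum_mono)
    fix e assume "e \<in> unordered_pairs V"
    then obtain x y where "e = {x, y}" "x \<in> V" "y \<in> V" by (auto simp: unordered_pairs_def)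
    then show "(real (card (A \<inter> pair_swap e ` B)) - card (A \<inter> B))\<^sup>2 \<le> 1"
      by (simp add: pair_swap_pair card_Int_transpose[OF fin sub])
  qed
  also have "\<dots> \<le> (real (card V))\<^sup>2 / 2"
    using card_unordered_pairs[OF fin] by (simp add: power2_eq_square algebra_simps)
  finally show "(\<Sum>e\<in>unordered_pairs V. (real (card (A \<inter> pair_swap e ` B)) - card (A \<inter> B))\<^sup>2)
      \<le> (real (card V))\<^sup>2 / 2" .
qed

text \<open>Centred at the mean overlap under a uniform permutation, so that the drift is
  proportional to the deviation itself.\<close>

definition overlap_dev :: "'a set \<Rightarrow> 'a set \<Rightarrow> ('a \<Rightarrow> 'a) \<Rightarrow> real" where
  "overlap_dev V A \<pi> = card (A \<inter> \<pi> ` A) - (real (card A))\<^sup>2 / card V"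

text \<open>The total change over all pairs is \<open>- card V\<close> times the deviation, so the
  deviation is an eigenfunction. In the square, the cross term doubles this rate and the squared
  jumps add at most n^2 / 2.\<close>

lemma swap_op_overlap_dev:
  assumes fin: "finite V" and V: "V \<noteq> {}" and A: "A \<subseteq> V" and \<pi>: "\<pi> permutes V" and r: "0 \<le> r"
  defines "P \<equiv> real (card (unordered_pairs V))"
  shows "swap_op V r (overlap_dev V A) \<pi> = (1 + r * (P - real (card V))) * overlap_dev V A \<pi>"
    and "swap_op V r (\<lambda>\<pi>. (overlap_dev V A \<pi>)\<^sup>2) \<pi>
      \<le> (1 + r * (P - 2 * real (card V))) * (overlap_dev V A \<pi>)\<^sup>2 + r * (real (card V))\<^sup>2 / 2"
proof -
  define Y where "Y = overlap_dev V A \<pi>"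
  define \<Delta> where "\<Delta> = (\<lambda>e. real (card (A \<inter> pair_swap e ` \<pi> ` A)) - card (A \<inter> \<pi> ` A))"
  have B: "\<pi> ` A \<subseteq> V" by (rule permutes_image_subset[OF \<pi> A])
  have cardB: "card (\<pi> ` A) = card A" by (rule card_permutes_image[OF \<pi>])
  have Y': "overlap_dev V A (pair_swap e \<circ> \<pi>) = Y + \<Delta> e" for e
    by (simp add: overlap_dev_def Y_def \<Delta>_def image_comp)
  have "0 < card V" using fin V by (simp add: card_gt_0_iff)
  then have drift: "(\<Sum>e\<in>unordered_pairs V. \<Delta> e) = - (card V * Y)"
    using sum_overlap_change(1)[OF fin A B]
    by (simp add: \<Delta>_def Y_def overlap_dev_def cardB power2_eq_square right_diff_distrib)
  have "swap_op V r (overlap_dev V A) \<pi> = Y + r * (P * Y + (\<Sum>e\<in>unordered_pairs V. \<Delta> e))"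
    by (simp add: swap_op_def Y' sum.distrib P_def flip: Y_def)
  then show "swap_op V r (overlap_dev V A) \<pi> = (1 + r * (P - real (card V))) * overlap_dev V A \<pi>"
    unfolding drift by (simp add: Y_def algebra_simps)
  have "swap_op V r (\<lambda>\<pi>. (overlap_dev V A \<pi>)\<^sup>2) \<pi>
      = Y\<^sup>2 + r * (P * Y\<^sup>2 + 2 * Y * (\<Sum>e\<in>unordered_pairs V. \<Delta> e) + (\<Sum>e\<in>unordered_pairs V. (\<Delta> e)\<^sup>2))"
    by (simp add: swap_op_def Y' power2_sum sum.distrib P_def sum_distrib_left mult_ac flip: Y_def)
  also have "\<dots> \<le> Y\<^sup>2 + r * (P * Y\<^sup>2 + 2 * Y * (\<Sum>e\<in>unordered_pairs V. \<Delta> e) + (real (card V))\<^sup>2 / 2)"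
    using sum_overlap_change(2)[OF fin A B] r by (intro add_left_mono mult_left_mono) (auto simp: \<Delta>_def)
  also have "\<dots> = (1 + r * (P - 2 * real (card V))) * Y\<^sup>2 + r * (real (card V))\<^sup>2 / 2"
    unfolding drift by (simp add: power2_eq_square algebra_simps)
  finally show "swap_op V r (\<lambda>\<pi>. (overlap_dev V A \<pi>)\<^sup>2) \<pi>
      \<le> (1 + r * (P - 2 * real (card V))) * (overlap_dev V A \<pi>)\<^sup>2 + r * (real (card V))\<^sup>2 / 2"
    by (simp add: Y_def)
qed

lemma swap_op_power_overlap_dev:
  assumes fin: "finite V" and V: "V \<noteq> {}" and A: "A \<subseteq> V" and \<pi>: "\<pi> permutes V" and r: "0 \<le> r"
  shows "(swap_op V r ^^ K) (overlap_dev V A) \<pi>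
    = (1 + r * (real (card (unordered_pairs V)) - real (card V))) ^ K * overlap_dev V A \<pi>"
  using \<pi>
proof (induction K arbitrary: \<pi>)
  case (Suc K)
  let ?c = "1 + r * (real (card (unordered_pairs V)) - real (card V))"
  have IH: "(swap_op V r ^^ K) (overlap_dev V A) (pair_swap e \<circ> \<pi>) = ?c ^ K * overlap_dev V A (pair_swap e \<circ> \<pi>)"
    if "e \<in> unordered_pairs V" for e
    using that by (intro Suc.IH permutes_compose pair_swap_permutes Suc.prems)
  have "(swap_op V r ^^ Suc K) (overlap_dev V A) \<pi> = swap_op V r ((swap_op V r ^^ K) (overlap_dev V A)) \<pi>"
    by simp
  also have "\<dots> = swap_op V r (\<lambda>\<pi>. ?c ^ K * overlap_dev V A \<pi>) \<pi>"
    unfolding swap_op_def[of V r "(swap_op V r ^^ K) (overlap_dev V A)" \<pi>]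
      swap_op_def[of V r "\<lambda>\<pi>. ?c ^ K * overlap_dev V A \<pi>" \<pi>]
    by (simp only: Suc.IH[OF Suc.prems] IH cong: sum.cong)
  also have "\<dots> = ?c ^ K * swap_op V r (overlap_dev V A) \<pi>"
    using swap_op_affine[of V r _ _ 0] by simp
  finally show ?case
    by (simp add: swap_op_overlap_dev(1)[OF fin V A Suc.prems r] mult_ac)
qed simp

text \<open>The recursion has n / 4 as its stationary level. Nonnegativity of \<open>c\<close>
  allows the one-step bound to be multiplied by \<open>c ^ K\<close>.\<close>

lemma swap_op_power_overlap_dev_sq:
  assumes fin: "finite V" and V: "V \<noteq> {}" and A: "A \<subseteq> V" and \<pi>: "\<pi> permutes V" and r: "0 \<le> r"
  defines "P \<equiv> real (card (unordered_pairs V))"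
  defines "c \<equiv> 1 + r * (P - 2 * real (card V))"
  assumes c: "0 \<le> c"
  shows "(swap_op V r ^^ K) (\<lambda>\<pi>. (overlap_dev V A \<pi>)\<^sup>2) \<pi>
    \<le> c ^ K * (overlap_dev V A \<pi>)\<^sup>2 + card V / 4 * ((1 + r * P) ^ K - c ^ K)"
  using \<pi>
proof (induction K arbitrary: \<pi>)
  case (Suc K)
  define d where "d = card V / 4 * ((1 + r * P) ^ K - c ^ K)"
  define Y2 where "Y2 = (\<lambda>\<pi>. (overlap_dev V A \<pi>)\<^sup>2)"
  have IH: "(swap_op V r ^^ K) Y2 \<pi> \<le> c ^ K * Y2 \<pi> + d" if "\<pi> permutes V" for \<pi>
    using Suc.IH[OF that] by (simp add: Y2_def d_def)
  have "(swap_op V r ^^ Suc K) Y2 \<pi> = swap_op V r ((swap_op V r ^^ K) Y2) \<pi>" by simp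
  also have "\<dots> \<le> swap_op V r (\<lambda>\<pi>. c ^ K * Y2 \<pi> + d) \<pi>"
    unfolding swap_op_def[of V r "(swap_op V r ^^ K) Y2" \<pi>] swap_op_def[of V r "\<lambda>\<pi>. c ^ K * Y2 \<pi> + d" \<pi>]
    using Suc.prems r
    by (intro add_mono mult_left_mono sum_mono IH permutes_compose pair_swap_permutes)
  also have "\<dots> = c ^ K * swap_op V r Y2 \<pi> + d * (1 + r * P)"
    unfolding P_def by (rule swap_op_affine)
  also have "\<dots> \<le> c ^ K * (c * Y2 \<pi> + r * (real (card V))\<^sup>2 / 2) + d * (1 + r * P)"
    using swap_op_overlap_dev(2)[OF fin V A Suc.prems r] c
    by (intro add_right_mono mult_left_mono) (auto simp: Y2_def c_def P_def)
  \<comment> \<open>As \<open>(1 + r * P) - c\<close> equals 2 r n, the added term is exactly n / 4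
    times the loss of mass, and the differences of powers telescope.\<close>
  also have "r * (real (card V))\<^sup>2 / 2 = card V / 4 * ((1 + r * P) - c)"
    by (simp add: c_def power2_eq_square algebra_simps)
  also have "c ^ K * (c * Y2 \<pi> + card V / 4 * ((1 + r * P) - c)) + d * (1 + r * P)
      = c ^ Suc K * Y2 \<pi> + card V / 4 * ((1 + r * P) ^ Suc K - c ^ Suc K)"
    by (simp add: d_def algebra_simps add_divide_distrib diff_divide_distrib)
  finally show ?case unfolding Y2_def .
qed simp

section \<open>The law of the interchange permutation\<close>

lemma tendsto_exp_compound:
  fixes x s :: real
  shows "(\<lambda>K. exp (- s) * (1 + x / real K) ^ K) \<longlonglongrightarrow> exp (x - s)"
  using tendsto_mult[OF tendsto_const tendsto_exp_limit_sequentially[of x], of "exp (- s)"]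
  by (simp add: exp_diff exp_minus field_simps)

context complete_graph_exclusion
begin

text \<open>Taken jointly with the initial configuration, so that independence of the permutation
  from \<open>\<eta>0\<close> comes out of the limit of the word probabilities.\<close>

definition joint_law :: "real \<Rightarrow> ('a \<Rightarrow> bool) \<Rightarrow> ('a \<Rightarrow> 'a) \<Rightarrow> real" where
  "joint_law t \<omega>0 \<sigma> = prob {\<omega> \<in> space M. \<eta>0 \<omega> = \<omega>0 \<and> interchange_perm V (\<lambda>e. R e \<omega>) t = \<sigma>}"

lemma joint_event:
  assumes "finite V" "0 < t"
  shows "{\<omega> \<in> space M. \<eta>0 \<omega> = \<omega>0 \<and> interchange_perm V (\<lambda>e. R e \<omega>) t = \<sigma>} \<in> events"
proof -
  have "{\<omega> \<in> space M. \<eta>0 \<omega> = \<omega>0 \<and> interchange_perm V (\<lambda>e. R e \<omega>) t = \<sigma>}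
      = (\<eta>0 -` {\<omega>0} \<inter> space M) \<inter> ((\<lambda>\<omega>. interchange_perm V (\<lambda>e. R e \<omega>) t) -` {\<sigma>} \<inter> space M)"
    by auto
  also have "\<dots> \<in> events"
    by (intro sets.Int measurable_sets[OF initial_measurable]
        measurable_sets[OF measurable_interchange_perm[OF assms]]) auto
  finally show ?thesis .
qed

lemma sum_joint_law_le_1:
  assumes "finite V" "0 < t" "finite S"
  shows "(\<Sum>(\<omega>0, \<sigma>)\<in>S. joint_law t \<omega>0 \<sigma>) \<le> 1"
proof -
  let ?E = "\<lambda>p. {\<omega> \<in> space M. \<eta>0 \<omega> = fst p \<and> interchange_perm V (\<lambda>e. R e \<omega>) t = snd p}"
  have "(\<Sum>(\<omega>0, \<sigma>)\<in>S. joint_law t \<omega>0 \<sigma>) = (\<Sum>p\<in>S. prob (?E p))"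
    by (simp add: joint_law_def case_prod_unfold)
  also have "\<dots> = prob (\<Union>p\<in>S. ?E p)"
    using assms joint_event
    by (intro finite_measure_finite_Union[symmetric]) (auto simp: disjoint_family_on_def)
  finally show ?thesis by simp
qed

text \<open>Different words require different counts in some cell, so their events are disjoint, and
  on each the permutation is that of the word. Only paths with several rings in one cell are
  lost.\<close>

lemma word_sum_le_joint_law:
  assumes fin: "finite V" and t: "0 < t" and K: "0 < K" and \<omega>0: "\<omega>0 \<in> cube V"
  shows "exp (- (t / card V * card (unordered_pairs V)))
      * (swap_op V (t / card V / K) ^^ K) (\<lambda>\<pi>. of_bool (\<pi> = \<sigma>)) id / 2 ^ card V
    \<le> joint_law t \<omega>0 \<sigma>"
proof -
  let ?P = "unordered_pairs V"
  define h where "h = t / K"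
  have h: "0 < h" and hK: "h * K = t" "real K * h = t" using t K by (auto simp: h_def)
  define E where "E = (\<lambda>w. {\<omega> \<in> space M. \<eta>0 \<omega> = \<omega>0 \<and> (\<forall>e\<in>?P. \<forall>i<K.
      rings_in e (real i * h) (real (Suc i) * h) \<omega> = of_bool (w ! i = Some e))})"
  define W where "W = {w \<in> words V K. word_perm w id = \<sigma>}"
  have W: "finite W" using fin by (simp add: W_def)
  have E: "E w \<in> events"
    "prob (E w) = exp (- (t / card V * card ?P)) * (\<Prod>x\<leftarrow>w. letter_weight (h / card V) x) / 2 ^ card V"
    if "w \<in> W" for w
    using prob_match_word[OF fin h K _ \<omega>0, of w] that by (simp_all add: E_def W_def hK)
  have disj: "disjoint_family_on E W"
    unfolding disjoint_family_on_def
  proof (intro ballI impI)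
    fix w w' assume ww: "w \<in> W" "w' \<in> W" "w \<noteq> w'"
    then have len: "length w = K" "length w' = K" by (auto simp: W_def words_def)
    then obtain i where i: "i < K" "w ! i \<noteq> w' ! i" using ww(3) nth_equalityI by metis
    moreover have "w ! i \<in> insert None (Some ` ?P)" "w' ! i \<in> insert None (Some ` ?P)"
      using ww i nth_words[of w V K i] nth_words[of w' V K i] by (simp_all add: W_def)
    ultimately obtain e where e: "e \<in> ?P" "(w ! i = Some e) \<noteq> (w' ! i = Some e)" by auto
    show "E w \<inter> E w' = {}"
    proof (rule ccontr)
      assume "E w \<inter> E w' \<noteq> {}"
      then obtain \<omega> where \<omega>: "\<omega> \<in> E w" "\<omega> \<in> E w'" by auto
      have "rings_in e (real i * h) (real (Suc i) * h) \<omega> = of_bool (v ! i = Some e)" if "\<omega> \<in> E v" for v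
        using that e(1) i(1) unfolding E_def by blast
      from this[OF \<omega>(1)] this[OF \<omega>(2)] show False
        using e(2) by (auto simp: of_bool_def split: if_splits)
    qed
  qed
  have "exp (- (t / card V * card ?P)) * (swap_op V (t / card V / K) ^^ K) (\<lambda>\<pi>. of_bool (\<pi> = \<sigma>)) id / 2 ^ card V
      = (\<Sum>w\<in>words V K. exp (- (t / card V * card ?P)) * (\<Prod>x\<leftarrow>w. letter_weight (h / card V) x) / 2 ^ card V
          * of_bool (word_perm w id = \<sigma>))"
    by (simp add: sum_words[OF fin, symmetric] h_def sum_distrib_left sum_divide_distrib mult_ac)
  also have "\<dots> = (\<Sum>w\<in>W. prob (E w))"
    using fin E(2) by (intro sum.mono_neutral_cong_right) (auto simp: W_def)
  also have "\<dots> = prob (\<Union>w\<in>W. E w)"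
    using E(1) W disj by (intro finite_measure_finite_Union[symmetric]) auto
  also have "\<dots> \<le> joint_law t \<omega>0 \<sigma>"
    unfolding joint_law_def
  proof (intro finite_measure_mono joint_event fin t)
    show "(\<Union>w\<in>W. E w) \<subseteq> {\<omega> \<in> space M. \<eta>0 \<omega> = \<omega>0 \<and> interchange_perm V (\<lambda>e. R e \<omega>) t = \<sigma>}"
    proof (rule UN_least, rule subsetI)
      fix w \<omega> assume w: "w \<in> W" and \<omega>: "\<omega> \<in> E w"
      have wW: "w \<in> words V K" using w by (simp add: W_def)
      have \<omega>M: "\<omega> \<in> space M" "\<eta>0 \<omega> = \<omega>0"
        and match: "\<And>i e. i < K \<Longrightarrow> e \<in> ?P \<Longrightarrow>
          card (R e \<omega> \<inter> {real i * h<..real (Suc i) * h}) = of_bool (w ! i = Some e)"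
        using \<omega> by (auto simp: E_def)
      note finR = finite_rings_in[OF _ \<omega>M(1)]
      have "interchange_perm V (\<lambda>e. R e \<omega>) (real K * h) = grid_perm V (\<lambda>e. R e \<omega>) h K"
      proof (rule interchange_perm_eq_grid_perm)
        show "finite (all_rings V (\<lambda>e. R e \<omega>) \<inter> {0<..b})" for b
          by (rule finite_all_rings[OF fin \<omega>M(1)])
        show "card (all_rings V (\<lambda>e. R e \<omega>) \<inter> {real i * h<..real (Suc i) * h}) \<le> 1" if "i < K" for i
          by (rule card_all_rings_le_1[OF fin nth_words[OF wW that] finR match[OF that]])
      qed (use h in simp)
      also have "\<dots> = word_perm (take K w) id"
        by (rule grid_perm_eq_word_perm[OF wW order.refl finR match])
      also have "\<dots> = \<sigma>" using w by (simp add: W_def words_def)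
      finally show "\<omega> \<in> {\<omega> \<in> space M. \<eta>0 \<omega> = \<omega>0 \<and> interchange_perm V (\<lambda>e. R e \<omega>) t = \<sigma>}"
        using \<omega>M by (simp add: hK)
    qed
  qed
  finally show ?thesis .
qed

text \<open>The word events are disjoint and their total mass tends to \<open>1\<close>, so the lower bounds of
  \<open>word_sum_le_joint_law\<close> become equalities in the limit.\<close>

lemma joint_law_limit:
  assumes fin: "finite V" and t: "0 < t" and \<omega>0: "\<omega>0 \<in> cube V" and \<sigma>: "\<sigma> permutes V"
  shows "(\<lambda>K. exp (- (t / card V * card (unordered_pairs V)))
      * (swap_op V (t / card V / real K) ^^ K) (\<lambda>\<pi>. of_bool (\<pi> = \<sigma>)) id)
    \<longlonglongrightarrow> 2 ^ card V * joint_law t \<omega>0 \<sigma>"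
proof -
  define s where "s = t / card V * card (unordered_pairs V)"
  define a where "a = (\<lambda>K \<sigma>. exp (- s) * (swap_op V (t / card V / real K) ^^ K) (\<lambda>\<pi>. of_bool (\<pi> = \<sigma>)) id)"
  define S where "S = cube V \<times> {\<sigma>. \<sigma> permutes V}"
  have S: "finite S" "(\<omega>0, \<sigma>) \<in> S" using fin \<omega>0 \<sigma> by (auto simp: S_def finite_permutations)
  have nonneg: "0 \<le> joint_law t \<omega> \<pi> - a K \<pi> / 2 ^ card V" if "0 < K" "\<omega> \<in> cube V" for K \<omega> \<pi>
    using word_sum_le_joint_law[OF fin t that] by (simp add: a_def s_def)
  \<comment> \<open>All deficits are nonnegative, so one of them is at most their sum, and this is
    at most 1 minus the total mass of the words.\<close>
  have upper: "joint_law t \<omega>0 \<sigma> - a K \<sigma> / 2 ^ card V \<le> 1 - exp (- s) * (1 + s / K) ^ K"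
    if K: "0 < K" for K
  proof -
    have "joint_law t \<omega>0 \<sigma> - a K \<sigma> / 2 ^ card V \<le> (\<Sum>(\<omega>, \<pi>)\<in>S. joint_law t \<omega> \<pi> - a K \<pi> / 2 ^ card V)"
      using member_le_sum[OF S(2) _ S(1), of "\<lambda>(\<omega>, \<pi>). joint_law t \<omega> \<pi> - a K \<pi> / 2 ^ card V"] nonneg[OF K]
      by (auto simp: S_def)
    also have "\<dots> = (\<Sum>(\<omega>, \<pi>)\<in>S. joint_law t \<omega> \<pi>) - (\<Sum>(\<omega>, \<pi>)\<in>S. a K \<pi> / 2 ^ card V)"
      by (simp add: case_prod_unfold sum_subtractf)
    also have "(\<Sum>(\<omega>, \<pi>)\<in>S. a K \<pi> / 2 ^ card V) = (\<Sum>\<pi> | \<pi> permutes V. a K \<pi>)"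
      using fin by (simp add: S_def sum.cartesian_product' card_cube flip: sum_divide_distrib)
    also have "\<dots> = exp (- s) * (1 + s / K) ^ K"
    proof -
      have "(\<Sum>\<pi> | \<pi> permutes V. a K \<pi>) = exp (- s) * (swap_op V (t / card V / real K) ^^ K) (\<lambda>_. 1) id"
        unfolding swap_op_power_eq_sum[OF fin, of _ _ "\<lambda>_. 1"] by (simp add: a_def sum_distrib_left)
      then show ?thesis by (simp add: swap_op_const s_def)
    qed
    finally show ?thesis using sum_joint_law_le_1[OF fin t S(1)] by linarith
  qed
  have "(\<lambda>K. joint_law t \<omega>0 \<sigma> - a K \<sigma> / 2 ^ card V) \<longlonglongrightarrow> 0"
  proof (rule tendsto_sandwich)
    show "\<forall>\<^sub>F K in sequentially. 0 \<le> joint_law t \<omega>0 \<sigma> - a K \<sigma> / 2 ^ card V"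
      using eventually_gt_at_top[of 0] by eventually_elim (use nonneg \<omega>0 in auto)
    show "\<forall>\<^sub>F K in sequentially. joint_law t \<omega>0 \<sigma> - a K \<sigma> / 2 ^ card V \<le> 1 - exp (- s) * (1 + s / K) ^ K"
      using eventually_gt_at_top[of 0] by eventually_elim (use upper in auto)
    show "(\<lambda>K. 1 - exp (- s) * (1 + s / real K) ^ K) \<longlonglongrightarrow> 0"
      using tendsto_diff[OF tendsto_const tendsto_exp_compound[of s s], of 1] by simp
  qed simp
  from tendsto_mult[OF tendsto_const tendsto_diff[OF tendsto_const this, of "joint_law t \<omega>0 \<sigma>"], of "2 ^ card V"]
  show ?thesis by (simp add: a_def s_def)
qed

text \<open>The limit of the word sums does not involve \<open>\<omega>0\<close>, so one reference
  configuration serves for all; the factor undoes its probability.\<close>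

definition perm_law :: "real \<Rightarrow> ('a \<Rightarrow> 'a) \<Rightarrow> real" where
  "perm_law t \<sigma> = 2 ^ card V * joint_law t (config V {}) \<sigma>"

text \<open>Both sides, scaled, are limits of the same word sums: the permutation is independent of
  the uniform start.\<close>

lemma joint_law_eq:
  assumes "finite V" "0 < t" "\<omega>0 \<in> cube V" "\<sigma> permutes V"
  shows "joint_law t \<omega>0 \<sigma> = perm_law t \<sigma> / 2 ^ card V"
  using LIMSEQ_unique[OF joint_law_limit[OF assms] joint_law_limit[OF assms(1,2) config_in_cube[of V "{}"] assms(4)]]
  by (simp add: perm_law_def)

lemma perm_law_nonneg: "0 \<le> perm_law t \<sigma>"
  by (simp add: perm_law_def joint_law_def)

lemma perm_law_limit:
  assumes fin: "finite V" and t: "0 < t"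
  shows "(\<lambda>K. exp (- (t / card V * card (unordered_pairs V))) * (swap_op V (t / card V / real K) ^^ K) \<phi> id)
    \<longlonglongrightarrow> (\<Sum>\<sigma> | \<sigma> permutes V. perm_law t \<sigma> * \<phi> \<sigma>)"
proof -
  have "(\<lambda>K. \<Sum>\<sigma> | \<sigma> permutes V. exp (- (t / card V * card (unordered_pairs V)))
      * (swap_op V (t / card V / real K) ^^ K) (\<lambda>\<pi>. of_bool (\<pi> = \<sigma>)) id * \<phi> \<sigma>)
    \<longlonglongrightarrow> (\<Sum>\<sigma> | \<sigma> permutes V. perm_law t \<sigma> * \<phi> \<sigma>)"
    unfolding perm_law_def using fin t
    by (intro tendsto_sum tendsto_mult_right joint_law_limit config_in_cube) auto
  then show ?thesis
    by (subst swap_op_power_eq_sum[OF fin]) (simp add: sum_distrib_left mult.assoc)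
qed

lemma sum_perm_law:
  assumes fin: "finite V" and t: "0 < t"
  shows "(\<Sum>\<sigma> | \<sigma> permutes V. perm_law t \<sigma>) = 1"
proof -
  have "(\<lambda>K. exp (- (t / card V * card (unordered_pairs V)))
      * (1 + (t / card V * card (unordered_pairs V)) / real K) ^ K)
    \<longlonglongrightarrow> (\<Sum>\<sigma> | \<sigma> permutes V. perm_law t \<sigma>)"
    using perm_law_limit[OF fin t, of "\<lambda>_. 1"] by (simp add: swap_op_const)
  from LIMSEQ_unique[OF this tendsto_exp_compound] show ?thesis by simp
qed

text \<open>Conjugation fixes the identity, where the words start, and commutes with the operator;
  the invariance passes to the limit.\<close>

lemma perm_law_conj:
  assumes fin: "finite V" and t: "0 < t" and g: "g permutes V" and \<sigma>: "\<sigma> permutes V"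
  shows "perm_law t (g \<circ> \<sigma> \<circ> inv g) = perm_law t \<sigma>"
proof -
  have conj: "g \<circ> \<sigma> \<circ> inv g permutes V"
    using g \<sigma> by (intro permutes_compose permutes_inv)
  have eq: "(g \<circ> \<pi> \<circ> inv g = g \<circ> \<sigma> \<circ> inv g) = (\<pi> = \<sigma>)" for \<pi>
  proof
    assume "g \<circ> \<pi> \<circ> inv g = g \<circ> \<sigma> \<circ> inv g"
    then have "inv g \<circ> (g \<circ> \<pi> \<circ> inv g) \<circ> g = inv g \<circ> (g \<circ> \<sigma> \<circ> inv g) \<circ> g" by simp
    then show "\<pi> = \<sigma>"
      using permutes_inverses[OF g] by (auto simp: fun_eq_iff)
  qed simp
  have op: "(swap_op V r ^^ K) (\<lambda>\<pi>. of_bool (\<pi> = g \<circ> \<sigma> \<circ> inv g)) id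
      = (swap_op V r ^^ K) (\<lambda>\<pi>. of_bool (\<pi> = \<sigma>)) id" for r K
    using swap_op_power_conj[OF g, where r = r and K = K and \<pi> = id
        and \<phi> = "\<lambda>\<pi>. of_bool (\<pi> = g \<circ> \<sigma> \<circ> inv g)"] permutes_inv_o(1)[OF g]
    by (simp add: eq)
  note lim = joint_law_limit[OF fin t config_in_cube[of V "{}"], folded perm_law_def]
  show ?thesis
    by (rule LIMSEQ_unique[OF lim[OF conj, unfolded op] lim[OF \<sigma>]])
qed

lemma perm_law_overlap:
  assumes fin: "finite V" and V: "V \<noteq> {}" and t: "0 < t" and A: "A \<subseteq> V"
  shows perm_law_overlap_mean:
    "(\<Sum>\<sigma> | \<sigma> permutes V. perm_law t \<sigma> * overlap_dev V A \<sigma>) = exp (- t) * overlap_dev V A id"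
    and perm_law_overlap_sq: "(\<Sum>\<sigma> | \<sigma> permutes V. perm_law t \<sigma> * (overlap_dev V A \<sigma>)\<^sup>2)
      \<le> exp (- 2 * t) * (overlap_dev V A id)\<^sup>2 + card V / 4 * (1 - exp (- 2 * t))"
proof -
  define n where "n = real (card V)"
  define P where "P = real (card (unordered_pairs V))"
  define s where "s = t / n * P"
  have n: "0 < n" using fin V by (simp add: n_def card_gt_0_iff)
  have r: "0 \<le> t / n / real K" for K using t n by simp
  \<comment> \<open>Used with b = 0, 1, 2 for the total mass, the mean and the square; after the
    factor \<open>exp (- s)\<close> the limits are 1, exp (- t) and exp (- 2 t).\<close>
  have rate: "1 + t / n / real K * (P - b * n) = 1 + (s - b * t) / real K" for b K
    using n by (simp add: s_def field_simps)
  have lim: "(\<lambda>K. exp (- s) * (1 + (s - 1 * t) / real K) ^ K * overlap_dev V A id)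
      \<longlonglongrightarrow> exp ((s - 1 * t) - s) * overlap_dev V A id"
    by (intro tendsto_mult_right tendsto_exp_compound)
  have eq: "exp (- s) * (swap_op V (t / n / real K) ^^ K) (overlap_dev V A) id
      = exp (- s) * (1 + (s - 1 * t) / real K) ^ K * overlap_dev V A id" for K
    using swap_op_power_overlap_dev[OF fin V A permutes_id r, of K K]
    unfolding rate[symmetric] P_def[symmetric] n_def[symmetric] by simp
  have "(\<lambda>K. exp (- s) * (1 + (s - 1 * t) / real K) ^ K * overlap_dev V A id)
      \<longlonglongrightarrow> (\<Sum>\<sigma> | \<sigma> permutes V. perm_law t \<sigma> * overlap_dev V A \<sigma>)"
    using perm_law_limit[OF fin t, of "overlap_dev V A", folded n_def P_def, folded s_def]
    unfolding eq .
  from LIMSEQ_unique[OF this lim]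
  show "(\<Sum>\<sigma> | \<sigma> permutes V. perm_law t \<sigma> * overlap_dev V A \<sigma>) = exp (- t) * overlap_dev V A id"
    by simp
  let ?u = "\<lambda>K. exp (- s) * (1 + (s - 2 * t) / real K) ^ K"
  have lim_sq: "(\<lambda>K. ?u K * (overlap_dev V A id)\<^sup>2 + n / 4 * (exp (- s) * (1 + s / real K) ^ K - ?u K))
      \<longlonglongrightarrow> exp ((s - 2 * t) - s) * (overlap_dev V A id)\<^sup>2 + n / 4 * (exp (s - s) - exp ((s - 2 * t) - s))"
    by (intro tendsto_intros tendsto_exp_compound)
  \<comment> \<open>The factor for the square may be negative on a coarse grid, so its recursion is
    applied only for large \<open>K\<close>.\<close>
  have "(\<lambda>K. (s - 2 * t) / real K) \<longlonglongrightarrow> 0" by (rule lim_const_over_n)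
  then have "\<forall>\<^sub>F K in sequentially. - 1 < (s - 2 * t) / real K"
    by (rule order_tendstoD) simp
  then have "\<forall>\<^sub>F K in sequentially. exp (- s) * (swap_op V (t / n / real K) ^^ K) (\<lambda>\<sigma>. (overlap_dev V A \<sigma>)\<^sup>2) id
      \<le> ?u K * (overlap_dev V A id)\<^sup>2 + n / 4 * (exp (- s) * (1 + s / real K) ^ K - ?u K)"
  proof eventually_elim
    case (elim K)
    let ?c = "1 + (s - 2 * t) / real K"
    have "(swap_op V (t / n / real K) ^^ K) (\<lambda>\<sigma>. (overlap_dev V A \<sigma>)\<^sup>2) id
        \<le> ?c ^ K * (overlap_dev V A id)\<^sup>2 + n / 4 * ((1 + s / real K) ^ K - ?c ^ K)"
      using swap_op_power_overlap_dev_sq[OF fin V A permutes_id, of "t / n / real K" K] t n elim rate[of K 2]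
        rate[of K 0]
      by (simp add: P_def n_def)
    then have "exp (- s) * (swap_op V (t / n / real K) ^^ K) (\<lambda>\<sigma>. (overlap_dev V A \<sigma>)\<^sup>2) id
        \<le> exp (- s) * (?c ^ K * (overlap_dev V A id)\<^sup>2 + n / 4 * ((1 + s / real K) ^ K - ?c ^ K))"
      by (intro mult_left_mono) auto
    then show ?case by (simp add: algebra_simps)
  qed
  from tendsto_le[OF _ lim_sq perm_law_limit[OF fin t, of "\<lambda>\<sigma>. (overlap_dev V A \<sigma>)\<^sup>2",
        folded n_def P_def, folded s_def] this]
  show "(\<Sum>\<sigma> | \<sigma> permutes V. perm_law t \<sigma> * (overlap_dev V A \<sigma>)\<^sup>2)
      \<le> exp (- 2 * t) * (overlap_dev V A id)\<^sup>2 + card V / 4 * (1 - exp (- 2 * t))"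
    by (simp add: n_def)
qed

section \<open>The exclusion process as a kernel on subsets\<close>

lemma AE_initial_in_cube:
  assumes "finite V"
  shows "AE \<omega> in M. \<eta>0 \<omega> \<in> cube V"
proof -
  have "AE \<eta> in distr M (count_space UNIV) \<eta>0. \<eta> \<in> cube V"
    unfolding initial_uniform using assms by (simp add: AE_measure_pmf_iff)
  then show ?thesis
    by (subst (asm) AE_distr_iff[OF initial_measurable]) auto
qed

lemma expectation_joint:
  fixes F :: "('a \<Rightarrow> bool) \<Rightarrow> ('a \<Rightarrow> 'a) \<Rightarrow> real"
  assumes fin: "finite V" and t: "0 < t"
  shows "(\<integral>\<omega>. F (\<eta>0 \<omega>) (interchange_perm V (\<lambda>e. R e \<omega>) t) \<partial>M)
    = (\<Sum>A\<in>Pow V. \<Sum>\<sigma> | \<sigma> permutes V. perm_law t \<sigma> * F (config V A) \<sigma>) / 2 ^ card V"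
proof -
  let ?\<pi> = "\<lambda>\<omega>. interchange_perm V (\<lambda>e. R e \<omega>) t"
  define S where "S = {\<sigma>. \<sigma> permutes V}"
  define E where "E = (\<lambda>\<omega>0 \<sigma>. {\<omega> \<in> space M. \<eta>0 \<omega> = \<omega>0 \<and> ?\<pi> \<omega> = \<sigma>})"
  have S: "finite S" using fin by (simp add: S_def finite_permutations)
  have E: "E \<omega>0 \<sigma> \<in> events" for \<omega>0 \<sigma>
    unfolding E_def by (rule joint_event[OF fin t])
  have perm: "?\<pi> \<omega> \<in> S" if "\<omega> \<in> space M" for \<omega>
    unfolding S_def using that t by (auto intro!: interchange_perm_permutes finite_all_rings fin)
  have "?\<pi> \<in> M \<rightarrow>\<^sub>M count_space S"
    using perm measurable_sets[OF measurable_interchange_perm[OF fin t]] by (intro measurableI) auto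
  moreover have "(\<lambda>\<omega>. F (\<eta>0 \<omega>) \<sigma>) \<in> borel_measurable M" for \<sigma>
    by (rule measurable_compose[OF initial_measurable]) simp
  ultimately have meas: "(\<lambda>\<omega>. F (\<eta>0 \<omega>) (?\<pi> \<omega>)) \<in> borel_measurable M"
    using S
    by (intro measurable_compose_countable'[where f = "\<lambda>\<sigma> \<omega>. F (\<eta>0 \<omega>) \<sigma>" and g = ?\<pi> and I = S])
      (auto simp: countable_finite)
  \<comment> \<open>Almost surely the pair takes one of finitely many values, so the integrand is a
    finite combination of indicators of joint events.\<close>
  have "(\<integral>\<omega>. F (\<eta>0 \<omega>) (?\<pi> \<omega>) \<partial>M)
      = (\<integral>\<omega>. (\<Sum>\<omega>0\<in>cube V. \<Sum>\<sigma>\<in>S. F \<omega>0 \<sigma> * indicator (E \<omega>0 \<sigma>) \<omega>) \<partial>M)"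
  proof (rule integral_cong_AE)
    show "AE \<omega> in M. F (\<eta>0 \<omega>) (?\<pi> \<omega>) = (\<Sum>\<omega>0\<in>cube V. \<Sum>\<sigma>\<in>S. F \<omega>0 \<sigma> * indicator (E \<omega>0 \<sigma>) \<omega>)"
      using AE_initial_in_cube[OF fin] AE_space
    proof eventually_elim
      case (elim \<omega>)
      have "(\<Sum>\<omega>0\<in>cube V. \<Sum>\<sigma>\<in>S. F \<omega>0 \<sigma> * indicator (E \<omega>0 \<sigma>) \<omega>)
          = (\<Sum>\<omega>0\<in>cube V. if \<omega>0 = \<eta>0 \<omega> then F (\<eta>0 \<omega>) (?\<pi> \<omega>) else 0)"
      proof (intro sum.cong refl)
        fix \<omega>0
        have "(\<Sum>\<sigma>\<in>S. F \<omega>0 \<sigma> * indicator (E \<omega>0 \<sigma>) \<omega>)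
            = (\<Sum>\<sigma>\<in>S. if \<sigma> = ?\<pi> \<omega> then F \<omega>0 \<sigma> * of_bool (\<omega>0 = \<eta>0 \<omega>) else 0)"
          using elim by (intro sum.cong) (auto simp: E_def)
        also have "\<dots> = F \<omega>0 (?\<pi> \<omega>) * of_bool (\<omega>0 = \<eta>0 \<omega>)"
          using S perm[OF elim(2)] by simp
        finally show "(\<Sum>\<sigma>\<in>S. F \<omega>0 \<sigma> * indicator (E \<omega>0 \<sigma>) \<omega>)
            = (if \<omega>0 = \<eta>0 \<omega> then F (\<eta>0 \<omega>) (?\<pi> \<omega>) else 0)" by simp
      qed
      then show ?case using elim fin by simp
    qed
    show "(\<lambda>\<omega>. \<Sum>\<omega>0\<in>cube V. \<Sum>\<sigma>\<in>S. F \<omega>0 \<sigma> * indicator (E \<omega>0 \<sigma>) \<omega>) \<in> borel_measurable M"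
      using E by measurable
  qed (rule meas)
  also have "\<dots> = (\<Sum>\<omega>0\<in>cube V. \<Sum>\<sigma>\<in>S. F \<omega>0 \<sigma> * joint_law t \<omega>0 \<sigma>)"
  proof -
    have "integrable M (\<lambda>\<omega>. F \<omega>0 \<sigma> * indicator (E \<omega>0 \<sigma>) \<omega>)" for \<omega>0 \<sigma>
      using E by (intro integrable_mult_right) (simp add: emeasure_eq_measure)
    then show ?thesis
      using E by (simp add: Bochner_Integration.integral_sum joint_law_def E_def[abs_def])
  qed
  also have "\<dots> = (\<Sum>\<omega>0\<in>cube V. \<Sum>\<sigma>\<in>S. perm_law t \<sigma> * F \<omega>0 \<sigma> / 2 ^ card V)"
    by (intro sum.cong refl) (simp add: joint_law_eq[OF fin t] S_def)
  finally show ?thesis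
    by (simp add: S_def sum_cube_eq_sum_Pow sum_divide_distrib)
qed

definition exclusion_kernel :: "real \<Rightarrow> 'a set \<Rightarrow> 'a set \<Rightarrow> real" where
  "exclusion_kernel t A B = (\<Sum>\<sigma> | \<sigma> permutes V \<and> \<sigma> ` A = B. perm_law t \<sigma>)"

lemma sum_exclusion_kernel:
  assumes fin: "finite V" and A: "A \<subseteq> V"
  shows "(\<Sum>B\<in>Pow V. exclusion_kernel t A B * \<phi> B) = (\<Sum>\<sigma> | \<sigma> permutes V. perm_law t \<sigma> * \<phi> (\<sigma> ` A))"
proof -
  have "(\<Sum>B\<in>Pow V. exclusion_kernel t A B * \<phi> B)
      = (\<Sum>B\<in>Pow V. \<Sum>\<sigma> | \<sigma> \<in> {\<sigma>. \<sigma> permutes V} \<and> \<sigma> ` A = B. perm_law t \<sigma> * \<phi> (\<sigma> ` A))"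
    by (intro sum.cong refl) (simp add: exclusion_kernel_def sum_distrib_right)
  also have "\<dots> = (\<Sum>\<sigma> | \<sigma> permutes V. perm_law t \<sigma> * \<phi> (\<sigma> ` A))"
    using fin permutes_image_subset[OF _ A] by (intro sum.group) (auto simp: finite_permutations)
  finally show ?thesis .
qed

lemma expectation_exclusion:
  assumes fin: "finite V" and t: "0 < t"
  shows "(\<integral>\<omega>. f (exclusion V R \<eta>0 0 \<omega>) * f (exclusion V R \<eta>0 t \<omega>) \<partial>M)
    = (\<Sum>A\<in>Pow V. \<Sum>B\<in>Pow V. exclusion_kernel t A B * (f (config V A) * f (config V B))) / 2 ^ card V"
proof -
  have "(\<integral>\<omega>. f (exclusion V R \<eta>0 0 \<omega>) * f (exclusion V R \<eta>0 t \<omega>) \<partial>M)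
    = (\<Sum>A\<in>Pow V. \<Sum>\<sigma> | \<sigma> permutes V. perm_law t \<sigma> * (f (config V A) * f (\<lambda>x. config V A (inv \<sigma> x)))) / 2 ^ card V"
    using expectation_joint[OF fin t, of "\<lambda>\<eta> \<sigma>. f \<eta> * f (\<lambda>x. \<eta> (inv \<sigma> x))"]
    by (simp add: exclusion_def interchange_perm_0)
  also have "\<dots> = (\<Sum>A\<in>Pow V. \<Sum>\<sigma> | \<sigma> permutes V. perm_law t \<sigma> * (f (config V A) * f (config V (\<sigma> ` A)))) / 2 ^ card V"
    by (simp add: config_permute)
  also have "\<dots> = (\<Sum>A\<in>Pow V. \<Sum>B\<in>Pow V. exclusion_kernel t A B * (f (config V A) * f (config V B))) / 2 ^ card V"
    using fin by (simp add: sum_exclusion_kernel)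
  finally show ?thesis .
qed

lemma expectation_initial:
  fixes f :: "('a \<Rightarrow> bool) \<Rightarrow> real"
  assumes fin: "finite V"
  shows "(\<integral>\<omega>. f (exclusion V R \<eta>0 0 \<omega>) \<partial>M) = measure_pmf.expectation (unif_cube V) f"
proof -
  have "(\<integral>\<omega>. f (\<eta>0 \<omega>) \<partial>M) = (\<integral>\<eta>. f \<eta> \<partial>distr M (count_space UNIV) \<eta>0)"
    by (rule integral_distr[OF initial_measurable, symmetric]) simp
  then show ?thesis
    by (simp add: exclusion_def interchange_perm_0 initial_uniform)
qed

lemma exclusion_kernel_nonneg: "0 \<le> exclusion_kernel t A B"
  unfolding exclusion_kernel_def by (intro sum_nonneg perm_law_nonneg)

text \<open>Conjugation by \<open>g\<close> matches the permutations taking \<open>A\<close> to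
  \<open>B\<close> with those taking \<open>g\<close> A\<open>to\<close>g \<open>B\<close>, and the
  law is constant on conjugacy classes.\<close>

lemma exclusion_kernel_permute:
  assumes fin: "finite V" and t: "0 < t" and g: "g permutes V"
  shows "exclusion_kernel t (g ` A) (g ` B) = exclusion_kernel t A B"
proof -
  have inv_g: "inv g permutes V" "inv (inv g) = g"
    using g by (auto intro: permutes_inv permutes_inv_inv)
  have cancel: "g \<circ> (inv g \<circ> \<sigma> \<circ> g) \<circ> inv g = \<sigma>" "inv g \<circ> (g \<circ> \<sigma> \<circ> inv g) \<circ> g = \<sigma>" for \<sigma>
    using permutes_inverses[OF g] by (auto simp: fun_eq_iff)
  have img: "(g \<circ> \<sigma> \<circ> inv g) ` g ` A = g ` \<sigma> ` A" for \<sigma>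
    using permutes_inverses[OF g] by (auto simp: image_image)
  have img': "(inv g \<circ> \<sigma> \<circ> g) ` A = inv g ` \<sigma> ` g ` A" for \<sigma>
    by (auto simp: image_image)
  show ?thesis
    unfolding exclusion_kernel_def
    by (rule sum.reindex_bij_witness[where i = "\<lambda>\<sigma>. g \<circ> \<sigma> \<circ> inv g" and j = "\<lambda>\<sigma>. inv g \<circ> \<sigma> \<circ> g"])
       (use g inv_g in \<open>auto simp only: cancel img img' mem_Collect_eq permutes_image_inv[OF g]
           perm_law_conj[OF fin t, of "inv g", unfolded inv_g(2)] intro!: permutes_compose\<close>)
qed

text \<open>Up to sign, the deviation from \<open>\<mu>\<close> is that of the overlap from its
  mean, so the sum is a variance. The terms exp (- 2 t) times the squared initial deviation cancel,
  leaving at most n / 4 for every \<open>t\<close> and \<open>A\<close>. Added and removed points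
  are equally many since permutations preserve size.\<close>

lemma exclusion_kernel_variance:
  fixes \<mu> :: real
  assumes fin: "finite V" and t: "0 < t" and A: "A \<subseteq> V"
  defines "\<mu> \<equiv> (1 - exp (- t)) * card A * (real (card V) - card A) / card V"
  shows "(\<Sum>B\<in>Pow V. exclusion_kernel t A B * (card (A - B) - \<mu>)\<^sup>2) \<le> card V" (is ?removed)
    and "(\<Sum>B\<in>Pow V. exclusion_kernel t A B * (card (B - A) - \<mu>)\<^sup>2) \<le> card V" (is ?added)
proof -
  note finite_subset[OF _ fin, simp]
  define Y where "Y = overlap_dev V A"
  have bound: "(\<Sum>\<sigma> | \<sigma> permutes V. perm_law t \<sigma> * (card (A - \<sigma> ` A) - \<mu>)\<^sup>2) \<le> card V"
  proof (cases "V = {}")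
    case True
    then show ?thesis using A by (simp add: \<mu>_def)
  next
    case False
    then have n: "0 < real (card V)" using fin by (simp add: card_gt_0_iff)
    have dev: "real (card (A - \<sigma> ` A)) - \<mu> = - (Y \<sigma> - exp (- t) * Y id)" for \<sigma>
    proof -
      have "real (card (A - \<sigma> ` A)) = card A - real (card (A \<inter> \<sigma> ` A))"
        using A by (simp add: card_Diff_subset_Int card_mono of_nat_diff)
      moreover have "\<mu> = (1 - exp (- t)) * (card A - (real (card A))\<^sup>2 / card V)"
      proof -
        have "real (card A) * (real (card V) - card A) / card V = card A - (real (card A))\<^sup>2 / card V"
          using n False by (simp add: right_diff_distrib diff_divide_distrib power2_eq_square)
        then show ?thesis unfolding \<mu>_def by (metis mult.assoc times_divide_eq_right)
      qed
      ultimately show ?thesis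
        by (simp add: Y_def overlap_dev_def algebra_simps diff_divide_distrib)
    qed
    have "(\<Sum>\<sigma> | \<sigma> permutes V. perm_law t \<sigma> * (card (A - \<sigma> ` A) - \<mu>)\<^sup>2)
        = (\<Sum>\<sigma> | \<sigma> permutes V. perm_law t \<sigma> * (Y \<sigma>)\<^sup>2)
          - 2 * (exp (- t) * Y id) * (\<Sum>\<sigma> | \<sigma> permutes V. perm_law t \<sigma> * Y \<sigma>)
          + (exp (- t) * Y id)\<^sup>2 * (\<Sum>\<sigma> | \<sigma> permutes V. perm_law t \<sigma>)"
      unfolding dev sum_distrib_left sum_subtractf[symmetric] sum.distrib[symmetric]
      by (intro sum.cong refl) (simp add: power2_eq_square algebra_simps)
    also have "\<dots> = (\<Sum>\<sigma> | \<sigma> permutes V. perm_law t \<sigma> * (Y \<sigma>)\<^sup>2) - exp (- 2 * t) * (Y id)\<^sup>2"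
    proof -
      have "(exp (- t))\<^sup>2 = exp (- 2 * t)" by (simp flip: exp_double)
      then show ?thesis
        unfolding perm_law_overlap_mean[OF fin False t A, folded Y_def] sum_perm_law[OF fin t]
        by (simp add: power2_eq_square algebra_simps)
    qed
    also have "\<dots> \<le> card V / 4 * (1 - exp (- 2 * t))"
      using perm_law_overlap_sq[OF fin False t A, folded Y_def] by simp
    also have "\<dots> \<le> card V / 4 * 1"
      by (intro mult_left_mono) auto
    finally show ?thesis using n by simp
  qed
  then show ?removed
    unfolding sum_exclusion_kernel[OF fin A, of t "\<lambda>B. (card (A - B) - \<mu>)\<^sup>2"] .
  have "card (\<sigma> ` A - A) = card (A - \<sigma> ` A)" if "\<sigma> permutes V" for \<sigma>
  proof -
    have "finite (\<sigma> ` A)" "card (\<sigma> ` A) = card A"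
      using A card_permutes_image[OF that] by auto
    then show ?thesis
      using A by (simp add: card_Diff_subset_Int Int_commute)
  qed
  then show ?added
    unfolding sum_exclusion_kernel[OF fin A, of t "\<lambda>B. (card (B - A) - \<mu>)\<^sup>2"]
    using bound by simp
qed

text \<open>The means of \<open>|A - B|\<close> and \<open>|B - A|\<close> under noise are \<open>\<epsilon> m / 2\<close> and \<open>\<epsilon> (n - m) / 2\<close>, within
  \<open>|m - n / 2|\<close> of the common centre.\<close>

lemma noise_exclusion_difference:
  assumes fin: "finite V" and V: "V \<noteq> {}" and t: "0 < t" and \<epsilon>: "\<epsilon> = 1 - exp (- t)"
    and f: "f \<in> cube V \<rightarrow> {-1, 1}" and L: "1 \<le> L"
  shows "\<bar>measure_pmf.expectation (noise_pair V \<epsilon>) (\<lambda>(\<omega>, \<omega>'). f \<omega> * f \<omega>')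
      - (\<integral>\<omega>. f (exclusion V R \<eta>0 0 \<omega>) * f (exclusion V R \<eta>0 t \<omega>) \<partial>M)\<bar>
    \<le> 10 * card V / L\<^sup>2 + 8 * (\<Sum>u\<in>window (card V) (8 * L). slice_disc V (\<lambda>A. f (config V A)) u)"
proof -
  define G where "G = (\<lambda>A. f (config V A))"
  have G: "G \<in> Pow V \<rightarrow> {-1, 1}"
    using f config_in_cube unfolding G_def by blast
  have \<epsilon>01: "0 \<le> \<epsilon>" "\<epsilon> \<le> 1" using t \<epsilon> by auto
  have n: "0 < real (card V)" using fin V by (simp add: card_gt_0_iff)
  obtain e where e: "bij_betw e {..<card V} V"
    using ex_bij_betw_nat_finite[OF fin] by (auto simp: lessThan_atLeast0)
  define D where "D = (\<Sum>A\<in>Pow V. corr_ivl V G e (card A)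
      (nat \<lfloor>\<epsilon> * real (card A) * (real (card V) - card A) / card V\<rfloor>)
      (card A + nat \<lfloor>\<epsilon> * real (card A) * (real (card V) - card A) / card V\<rfloor>)) / 2 ^ card V"
  let ?bound = "5 * card V / L\<^sup>2 + 4 * (\<Sum>u\<in>window (card V) (8 * L). slice_disc V G u)"
  \<comment> \<open>In both cases the difference is, up to sign, the factor
    \<open>\<epsilon> * k / card V\<close> in [0, 1] times \<open>m - card V / 2\<close>.\<close>
  have half: "\<bar>\<epsilon> / 2 * k - \<epsilon> * m * (card V - m) / card V\<bar> \<le> \<bar>m - card V / 2\<bar>"
    if "k = m \<or> k = card V - m" "0 \<le> m" "m \<le> card V" for k m :: real
  proof -
    have le: "\<bar>x\<bar> \<le> \<bar>y\<bar>" if "x = q * y \<or> x = - (q * y)" "0 \<le> q" "q \<le> 1" for x y q :: real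
      using that by (auto simp: abs_mult mult_left_le_one_le)
    have q: "0 \<le> \<epsilon> * k / card V" "\<epsilon> * k / card V \<le> 1"
      using that \<epsilon>01 n mult_mono[of \<epsilon> 1 k "card V"] by auto
    from that(1) show ?thesis
    proof
      assume "k = m"
      then have "\<epsilon> / 2 * k - \<epsilon> * m * (card V - m) / card V = \<epsilon> * k / card V * (m - card V / 2)"
        using n by (simp add: field_simps)
      from le[OF disjI1[OF this] q] show ?thesis .
    next
      assume k: "k = card V - m"
      have "\<epsilon> / 2 * k - \<epsilon> * m * k / card V = - (\<epsilon> * k / card V * (m - card V / 2))"
        using n by (simp add: field_simps)
      from le[OF disjI2[OF this] q] show ?thesis by (simp add: k)
    qed
  qed
  have cardA: "real (card (V - A)) = card V - real (card A)" "real (card A) \<le> card V" if "A \<subseteq> V" for A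
    using that fin by (auto simp: card_Diff_subset finite_subset of_nat_diff card_mono)
  have var: "\<epsilon> / 2 * (1 - \<epsilon> / 2) * card A \<le> card V" if "A \<subseteq> V" for A
  proof -
    have "\<epsilon> / 2 * (1 - \<epsilon> / 2) * card A \<le> 1 * 1 * real (card A)"
      using \<epsilon>01 by (intro mult_right_mono mult_mono) auto
    then show ?thesis using cardA(2)[OF that] by simp
  qed
  have noise: "\<bar>(\<Sum>A\<in>Pow V. \<Sum>B\<in>Pow V. noise_kernel V \<epsilon> A B * (G A * G B)) / 2 ^ card V - D\<bar> \<le> ?bound"
    unfolding D_def
  proof (rule kernel_corr_bound[OF fin V e G \<epsilon>01 L, where \<mu> = "\<lambda>A. \<epsilon> / 2 * card A"
        and \<nu> = "\<lambda>A. \<epsilon> / 2 * card (V - A)"])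
    fix A assume A: "A \<subseteq> V"
    show "\<bar>\<epsilon> / 2 * card A - \<epsilon> * card A * (real (card V) - card A) / card V\<bar> \<le> \<bar>card A - card V / 2\<bar>"
      "\<bar>\<epsilon> / 2 * card (V - A) - \<epsilon> * card A * (real (card V) - card A) / card V\<bar> \<le> \<bar>card A - card V / 2\<bar>"
      using cardA[OF A] by (intro half; simp)+
    show "(\<Sum>B\<in>Pow V. noise_kernel V \<epsilon> A B * (card (A - B) - \<epsilon> / 2 * card A)\<^sup>2) \<le> card V"
      "(\<Sum>B\<in>Pow V. noise_kernel V \<epsilon> A B * (card (B - A) - \<epsilon> / 2 * card (V - A))\<^sup>2) \<le> card V"
      unfolding noise_kernel_variance[OF fin A] using var A by auto
  qed (use fin \<epsilon>01 in \<open>simp_all add: noise_kernel_nonneg sum_noise_kernel_eq_1 noise_kernel_permute\<close>)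
  have excl: "\<bar>(\<Sum>A\<in>Pow V. \<Sum>B\<in>Pow V. exclusion_kernel t A B * (G A * G B)) / 2 ^ card V - D\<bar> \<le> ?bound"
    unfolding D_def
  proof (rule kernel_corr_bound[OF fin V e G \<epsilon>01 L,
        where \<mu> = "\<lambda>A. \<epsilon> * card A * (real (card V) - card A) / card V"
        and \<nu> = "\<lambda>A. \<epsilon> * card A * (real (card V) - card A) / card V"])
    fix A assume A: "A \<subseteq> V"
    show "(\<Sum>B\<in>Pow V. exclusion_kernel t A B) = 1"
      using sum_exclusion_kernel[OF fin A, of t "\<lambda>_. 1"] sum_perm_law[OF fin t] by simp
    show "(\<Sum>B\<in>Pow V. exclusion_kernel t A B
          * (card (A - B) - \<epsilon> * card A * (real (card V) - card A) / card V)\<^sup>2) \<le> card V"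
      "(\<Sum>B\<in>Pow V. exclusion_kernel t A B
          * (card (B - A) - \<epsilon> * card A * (real (card V) - card A) / card V)\<^sup>2) \<le> card V"
      unfolding \<epsilon> using exclusion_kernel_variance[OF fin t A] by auto
  qed (use fin t in \<open>simp_all add: exclusion_kernel_nonneg exclusion_kernel_permute\<close>)
  have "real (10 * card V) / L\<^sup>2 = 2 * (real (5 * card V) / L\<^sup>2)" by simp
  then show ?thesis
    unfolding expectation_noise_pair[OF fin \<epsilon>01, where f = f] expectation_exclusion[OF fin t, where f = f]
    using noise excl unfolding G_def by linarith
qed

text \<open>With \<open>L = K * sqrt n\<close> the Chebyshev term becomes 10 / K^2, and the sqrt n
  from Cauchy-Schwarz cancels against the edge mass of the layers, so the bound is free of n and
  t.\<close>

lemma noise_exclusion_difference_le_II: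
  fixes K c :: real
  assumes fin: "finite V" and t: "0 < t" and \<epsilon>: "\<epsilon> = 1 - exp (- t)"
    and f: "f \<in> cube V \<rightarrow> {-1, 1}" and K: "1 \<le> K" and c: "0 < c"
    and window: "\<And>n u. u \<in> window n (8 * K * sqrt n) \<Longrightarrow>
      c * sqrt n \<le> (n choose u) * (real n - u) / 2 ^ n"
  shows "\<bar>measure_pmf.expectation (noise_pair V \<epsilon>) (\<lambda>(\<omega>, \<omega>'). f \<omega> * f \<omega>')
      - (\<integral>\<omega>. f (exclusion V R \<eta>0 0 \<omega>) * f (exclusion V R \<eta>0 t \<omega>) \<partial>M)\<bar>
    \<le> 10 / K\<^sup>2 + 8 / c * sqrt (II V f)"
proof (cases "V = {}")
  \<comment> \<open>On the empty set both kernels are 1, so the two correlations coincide.\<close>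
  case True
  have "{\<sigma>. \<sigma> permutes ({} :: 'a set)} = {id}" by auto
  then have "exclusion_kernel t {} {} = 1"
    unfolding exclusion_kernel_def using sum_perm_law[OF fin t] True by simp
  moreover have "noise_kernel V \<epsilon> {} {} = 1" using True by (simp add: noise_kernel_def)
  moreover have \<epsilon>01: "0 \<le> \<epsilon>" "\<epsilon> \<le> 1" using t \<epsilon> by auto
  ultimately show ?thesis
    unfolding expectation_noise_pair[OF fin \<epsilon>01, where f = f] expectation_exclusion[OF fin t, where f = f]
    using True c by (simp add: II_def)
next
  case False
  define n where "n = card V"
  have n: "1 \<le> sqrt n" using fin False by (simp add: n_def Suc_le_eq card_gt_0_iff)
  define L where "L = K * sqrt n"
  have "1 * 1 \<le> L" unfolding L_def using K n by (intro mult_mono) auto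
  then have L: "1 \<le> L" by simp
  have "(\<Sum>u\<in>window n (8 * L). slice_disc V (\<lambda>A. f (config V A)) u)
      \<le> (\<Sum>A\<in>Pow V. \<Sum>x\<in>V - A. pivotal (\<lambda>A. f (config V A)) A x) / 2 ^ card V / (c * sqrt n)"
    unfolding n_def
  proof (rule sum_slice_disc_le[OF fin])
    show "0 < c * sqrt (card V)" using c n by (simp add: n_def)
    show "c * sqrt (card V) \<le> (card V choose u) * (real (card V) - u) / 2 ^ card V"
      if "u \<in> window (card V) (8 * L)" for u
      using window[of u "card V"] that by (simp add: L_def n_def mult.assoc)
  qed (auto simp: window_def)
  also have "\<dots> \<le> (sqrt n * sqrt (II V f)) / (c * sqrt n)"
    using sum_pivotal_le_II[OF fin, of f] c by (intro divide_right_mono) (auto simp: n_def)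
  also have "\<dots> = sqrt (II V f) / c" using n by simp
  finally have W: "(\<Sum>u\<in>window n (8 * L). slice_disc V (\<lambda>A. f (config V A)) u) \<le> sqrt (II V f) / c" .
  have "10 * real n / L\<^sup>2 = 10 / K\<^sup>2"
    using n by (simp add: L_def power_mult_distrib)
  then show ?thesis
    using noise_exclusion_difference[OF fin False t \<epsilon> f L, folded n_def] W by simp
qed

end

theorem corollary1p17:
  fixes V :: "nat \<Rightarrow> 'a set"
    and f :: "nat \<Rightarrow> ('a \<Rightarrow> bool) \<Rightarrow> real"
    and \<epsilon> t :: "nat \<Rightarrow> real"
    and M :: "nat \<Rightarrow> 'w measure"
    and R :: "nat \<Rightarrow> 'a set \<Rightarrow> 'w \<Rightarrow> real set"
    and \<eta>0 :: "nat \<Rightarrow> 'w \<Rightarrow> 'a \<Rightarrow> bool"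
  assumes "incseq V" and "\<And>n. finite (V n)"
    and "\<And>n. complete_graph_exclusion (M n) (V n) (R n) (\<eta>0 n)"
    and "\<And>n. t n > 0" and "\<And>n. \<epsilon> n = 1 - exp (- t n)"
    and "\<And>n. f n \<in> cube (V n) \<rightarrow> {-1, 1}"
    and "(\<lambda>n. II (V n) (f n)) \<longlonglongrightarrow> 0"
  shows "NS V f \<epsilon> \<longleftrightarrow> CGXS M V R \<eta>0 f t"
proof -
  define X where "X = (\<lambda>n. measure_pmf.expectation (noise_pair (V n) (\<epsilon> n)) (\<lambda>(\<omega>, \<omega>\<epsilon>). f n \<omega> * f n \<omega>\<epsilon>))"
  define Y where "Y = (\<lambda>n. \<integral>\<omega>. f n (exclusion (V n) (R n) (\<eta>0 n) 0 \<omega>)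
      * f n (exclusion (V n) (R n) (\<eta>0 n) (t n) \<omega>) \<partial>M n)"
  define m where "m = (\<lambda>n. (measure_pmf.expectation (unif_cube (V n)) (f n))\<^sup>2)"
  have mean: "(\<integral>\<omega>. f n (exclusion (V n) (R n) (\<eta>0 n) 0 \<omega>) \<partial>M n)\<^sup>2 = m n" for n
    using complete_graph_exclusion.expectation_initial[OF assms(3)[of n] assms(2), where f = "f n"]
    by (simp add: m_def)
  have "(\<lambda>n. X n - Y n) \<longlonglongrightarrow> 0"
  proof (rule LIMSEQ_I)
    fix r :: real assume r: "0 < r"
    \<comment> \<open>Makes 10 / K^2 less than r / 2; the added 1 gives strictness.\<close>
    define K where "K = max 1 (sqrt (20 / r) + 1)"
    have K: "1 \<le> K" by (simp add: K_def)
    have "sqrt (20 / r) < K" by (simp add: K_def)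
    then have "(sqrt (20 / r))\<^sup>2 < K\<^sup>2" using r by (intro power_strict_mono) auto
    then have "20 / r < K\<^sup>2" using r by simp
    then have K2: "10 / K\<^sup>2 < r / 2" using r K by (simp add: field_simps)
    \<comment> \<open>\<open>c\<close> depends on \<open>K\<close> alone; with both fixed, the
      vanishing of \<open>II\<close> handles the remaining term.\<close>
    obtain c where c: "0 < c" and window: "\<And>n u. u \<in> window n (8 * K * sqrt n) \<Longrightarrow>
        c * sqrt n \<le> (n choose u) * (real n - u) / 2 ^ n"
      using binomial_window_lower[of "8 * K"] K by auto
    define C where "C = 8 / c"
    have bound: "\<bar>X n - Y n\<bar> \<le> 10 / K\<^sup>2 + C * sqrt (II (V n) (f n))" for n
      unfolding X_def Y_def C_def
      by (rule complete_graph_exclusion.noise_exclusion_difference_le_II[OF assms(3,2,4,5,6) K c window])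
    have "(\<lambda>n. C * sqrt (II (V n) (f n))) \<longlonglongrightarrow> C * sqrt 0"
      by (intro tendsto_intros assms(7))
    then have "\<forall>\<^sub>F n in sequentially. C * sqrt (II (V n) (f n)) < r / 2"
      using r by (intro order_tendstoD(2)) auto
    then obtain N where N: "\<And>n. N \<le> n \<Longrightarrow> C * sqrt (II (V n) (f n)) < r / 2"
      unfolding eventually_sequentially by blast
    have "norm (X n - Y n - 0) < r" if "N \<le> n" for n
      using bound[of n] N[OF that] K2 by simp
    then show "\<exists>N. \<forall>n\<ge>N. norm (X n - Y n - 0) < r" by blast
  qed
  then have diff: "(\<lambda>n. (X n - m n) - (Y n - m n)) \<longlonglongrightarrow> 0" by simp
  have "NS V f \<epsilon> \<longleftrightarrow> (\<lambda>n. X n - m n) \<longlonglongrightarrow> 0"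
    by (simp add: NS_def X_def m_def)
  also have "\<dots> \<longleftrightarrow> (\<lambda>n. Y n - m n) \<longlonglongrightarrow> 0"
  proof
    assume "(\<lambda>n. X n - m n) \<longlonglongrightarrow> 0"
    from tendsto_diff[OF this diff] show "(\<lambda>n. Y n - m n) \<longlonglongrightarrow> 0" by simp
  next
    assume "(\<lambda>n. Y n - m n) \<longlonglongrightarrow> 0"
    from tendsto_add[OF this diff] show "(\<lambda>n. X n - m n) \<longlonglongrightarrow> 0" by simp
  qed
  also have "\<dots> \<longleftrightarrow> CGXS M V R \<eta>0 f t"
    by (simp add: CGXS_def Y_def mean)
  finally show ?thesis .
qed

end
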